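(* Let $M$ be a closed orientable 3-manifold. For any transversally orientable contact structure $\xi$ on $M$ there is a Riemannian metric on $M$ such that the sectional curvature of $\xi$ in this metric is equal to $-1$, i.e. $K(\xi) \equiv -1$.
   Context: A (plane) distribution on a 3-manifold $M$ is a rank-two smooth subbundle $\xi$ of $TM$. It is a contact structure if for any linearly independent (local) sections $S, T$ of $\xi$ and any point $p$ the Lie bracket $[S,T]$ at $p$ does not belong to $\xi_p$. It is transversally orientable (transversally oriented) if there is a globally defined 1-form $\alpha$ with $\xi = \ker \alpha$; equivalently, if there is a globally defined vector field transverse to $\xi$. Given a Riemannian metric on $M$, the sectional curvature of $\xi$ is the function $K(\xi)$ on $M$ assigning to $p \in M$ the sectional curvature of the plane $\xi_p \subset T_pM$. *)

theory Defs
  imports "HOL-Analysis.Analysis" "HOL-Library.Function_Algebras"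
begin

text \<open>Pointwise scaling, so that tangent vectors (functionals on functions) form a real vector
  space and the library's \<^const>\<open>subspace\<close>, \<^const>\<open>span\<close>, \<^const>\<open>dim\<close> apply to them.\<close>

instantiation "fun" :: (type, real_vector) real_vector
begin

definition scaleR_fun :: "real \<Rightarrow> ('a \<Rightarrow> 'b) \<Rightarrow> 'a \<Rightarrow> 'b"
  where "scaleR_fun r f = (\<lambda>x. r *\<^sub>R f x)"

instance
  by standard (auto simp: scaleR_fun_def plus_fun_def algebra_simps)

end

section \<open>Smooth maps between normed spaces\<close>

text \<open>Only meant for open \<open>S\<close>.\<close>

primrec Ck_on ::
  "nat \<Rightarrow> ('a::real_normed_vector \<Rightarrow> 'b::real_normed_vector) \<Rightarrow> 'a set \<Rightarrow> bool" where
  "Ck_on 0 f S \<longleftrightarrow> continuous_on S f"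
| "Ck_on (Suc k) f S \<longleftrightarrow>
     (\<forall>x\<in>S. f differentiable (at x)) \<and>
     (\<forall>v. Ck_on k (\<lambda>x. frechet_derivative f (at x) v) S)"

definition Cinf_on :: "('a::real_normed_vector \<Rightarrow> 'b::real_normed_vector) \<Rightarrow> 'a set \<Rightarrow> bool"
  where "Cinf_on f S \<longleftrightarrow> (\<forall>k. Ck_on k f S)"

section \<open>Smooth manifolds\<close>

text \<open>The points of a manifold are those of \<open>topspace M\<close>; the values outside \<open>topspace M\<close> of
  functions, vector fields, metrics etc. are irrelevant throughout.\<close>

type_synonym ('a, 'n) chart = "'a set \<times> ('a \<Rightarrow> real ^ 'n)"

definition is_chart :: "'a topology \<Rightarrow> ('a, 'n::finite) chart \<Rightarrow> bool" where
  "is_chart M c \<longleftrightarrow> (case c of (U, \<phi>) \<Rightarrow>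
     openin M U \<and> open (\<phi> ` U) \<and>
     homeomorphic_map (subtopology M U) (top_of_set (\<phi> ` U)) \<phi>)"

definition transition :: "('a, 'n::finite) chart \<Rightarrow> ('a, 'n) chart \<Rightarrow> real ^ 'n \<Rightarrow> real ^ 'n" where
  "transition c d = snd d \<circ> inv_into (fst c) (snd c)"

definition overlap :: "('a, 'n::finite) chart \<Rightarrow> ('a, 'n) chart \<Rightarrow> (real ^ 'n) set" where
  "overlap c d = snd c ` (fst c \<inter> fst d)"

definition smooth_atlas :: "'a topology \<Rightarrow> ('a, 'n::finite) chart set \<Rightarrow> bool" where
  "smooth_atlas M A \<longleftrightarrow>
     (\<forall>c\<in>A. is_chart M c) \<and>
     (\<Union>c\<in>A. fst c) = topspace M \<and>
     (\<forall>c\<in>A. \<forall>d\<in>A. Cinf_on (transition c d) (overlap c d))"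

text \<open>The smooth structure is the one generated by the (not necessarily maximal) atlas \<open>A\<close>.\<close>

definition smooth_manifold :: "'a topology \<Rightarrow> ('a, 'n::finite) chart set \<Rightarrow> bool" where
  "smooth_manifold M A \<longleftrightarrow> Hausdorff_space M \<and> second_countable M \<and> smooth_atlas M A"

definition closed_manifold :: "'a topology \<Rightarrow> ('a, 'n::finite) chart set \<Rightarrow> bool" where
  "closed_manifold M A \<longleftrightarrow> smooth_manifold M A \<and> compact_space M"

definition oriented_atlas :: "('a, 'n::finite) chart set \<Rightarrow> bool" where
  "oriented_atlas B \<longleftrightarrow>
     (\<forall>c\<in>B. \<forall>d\<in>B. \<forall>x\<in>overlap c d.
        0 < det (matrix (frechet_derivative (transition c d) (at x))))"

text \<open>Smoothness of the atlas \<open>A \<union> B\<close> says that \<open>B\<close> defines the same smooth structure as \<open>A\<close>.\<close>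

definition orientable_manifold :: "'a topology \<Rightarrow> ('a, 'n::finite) chart set \<Rightarrow> bool" where
  "orientable_manifold M A \<longleftrightarrow>
     (\<exists>B. smooth_atlas M B \<and> smooth_atlas M (A \<union> B) \<and> oriented_atlas B)"

definition smooth_fun :: "'a topology \<Rightarrow> ('a, 'n::finite) chart set \<Rightarrow> 'a set \<Rightarrow> ('a \<Rightarrow> real) \<Rightarrow> bool"
  where "smooth_fun M A U f \<longleftrightarrow>
     openin M U \<and> (\<forall>(V, \<phi>)\<in>A. Cinf_on (f \<circ> inv_into V \<phi>) (\<phi> ` (U \<inter> V)))"

definition smooth_near :: "'a topology \<Rightarrow> ('a, 'n::finite) chart set \<Rightarrow> 'a \<Rightarrow> ('a \<Rightarrow> real) \<Rightarrow> bool"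
  where "smooth_near M A p f \<longleftrightarrow> (\<exists>U. p \<in> U \<and> smooth_fun M A U f)"

section \<open>Tangent vectors, vector fields, one-forms\<close>

text \<open>Tangent vectors at \<open>p\<close> are derivations on the functions that are smooth near \<open>p\<close>. They
  depend only on the germ at \<open>p\<close>: if \<open>f\<close> vanishes on an open neighbourhood \<open>U\<close> of \<open>p\<close>, then
  the Leibniz rule applied to \<open>f\<close> times the indicator function of \<open>U\<close> (which is smooth near
  \<open>p\<close>) gives \<open>v f = 0\<close>. The value 0 at functions not smooth near \<open>p\<close> makes \<open>v\<close> unique.\<close>

type_synonym 'a tangent = "('a \<Rightarrow> real) \<Rightarrow> real"

definition tangent_space :: "'a topology \<Rightarrow> ('a, 'n::finite) chart set \<Rightarrow> 'a \<Rightarrow> 'a tangent set" where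
  "tangent_space M A p = {v.
     (\<forall>f h a b. smooth_near M A p f \<longrightarrow> smooth_near M A p h \<longrightarrow>
        v (\<lambda>x. a * f x + b * h x) = a * v f + b * v h) \<and>
     (\<forall>f h. smooth_near M A p f \<longrightarrow> smooth_near M A p h \<longrightarrow>
        v (\<lambda>x. f x * h x) = f p * v h + h p * v f) \<and>
     (\<forall>f. \<not> smooth_near M A p f \<longrightarrow> v f = 0)}"

definition vector_field ::
  "'a topology \<Rightarrow> ('a, 'n::finite) chart set \<Rightarrow> 'a set \<Rightarrow> ('a \<Rightarrow> 'a tangent) \<Rightarrow> bool" where
  "vector_field M A U X \<longleftrightarrow>
     openin M U \<and> (\<forall>p\<in>U. X p \<in> tangent_space M A p) \<and>
     (\<forall>V f. V \<subseteq> U \<longrightarrow> smooth_fun M A V f \<longrightarrow> smooth_fun M A V (\<lambda>p. X p f))"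

definition lie_bracket ::
  "'a topology \<Rightarrow> ('a, 'n::finite) chart set \<Rightarrow> ('a \<Rightarrow> 'a tangent) \<Rightarrow> ('a \<Rightarrow> 'a tangent) \<Rightarrow> 'a \<Rightarrow> 'a tangent"
  where "lie_bracket M A X Y p =
    (\<lambda>f. if smooth_near M A p f then X p (\<lambda>q. Y q f) - Y p (\<lambda>q. X q f) else 0)"

definition one_form ::
  "'a topology \<Rightarrow> ('a, 'n::finite) chart set \<Rightarrow> ('a \<Rightarrow> 'a tangent \<Rightarrow> real) \<Rightarrow> bool" where
  "one_form M A \<alpha> \<longleftrightarrow>
     (\<forall>p\<in>topspace M. \<forall>u\<in>tangent_space M A p. \<forall>v\<in>tangent_space M A p. \<forall>a b.
        \<alpha> p (a *\<^sub>R u + b *\<^sub>R v) = a * \<alpha> p u + b * \<alpha> p v) \<and>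
     (\<forall>U X. vector_field M A U X \<longrightarrow> smooth_fun M A U (\<lambda>p. \<alpha> p (X p)))"

section \<open>Plane distributions and contact structures\<close>

definition local_section ::
  "'a topology \<Rightarrow> ('a, 'n::finite) chart set \<Rightarrow> ('a \<Rightarrow> 'a tangent set) \<Rightarrow> 'a set \<Rightarrow> ('a \<Rightarrow> 'a tangent) \<Rightarrow> bool"
  where "local_section M A \<xi> U S \<longleftrightarrow> vector_field M A U S \<and> (\<forall>p\<in>U. S p \<in> \<xi> p)"

definition lin_indep2 :: "'v::real_vector \<Rightarrow> 'v \<Rightarrow> bool"
  where "lin_indep2 u v \<longleftrightarrow> u \<noteq> v \<and> independent {u, v}"

definition plane_distribution ::
  "'a topology \<Rightarrow> ('a, 'n::finite) chart set \<Rightarrow> ('a \<Rightarrow> 'a tangent set) \<Rightarrow> bool" where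
  "plane_distribution M A \<xi> \<longleftrightarrow>
     (\<forall>p\<in>topspace M. subspace (\<xi> p) \<and> \<xi> p \<subseteq> tangent_space M A p \<and> dim (\<xi> p) = 2) \<and>
     (\<forall>p\<in>topspace M. \<exists>U S T. p \<in> U \<and> local_section M A \<xi> U S \<and> local_section M A \<xi> U T \<and>
        (\<forall>q\<in>U. \<xi> q = span {S q, T q}))"

definition contact_structure ::
  "'a topology \<Rightarrow> ('a, 'n::finite) chart set \<Rightarrow> ('a \<Rightarrow> 'a tangent set) \<Rightarrow> bool" where
  "contact_structure M A \<xi> \<longleftrightarrow>
     plane_distribution M A \<xi> \<and>
     (\<forall>U S T. local_section M A \<xi> U S \<longrightarrow> local_section M A \<xi> U T \<longrightarrow>
        (\<forall>q\<in>U. lin_indep2 (S q) (T q)) \<longrightarrow>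
        (\<forall>p\<in>U. lie_bracket M A S T p \<notin> \<xi> p))"

definition transversally_orientable ::
  "'a topology \<Rightarrow> ('a, 'n::finite) chart set \<Rightarrow> ('a \<Rightarrow> 'a tangent set) \<Rightarrow> bool" where
  "transversally_orientable M A \<xi> \<longleftrightarrow>
     (\<exists>\<alpha>. one_form M A \<alpha> \<and> (\<forall>p\<in>topspace M. \<xi> p = {v \<in> tangent_space M A p. \<alpha> p v = 0}))"

section \<open>Riemannian metrics and sectional curvature\<close>

definition riemannian_metric ::
  "'a topology \<Rightarrow> ('a, 'n::finite) chart set \<Rightarrow> ('a \<Rightarrow> 'a tangent \<Rightarrow> 'a tangent \<Rightarrow> real) \<Rightarrow> bool" where
  "riemannian_metric M A g \<longleftrightarrow>
     (\<forall>p\<in>topspace M. \<forall>u\<in>tangent_space M A p. \<forall>v\<in>tangent_space M A p.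
        g p u v = g p v u \<and>
        (u \<noteq> 0 \<longrightarrow> 0 < g p u u) \<and>
        (\<forall>w\<in>tangent_space M A p. \<forall>a b. g p (a *\<^sub>R u + b *\<^sub>R v) w = a * g p u w + b * g p v w)) \<and>
     (\<forall>U X Y. vector_field M A U X \<longrightarrow> vector_field M A U Y \<longrightarrow>
        smooth_fun M A U (\<lambda>p. g p (X p) (Y p)))"

text \<open>\<open>D p v Y\<close> is the covariant derivative at \<open>p\<close>, in direction \<open>v\<close>, of a vector field \<open>Y\<close>
  defined near \<open>p\<close>. As for tangent vectors, it depends only on the germ of \<open>Y\<close> at \<open>p\<close>, by the
  Leibniz rule for an indicator function.\<close>

type_synonym 'a connection = "'a \<Rightarrow> 'a tangent \<Rightarrow> ('a \<Rightarrow> 'a tangent) \<Rightarrow> 'a tangent"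

definition affine_connection :: "'a topology \<Rightarrow> ('a, 'n::finite) chart set \<Rightarrow> 'a connection \<Rightarrow> bool" where
  "affine_connection M A D \<longleftrightarrow>
     (\<forall>U X Y. vector_field M A U X \<longrightarrow> vector_field M A U Y \<longrightarrow>
        vector_field M A U (\<lambda>p. D p (X p) Y)) \<and>
     (\<forall>U Y. vector_field M A U Y \<longrightarrow>
        (\<forall>p\<in>U. \<forall>u\<in>tangent_space M A p. \<forall>v\<in>tangent_space M A p. \<forall>a b.
          D p (a *\<^sub>R u + b *\<^sub>R v) Y = a *\<^sub>R D p u Y + b *\<^sub>R D p v Y)) \<and>
     (\<forall>U Y Z. vector_field M A U Y \<longrightarrow> vector_field M A U Z \<longrightarrow>
        (\<forall>p\<in>U. \<forall>v\<in>tangent_space M A p.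
          D p v (\<lambda>q. Y q + Z q) = D p v Y + D p v Z)) \<and>
     (\<forall>U f Y. smooth_fun M A U f \<longrightarrow> vector_field M A U Y \<longrightarrow>
        (\<forall>p\<in>U. \<forall>v\<in>tangent_space M A p.
          D p v (\<lambda>q. f q *\<^sub>R Y q) = v f *\<^sub>R Y p + f p *\<^sub>R D p v Y))"

definition levi_civita ::
  "'a topology \<Rightarrow> ('a, 'n::finite) chart set \<Rightarrow> ('a \<Rightarrow> 'a tangent \<Rightarrow> 'a tangent \<Rightarrow> real) \<Rightarrow> 'a connection \<Rightarrow> bool"
  where "levi_civita M A g D \<longleftrightarrow>
     affine_connection M A D \<and>
     (\<forall>U X Y. vector_field M A U X \<longrightarrow> vector_field M A U Y \<longrightarrow>
        (\<forall>p\<in>U. D p (X p) Y - D p (Y p) X = lie_bracket M A X Y p)) \<and>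
     (\<forall>U Y Z. vector_field M A U Y \<longrightarrow> vector_field M A U Z \<longrightarrow>
        (\<forall>p\<in>U. \<forall>v\<in>tangent_space M A p.
          v (\<lambda>q. g q (Y q) (Z q)) = g p (D p v Y) (Z p) + g p (Y p) (D p v Z)))"

definition curvature ::
  "'a topology \<Rightarrow> ('a, 'n::finite) chart set \<Rightarrow> 'a connection \<Rightarrow>
     ('a \<Rightarrow> 'a tangent) \<Rightarrow> ('a \<Rightarrow> 'a tangent) \<Rightarrow> ('a \<Rightarrow> 'a tangent) \<Rightarrow> 'a \<Rightarrow> 'a tangent" where
  "curvature M A D X Y Z p =
     D p (X p) (\<lambda>q. D q (Y q) Z) - D p (Y p) (\<lambda>q. D q (X q) Z) - D p (lie_bracket M A X Y p) Z"

text \<open>The sectional curvature at \<open>p\<close> of the plane \<open>\<sigma>\<close> in the tangent space at \<open>p\<close>, computed from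
  any local vector fields \<open>X\<close>, \<open>Y\<close> whose values at \<open>p\<close> form a basis of \<open>\<sigma>\<close>. The Levi-Civita
  connection is unique on the arguments that matter, and the value does not depend on the choice
  of \<open>X\<close>, \<open>Y\<close>. The sign is such that round spheres have positive curvature.\<close>

definition sectional_curvature ::
  "'a topology \<Rightarrow> ('a, 'n::finite) chart set \<Rightarrow> ('a \<Rightarrow> 'a tangent \<Rightarrow> 'a tangent \<Rightarrow> real) \<Rightarrow>
     'a \<Rightarrow> 'a tangent set \<Rightarrow> real" where
  "sectional_curvature M A g p \<sigma> =
     (THE K. \<exists>D U X Y. levi_civita M A g D \<and> p \<in> U \<and> vector_field M A U X \<and> vector_field M A U Y \<and>
        lin_indep2 (X p) (Y p) \<and> span {X p, Y p} = \<sigma> \<and>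
        K = g p (curvature M A D X Y Y p) (X p) /
            (g p (X p) (X p) * g p (Y p) (Y p) - (g p (X p) (Y p))\<^sup>2))"

definition distribution_curvature ::
  "'a topology \<Rightarrow> ('a, 'n::finite) chart set \<Rightarrow> ('a \<Rightarrow> 'a tangent \<Rightarrow> 'a tangent \<Rightarrow> real) \<Rightarrow>
     ('a \<Rightarrow> 'a tangent set) \<Rightarrow> 'a \<Rightarrow> real" where
  "distribution_curvature M A g \<xi> p = sectional_curvature M A g p (\<xi> p)"

end

theory Submission
  imports Defs "HOL-Real_Asymp.Real_Asymp"
begin

text \<open>Let \<open>\<xi> = ker \<alpha>\<close>, fix any Riemannian metric \<open>g\<close> with unit normal \<open>n\<close> of \<open>\<xi>\<close>, and rescale \<open>g\<close> by a
  constant \<open>s\<close> along \<open>\<xi>\<close> and by a function \<open>u\<close> along \<open>n\<close>. In an orthonormal frame \<open>e\<^sub>1, e\<^sub>2 \<in> \<xi>\<close>,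
  \<open>e\<^sub>3 = n\<close> of \<open>g\<close>, the connection coefficients show that no derivative of \<open>u\<close> enters
  the sectional curvature of \<open>\<xi>\<close> in the new metric: it is \<open>- C u / s\<^sup>2 + P / s + Q / u\<close>, where \<open>C, P, Q\<close> depend
  only on \<open>g\<close> and \<open>C = 3/4 g([e\<^sub>1, e\<^sub>2], e\<^sub>3)\<^sup>2 > 0\<close> by the contact condition. With \<open>u = s v\<close>, curvature
  \<open>-1\<close> becomes the quadratic equation \<open>C v\<^sup>2 = (P + s) v + Q\<close>. By compactness, for
  large \<open>s\<close> it has a root \<open>v\<close> that is positive and smooth on \<open>M\<close>.\<close>

section \<open>Calculus of smooth functions on normed spaces\<close>

text \<open>The normal is the direction to stretch by a function because differentiating the factor
  \<open>1 / sqrt (u q)\<close> produces only multiples of the normal in the brackets of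
  \<open>E 1\<close>, \<open>E 2\<close> with the rescaled normal, and the normal components of
  those brackets do not occur in the curvature of the plane of \<open>E 1\<close>,
  \<open>E 2\<close>. The factor along \<xi> is kept constant because its derivatives would occur.
  The constant s solves the quadratic: it is added to the bounded function P, so a large s outweighs
  both a negative P and a negative Q.

  Two obstacles shape the rest. Sectional curvature is a definite description over all Levi-Civita
  connections of the whole manifold and all local fields spanning the plane, so computing it takes a
  global connection as well as independence of every choice; both are obtained from local
  orthonormal frames. And tangent vectors are derivations on functions, with no basis at hand:
  frames come from the contact condition, and the initial metric is built from such frames.\<close>

lemma Ck_on_cong:
  assumes "open S" "\<And>x. x \<in> S \<Longrightarrow> f x = g x" "Ck_on k f S"
  shows "Ck_on k g S"
  using assms(2,3)
proof (induction k arbitrary: f g)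
  case 0
  then show ?case using continuous_on_cong[of S S f g] by auto
next
  case (Suc k)
  have d: "(g has_derivative frechet_derivative f (at x)) (at x)" if "x \<in> S" for x
  proof -
    have "(f has_derivative frechet_derivative f (at x)) (at x)"
      using that Suc.prems(2) frechet_derivative_works by auto
    then show ?thesis
      by (rule has_derivative_transform_within_open[OF _ assms(1) that]) (rule Suc.prems(1))
  qed
  have "Ck_on k (\<lambda>x. frechet_derivative g (at x) v) S" for v
  proof (rule Suc.IH)
    show "Ck_on k (\<lambda>x. frechet_derivative f (at x) v) S"
      using Suc.prems(2) by simp
    show "frechet_derivative f (at x) v = frechet_derivative g (at x) v" if "x \<in> S" for x
      using frechet_derivative_at[OF d[OF that]] by simp
  qed
  moreover have "\<forall>x\<in>S. g differentiable (at x)"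
    using d unfolding differentiable_def by blast
  ultimately show ?case
    by simp
qed

text \<open>Trades the derivative chosen inside \<open>Ck_on\<close> for any explicitly known one;
  the closure properties under algebraic operations and composition are inductions on k that feed a
  differentiation rule into it.\<close>

lemma Ck_on_Suc:
  assumes "open S" "\<And>x. x \<in> S \<Longrightarrow> (f has_derivative f' x) (at x)" "\<And>v. Ck_on k (\<lambda>x. f' x v) S"
  shows "Ck_on (Suc k) f S"
proof -
  have "f' x v = frechet_derivative f (at x) v" if "x \<in> S" for x v
    using frechet_derivative_at[OF assms(2)[OF that]] by simp
  then have "Ck_on k (\<lambda>x. frechet_derivative f (at x) v) S" for v
    by (rule Ck_on_cong[OF assms(1) _ assms(3)])
  moreover have "\<forall>x\<in>S. f differentiable (at x)"
    using assms(2) unfolding differentiable_def by blast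
  ultimately show ?thesis
    by simp
qed

lemma Ck_on_Suc_derivative:
  "Ck_on (Suc k) f S \<Longrightarrow> x \<in> S \<Longrightarrow> (f has_derivative frechet_derivative f (at x)) (at x)"
  using frechet_derivative_works by auto

lemma Ck_on_Suc_imp: "Ck_on (Suc k) f S \<Longrightarrow> Ck_on k f S"
proof (induction k arbitrary: f)
  case 0
  then show ?case
    by (auto intro!: continuous_at_imp_continuous_on differentiable_imp_continuous_within)
next
  case (Suc k)
  then show ?case using Ck_on.simps(2) by blast
qed

lemma Ck_on_subset: "Ck_on k f S \<Longrightarrow> T \<subseteq> S \<Longrightarrow> Ck_on k f T"
  by (induction k arbitrary: f) (auto intro: continuous_on_subset)

lemma Ck_on_locally:
  assumes "\<And>x. x \<in> S \<Longrightarrow> \<exists>T. open T \<and> x \<in> T \<and> Ck_on k f T"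
  shows "Ck_on k f S"
  using assms
proof (induction k arbitrary: f)
  case 0
  then show ?case
    by (metis Ck_on.simps(1) continuous_at_imp_continuous_on continuous_on_eq_continuous_at)
next
  case (Suc k)
  have "f differentiable (at x)" if "x \<in> S" for x
    using Suc.prems[OF that] by auto
  moreover have "Ck_on k (\<lambda>x. frechet_derivative f (at x) v) S" for v
  proof (rule Suc.IH)
    show "\<exists>T. open T \<and> x \<in> T \<and> Ck_on k (\<lambda>x. frechet_derivative f (at x) v) T" if "x \<in> S" for x
      using Suc.prems[OF that] by auto
  qed
  ultimately show ?case
    by simp
qed

lemma Ck_on_const: "open S \<Longrightarrow> Ck_on k (\<lambda>x. c) S"
proof (induction k arbitrary: c)
  case (Suc k)
  show ?case
    by (rule Ck_on_Suc[where f' = "\<lambda>x v. 0"]) (use Suc in simp_all)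
qed simp

lemma Ck_on_add:
  assumes "open S" "Ck_on k f S" "Ck_on k g S"
  shows "Ck_on k (\<lambda>x. f x + g x) S"
  using assms(2,3)
proof (induction k arbitrary: f g)
  case 0
  then show ?case by (auto intro: continuous_intros)
next
  case (Suc k)
  note d = Ck_on_Suc_derivative[OF Suc.prems(1)] Ck_on_Suc_derivative[OF Suc.prems(2)]
  show ?case
    by (rule Ck_on_Suc[OF assms(1) has_derivative_add[OF d]]) (use Suc in auto)
qed

lemma Ck_on_bounded_linear:
  assumes "open S" "bounded_linear h" "Ck_on k f S"
  shows "Ck_on k (\<lambda>x. h (f x)) S"
  using assms(3)
proof (induction k arbitrary: f)
  case 0
  then show ?case by (auto intro: bounded_linear.continuous_on[OF assms(2)])
next
  case (Suc k)
  note d = Ck_on_Suc_derivative[OF Suc.prems(1)]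
  show ?case
    by (rule Ck_on_Suc[OF assms(1) bounded_linear.has_derivative[OF assms(2) d]]) (use Suc in auto)
qed

text \<open>The product rule returns f and g undifferentiated, so the induction step must also drop
  one order of smoothness.\<close>

lemma Ck_on_mult:
  fixes f g :: "'a::real_normed_vector \<Rightarrow> real"
  assumes "open S" "Ck_on k f S" "Ck_on k g S"
  shows "Ck_on k (\<lambda>x. f x * g x) S"
  using assms(2,3)
proof (induction k arbitrary: f g)
  case 0
  then show ?case by (auto intro: continuous_intros)
next
  case (Suc k)
  note d = Ck_on_Suc_derivative[OF Suc.prems(1)] Ck_on_Suc_derivative[OF Suc.prems(2)]
  show ?case
    by (rule Ck_on_Suc[OF assms(1) has_derivative_mult[OF d]])
      (use Suc.prems Ck_on_Suc_imp[OF Suc.prems(1)] Ck_on_Suc_imp[OF Suc.prems(2)]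
        in \<open>auto intro!: Ck_on_add[OF assms(1)] Suc.IH\<close>)
qed

text \<open>With real intermediate values the derivative of h is multiplication by a number, and the
  chain rule reduces to products. The outer functions that occur are \<open>inverse\<close>,
  \<open>sqrt\<close> and \<open>flat_exp\<close>; changes of chart are covered by the compatibility
  condition of the atlas.\<close>

lemma Ck_on_compose_real:
  fixes f :: "'a::real_normed_vector \<Rightarrow> real" and h :: "real \<Rightarrow> real"
  assumes "open S" "open T" "f ` S \<subseteq> T" "Ck_on k h T" "Ck_on k f S"
  shows "Ck_on k (\<lambda>x. h (f x)) S"
  using assms(3-5)
proof (induction k arbitrary: f h)
  case 0
  then show ?case by (auto intro: continuous_on_compose2)
next
  case (Suc k)
  let ?h' = "\<lambda>y. frechet_derivative h (at y) 1" and ?f' = "\<lambda>x. frechet_derivative f (at x)"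
  have d: "((\<lambda>x. h (f x)) has_derivative (\<lambda>v. ?f' x v * ?h' (f x))) (at x)" if "x \<in> S" for x
  proof -
    have h: "(h has_derivative frechet_derivative h (at (f x))) (at (f x))"
      using Ck_on_Suc_derivative[OF Suc.prems(2)] Suc.prems(1) that by auto
    have "frechet_derivative h (at (f x)) r = r * ?h' (f x)" for r
      using linear_scale[OF has_derivative_linear[OF h], of r 1] by simp
    then have "frechet_derivative h (at (f x)) = (\<lambda>r. r * ?h' (f x))"
      by (rule ext)
    then have "(h has_derivative (\<lambda>r. r * ?h' (f x))) (at (f x))"
      using h by metis
    with Ck_on_Suc_derivative[OF Suc.prems(3) that] show ?thesis
      by (rule has_derivative_compose)
  qed
  have "Ck_on k (\<lambda>x. ?h' (f x)) S"
    using Suc.IH[of f ?h'] Suc.prems(1,2) Ck_on_Suc_imp[OF Suc.prems(3)] by simp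
  then show ?case
    by (intro Ck_on_Suc[OF assms(1) d] Ck_on_mult[OF assms(1)]) (use Suc.prems(3) in auto)
qed

lemma Ck_on_inverse: "Ck_on k inverse (- {0::real})"
proof (induction k)
  case 0
  then show ?case by (auto intro!: continuous_intros)
next
  case (Suc k)
  have "Ck_on k (\<lambda>x::real. - (v * (inverse x * inverse x))) (- {0})" for v
    using Suc by (auto intro!: Ck_on_bounded_linear[OF _ bounded_linear_minus[OF bounded_linear_ident]]
        Ck_on_mult Ck_on_const)
  then show ?case
    by (intro Ck_on_Suc[where f' = "\<lambda>x v. - (v * (inverse x * inverse x))"])
      (auto intro!: derivative_eq_intros)
qed

lemma Ck_on_sqrt: "Ck_on k sqrt {0<..}"
proof (induction k)
  case 0
  then show ?case by (auto intro!: continuous_intros)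
next
  case (Suc k)
  have "Ck_on k (\<lambda>x. inverse (sqrt x)) {0<..}"
    by (rule Ck_on_compose_real[OF _ _ _ Ck_on_inverse Suc]) auto
  then have "Ck_on k (\<lambda>x. v * ((1 / 2) * inverse (sqrt x))) {0<..}" for v
    by (intro Ck_on_mult Ck_on_const) auto
  then show ?case
    by (intro Ck_on_Suc[where f' = "\<lambda>x v. v * ((1 / 2) * inverse (sqrt x))"])
      (auto intro!: derivative_eq_intros simp: field_simps)
qed

text \<open>The powers of t in the denominator close the family under differentiation, so that one
  induction over all n gives smoothness. The member n = 0 is the profile of the bump
  functions.\<close>

definition flat_exp :: "nat \<Rightarrow> real \<Rightarrow> real"
  where "flat_exp n t = (if t > 0 then exp (- (1 / t)) / t ^ n else 0)"

lemma flat_exp_tendsto: "(flat_exp n \<longlongrightarrow> 0) (at 0)"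
proof -
  have "((\<lambda>t::real. exp (- (1 / t)) / t ^ n) \<longlongrightarrow> 0) (at_right 0)"
    by real_asymp
  then have "(flat_exp n \<longlongrightarrow> 0) (at_right 0)"
    by (rule Lim_transform_eventually)
      (auto simp: flat_exp_def eventually_at_filter)
  moreover have "(flat_exp n \<longlongrightarrow> 0) (at_left 0)"
    by (rule tendsto_eventually) (auto simp: flat_exp_def eventually_at_filter)
  ultimately show ?thesis
    by (simp add: filterlim_split_at)
qed

lemma flat_exp_deriv:
  "(flat_exp n has_real_derivative flat_exp (n + 2) t - real n * flat_exp (n + 1) t) (at t)"
proof -
  consider "t > 0" | "t < 0" | "t = 0" by linarith
  then show ?thesis
  proof cases
    case 1
    have "((\<lambda>t. exp (- (1 / t)) / t ^ n) has_real_derivative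
        (exp (- (1 / t)) * (1 / t\<^sup>2) * t ^ n - exp (- (1 / t)) * (real n * t ^ (n - 1))) / (t ^ n * t ^ n)) (at t)"
      using 1 by (auto intro!: derivative_eq_intros simp: power2_eq_square)
    moreover have "real n * t ^ (n - 1) = real n * t ^ n / t"
      using 1 by (cases n) auto
    moreover have "(exp (- (1 / t)) * (1 / t\<^sup>2) * t ^ n - exp (- (1 / t)) * (real n * t ^ n / t)) / (t ^ n * t ^ n)
        = flat_exp (n + 2) t - real n * flat_exp (n + 1) t"
      using 1 by (simp add: flat_exp_def field_simps power2_eq_square power_add)
    ultimately have "((\<lambda>t. exp (- (1 / t)) / t ^ n) has_real_derivative
        flat_exp (n + 2) t - real n * flat_exp (n + 1) t) (at t)"
      by simp
    then show ?thesis
      by (rule has_field_derivative_transform_within_open[of _ _ _ "{0<..}"])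
        (use 1 in \<open>auto simp: flat_exp_def\<close>)
  next
    case 2
    have "((\<lambda>t. 0) has_real_derivative flat_exp (n + 2) t - real n * flat_exp (n + 1) t) (at t)"
      using 2 by (auto simp: flat_exp_def)
    then show ?thesis
      by (rule has_field_derivative_transform_within_open[of _ _ _ "{..<0}"])
        (use 2 in \<open>auto simp: flat_exp_def\<close>)
  next
    case 3
    \<comment> \<open>The difference quotient at 0 is the next member of the family, which tends to
      0; the claimed derivative is 0 there because every member vanishes at 0.\<close>
    have "flat_exp n h / h = flat_exp (n + 1) h" for h
      by (simp add: flat_exp_def)
    then show ?thesis
      using flat_exp_tendsto[of "n + 1"] 3 by (simp add: DERIV_def flat_exp_def[of _ 0])
  qed
qed

lemma Ck_on_flat_exp: "Ck_on k (flat_exp n) UNIV"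
proof (induction k arbitrary: n)
  case 0
  then show ?case using flat_exp_deriv by (auto intro: DERIV_isCont continuous_at_imp_continuous_on)
next
  case (Suc k)
  have "Ck_on k (\<lambda>t. (flat_exp (n + 2) t + (- real n) * flat_exp (n + 1) t) * v) UNIV" for v
    by (intro Ck_on_add Ck_on_mult Ck_on_const Suc) auto
  then show ?case
    using flat_exp_deriv
    by (intro Ck_on_Suc[where f' = "\<lambda>t v. (flat_exp (n + 2) t + (- real n) * flat_exp (n + 1) t) * v"])
      (auto simp: has_field_derivative_def)
qed

section \<open>Smooth functions, tangent vectors and vector fields\<close>

locale smooth_space =
  fixes M :: "'a topology" and A :: "('a, 'n::finite) chart set"
  assumes atlas: "smooth_atlas M A"
begin

abbreviation "smooth \<equiv> smooth_fun M A"
abbreviation "near \<equiv> smooth_near M A"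
abbreviation "tanv \<equiv> tangent_space M A"
abbreviation "vfield \<equiv> vector_field M A"
abbreviation "bracket \<equiv> lie_bracket M A"

section \<open>Charts and the algebra of smooth functions\<close>

lemma chartD:
  assumes "(V, \<phi>) \<in> A"
  shows "openin M V" "open (\<phi> ` V)"
    "homeomorphic_map (subtopology M V) (top_of_set (\<phi> ` V)) \<phi>" "V \<subseteq> topspace M" "inj_on \<phi> V"
proof -
  have c: "is_chart M (V, \<phi>)"
    using atlas assms unfolding smooth_atlas_def by blast
  then show o: "openin M V" and "open (\<phi> ` V)"
    and h: "homeomorphic_map (subtopology M V) (top_of_set (\<phi> ` V)) \<phi>"
    by (auto simp: is_chart_def)
  show V: "V \<subseteq> topspace M"
    using o by (rule openin_subset)
  show "inj_on \<phi> V"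
    using homeomorphic_imp_injective_map[OF h] V by (simp add: topspace_subtopology Int_absorb1)
qed

lemma chart_exists: "p \<in> topspace M \<Longrightarrow> \<exists>V \<phi>. (V, \<phi>) \<in> A \<and> p \<in> V"
proof -
  assume "p \<in> topspace M"
  then have "p \<in> (\<Union>c\<in>A. fst c)"
    using atlas by (simp add: smooth_atlas_def)
  then show ?thesis
    by auto
qed

lemma open_chart_image:
  assumes "(V, \<phi>) \<in> A" "openin M U"
  shows "open (\<phi> ` (U \<inter> V))"
proof -
  have "openin (subtopology M V) (U \<inter> V)"
    using assms(2) by (auto simp: openin_subtopology)
  then have "openin (top_of_set (\<phi> ` V)) (\<phi> ` (U \<inter> V))"
    using homeomorphic_imp_open_map[OF chartD(3)[OF assms(1)]] by (simp add: open_map_def)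
  then show ?thesis
    using openin_open_eq[OF chartD(2)[OF assms(1)]] by blast
qed

lemma open_chart_vimage:
  assumes "(V, \<phi>) \<in> A" "open T"
  shows "openin M {q \<in> V. \<phi> q \<in> T}"
proof -
  have "continuous_map (subtopology M V) (top_of_set (\<phi> ` V)) \<phi>"
    using homeomorphic_imp_continuous_map[OF chartD(3)[OF assms(1)]] .
  then have "continuous_map (subtopology M V) euclidean \<phi>"
    using continuous_map_in_subtopology by blast
  then have "openin (subtopology M V) {q \<in> topspace (subtopology M V). \<phi> q \<in> T}"
    using assms(2) by (simp add: continuous_map_def)
  moreover have "topspace (subtopology M V) = V"
    using chartD(4)[OF assms(1)] by auto
  ultimately show ?thesis
    using openin_trans_full[OF _ chartD(1)[OF assms(1)], of "{q \<in> V. \<phi> q \<in> T}"] by metis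
qed

lemma smoothI:
  assumes "openin M U"
    and "\<And>V \<phi> k. (V, \<phi>) \<in> A \<Longrightarrow> Ck_on k (\<lambda>x. f (inv_into V \<phi> x)) (\<phi> ` (U \<inter> V))"
  shows "smooth U f"
  using assms by (auto simp: smooth_fun_def Cinf_on_def comp_def)

lemma smoothD:
  assumes "smooth U f" "(V, \<phi>) \<in> A"
  shows "Ck_on k (\<lambda>x. f (inv_into V \<phi> x)) (\<phi> ` (U \<inter> V))"
  using assms by (auto simp: smooth_fun_def Cinf_on_def comp_def)

lemma smooth_open: "smooth U f \<Longrightarrow> openin M U"
  by (simp add: smooth_fun_def)

lemma smooth_cong:
  assumes "smooth U f" "\<And>q. q \<in> U \<Longrightarrow> f q = h q"
  shows "smooth U h"
proof (rule smoothI[OF smooth_open[OF assms(1)]])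
  fix V \<phi> k assume V: "(V, \<phi>) \<in> A"
  show "Ck_on k (\<lambda>x. h (inv_into V \<phi> x)) (\<phi> ` (U \<inter> V))"
    by (rule Ck_on_cong[OF open_chart_image[OF V smooth_open[OF assms(1)]] _ smoothD[OF assms(1) V]])
      (use assms(2) chartD(5)[OF V] in auto)
qed

lemma smooth_subset:
  assumes "smooth U f" "openin M W" "W \<subseteq> U"
  shows "smooth W f"
proof (rule smoothI[OF assms(2)])
  fix V \<phi> k assume V: "(V, \<phi>) \<in> A"
  show "Ck_on k (\<lambda>x. f (inv_into V \<phi> x)) (\<phi> ` (W \<inter> V))"
    by (rule Ck_on_subset[OF smoothD[OF assms(1) V]]) (use assms(3) in auto)
qed

lemma smooth_local:
  assumes "openin M U" "\<And>p. p \<in> U \<Longrightarrow> \<exists>W. p \<in> W \<and> smooth W f"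
  shows "smooth U f"
proof (rule smoothI[OF assms(1)])
  fix V \<phi> k assume V: "(V, \<phi>) \<in> A"
  show "Ck_on k (\<lambda>x. f (inv_into V \<phi> x)) (\<phi> ` (U \<inter> V))"
  proof (rule Ck_on_locally)
    fix x assume "x \<in> \<phi> ` (U \<inter> V)"
    then obtain p where p: "x = \<phi> p" "p \<in> U" "p \<in> V" by auto
    then obtain W where W: "p \<in> W" "smooth W f" using assms(2) by blast
    then show "\<exists>T. open T \<and> x \<in> T \<and> Ck_on k (\<lambda>x. f (inv_into V \<phi> x)) T"
      using open_chart_image[OF V smooth_open[OF W(2)]] smoothD[OF W(2) V] p by blast
  qed
qed

lemma smooth_const: "openin M U \<Longrightarrow> smooth U (\<lambda>q. c)"
  by (intro smoothI Ck_on_const open_chart_image)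

lemma smooth_add:
  assumes "smooth U f" "smooth U h"
  shows "smooth U (\<lambda>q. f q + h q)"
proof (rule smoothI[OF smooth_open[OF assms(1)]])
  fix V \<phi> k assume V: "(V, \<phi>) \<in> A"
  show "Ck_on k (\<lambda>x. f (inv_into V \<phi> x) + h (inv_into V \<phi> x)) (\<phi> ` (U \<inter> V))"
    by (rule Ck_on_add[OF open_chart_image[OF V smooth_open[OF assms(1)]]
          smoothD[OF assms(1) V] smoothD[OF assms(2) V]])
qed

lemma smooth_mult:
  assumes "smooth U f" "smooth U h"
  shows "smooth U (\<lambda>q. f q * h q)"
proof (rule smoothI[OF smooth_open[OF assms(1)]])
  fix V \<phi> k assume V: "(V, \<phi>) \<in> A"
  show "Ck_on k (\<lambda>x. f (inv_into V \<phi> x) * h (inv_into V \<phi> x)) (\<phi> ` (U \<inter> V))"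
    by (rule Ck_on_mult[OF open_chart_image[OF V smooth_open[OF assms(1)]]
          smoothD[OF assms(1) V] smoothD[OF assms(2) V]])
qed

lemma smooth_compose_real:
  assumes "smooth U f" "open T" "\<And>q. q \<in> U \<Longrightarrow> f q \<in> T" "\<And>k. Ck_on k h T"
  shows "smooth U (\<lambda>q. h (f q))"
proof (rule smoothI[OF smooth_open[OF assms(1)]])
  fix V \<phi> k assume V: "(V, \<phi>) \<in> A"
  show "Ck_on k (\<lambda>x. h (f (inv_into V \<phi> x))) (\<phi> ` (U \<inter> V))"
    by (rule Ck_on_compose_real[OF _ assms(2) _ assms(4) smoothD[OF assms(1) V]])
      (use assms(3) open_chart_image[OF V smooth_open[OF assms(1)]] chartD(5)[OF V] in auto)
qed

lemma smooth_minus: "smooth U f \<Longrightarrow> smooth U (\<lambda>q. - f q)"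
  using smooth_mult[OF smooth_const[of U "-1"], of f] smooth_open by simp

lemma smooth_diff: "smooth U f \<Longrightarrow> smooth U h \<Longrightarrow> smooth U (\<lambda>q. f q - h q)"
  using smooth_add[of U f "\<lambda>q. - h q"] smooth_minus by simp

lemma smooth_divide:
  assumes "smooth U f" "smooth U h" "\<And>q. q \<in> U \<Longrightarrow> h q \<noteq> 0"
  shows "smooth U (\<lambda>q. f q / h q)"
  unfolding divide_inverse
  by (rule smooth_mult[OF assms(1) smooth_compose_real[OF assms(2) _ _ Ck_on_inverse]])
    (use assms(3) in auto)

lemma smooth_sqrt:
  assumes "smooth U f" "\<And>q. q \<in> U \<Longrightarrow> f q > 0"
  shows "smooth U (\<lambda>q. sqrt (f q))"
  by (rule smooth_compose_real[OF assms(1) _ _ Ck_on_sqrt]) (use assms(2) in auto)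

lemma smooth_power: "smooth U f \<Longrightarrow> smooth U (\<lambda>q. f q ^ n)"
  by (induction n) (auto intro: smooth_const smooth_open smooth_mult)

lemma smooth_sum:
  assumes "openin M U" "\<And>i. i \<in> I \<Longrightarrow> smooth U (f i)"
  shows "smooth U (\<lambda>q. \<Sum>i\<in>I. f i q)"
  using assms(2)
  by (induction I rule: infinite_finite_induct) (auto intro: smooth_const assms(1) smooth_add)

lemmas smooth_intros = smooth_const smooth_add smooth_mult smooth_minus smooth_diff smooth_divide
  smooth_sqrt smooth_power smooth_sum

text \<open>Continuity of smooth functions for the topology of M: the case k = 0 in each chart,
  pulled back by the chart.\<close>

lemma smooth_open_vimage:
  assumes "smooth U f" "open T"
  shows "openin M {q \<in> U. f q \<in> T}"
proof (subst openin_subopen, rule ballI)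
  fix p assume p: "p \<in> {q \<in> U. f q \<in> T}"
  then have "p \<in> topspace M" using smooth_open[OF assms(1)] openin_subset by blast
  then obtain V \<phi> where V: "(V, \<phi>) \<in> A" "p \<in> V" using chart_exists by blast
  let ?S = "\<phi> ` (U \<inter> V)" and ?F = "\<lambda>x. f (inv_into V \<phi> x)"
  have "continuous_on ?S ?F" "open ?S"
    using smoothD[OF assms(1) V(1), of 0] open_chart_image[OF V(1) smooth_open[OF assms(1)]] by auto
  then have "open (?F -` T \<inter> ?S)"
    using assms(2) continuous_on_open_vimage by blast
  then have "openin M {q \<in> V. \<phi> q \<in> ?F -` T \<inter> ?S}"
    by (rule open_chart_vimage[OF V(1)])
  moreover have "\<phi> q \<in> ?F -` T \<inter> ?S \<longleftrightarrow> q \<in> U \<and> f q \<in> T" if "q \<in> V" for q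
    using inj_on_image_mem_iff[OF chartD(5)[OF V(1)] that, of "U \<inter> V"]
      inv_into_f_f[OF chartD(5)[OF V(1)] that] that by auto
  then have "{q \<in> V. \<phi> q \<in> ?F -` T \<inter> ?S} = {q \<in> U \<inter> V. f q \<in> T}"
    by blast
  ultimately have "openin M {q \<in> U \<inter> V. f q \<in> T}"
    by simp
  then show "\<exists>W. openin M W \<and> p \<in> W \<and> W \<subseteq> {q \<in> U. f q \<in> T}"
    using p V(2) by (intro exI[of _ "{q \<in> U \<inter> V. f q \<in> T}"]) auto
qed

lemma smooth_bounded:
  assumes "compact_space M" "smooth (topspace M) f"
  shows "\<exists>B. \<forall>q\<in>topspace M. \<bar>f q\<bar> \<le> B"
proof -
  have "continuous_map M euclidean f"
    using smooth_open_vimage[OF assms(2)] by (auto simp: continuous_map_def)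
  then have "compactin euclidean (f ` topspace M)"
    using assms(1) image_compactin unfolding compact_space_def by blast
  then have "bounded (f ` topspace M)"
    by (simp add: compact_imp_bounded)
  then show ?thesis
    by (auto simp: bounded_iff)
qed

lemma nearI: "smooth U f \<Longrightarrow> p \<in> U \<Longrightarrow> near p f"
  by (auto simp: smooth_near_def)

lemma nearE:
  assumes "near p f" obtains U where "p \<in> U" "smooth U f" "openin M U"
  using assms smooth_open by (auto simp: smooth_near_def)

lemma near_binop:
  assumes "near p f" "near p h" "\<And>U. smooth U f \<Longrightarrow> smooth U h \<Longrightarrow> smooth U k"
  shows "near p k"
proof -
  obtain U W where "p \<in> U" "smooth U f" "p \<in> W" "smooth W h"
    using assms by (auto simp: smooth_near_def)
  then have "smooth (U \<inter> W) k"
    by (intro assms(3)) (auto intro: smooth_subset smooth_open)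
  then show ?thesis
    using \<open>p \<in> U\<close> \<open>p \<in> W\<close> by (auto intro: nearI)
qed

lemma near_add: "near p f \<Longrightarrow> near p h \<Longrightarrow> near p (\<lambda>x. f x + h x)"
  by (erule (1) near_binop) (rule smooth_add)

lemma near_mult: "near p f \<Longrightarrow> near p h \<Longrightarrow> near p (\<lambda>x. f x * h x)"
  by (erule (1) near_binop) (rule smooth_mult)

lemma near_const: "p \<in> topspace M \<Longrightarrow> near p (\<lambda>x. c)"
  by (rule nearI[OF smooth_const[OF openin_topspace]])

lemma near_topspace: "near p f \<Longrightarrow> p \<in> topspace M"
  by (metis nearE openin_subset subsetD)

lemma near_cong:
  assumes "near p f" "openin M W" "p \<in> W" "\<And>q. q \<in> W \<Longrightarrow> f q = h q"
  shows "near p h"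
proof -
  obtain U where "p \<in> U" "smooth U f" using assms(1) by (auto simp: smooth_near_def)
  then have "smooth (U \<inter> W) f"
    by (metis Int_lower1 assms(2) openin_Int smooth_open smooth_subset)
  then have "smooth (U \<inter> W) h"
    by (rule smooth_cong) (use assms(4) in auto)
  then show ?thesis
    using \<open>p \<in> U\<close> assms(3) by (auto intro: nearI)
qed

lemma near_sum:
  assumes "p \<in> topspace M" "\<And>i. i \<in> I \<Longrightarrow> near p (f i)"
  shows "near p (\<lambda>x. \<Sum>i\<in>I. f i x)"
  using assms(2)
  by (induction I rule: infinite_finite_induct) (auto intro: near_const assms(1) near_add)

section \<open>Tangent vectors as derivations\<close>

lemma tanI:
  assumes "\<And>f h a b. near p f \<Longrightarrow> near p h \<Longrightarrow> v (\<lambda>x. a * f x + b * h x) = a * v f + b * v h"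
    and "\<And>f h. near p f \<Longrightarrow> near p h \<Longrightarrow> v (\<lambda>x. f x * h x) = f p * v h + h p * v f"
    and "\<And>f. \<not> near p f \<Longrightarrow> v f = 0"
  shows "v \<in> tanv p"
  using assms by (simp add: tangent_space_def)

lemma tan_linear:
  "v \<in> tanv p \<Longrightarrow> near p f \<Longrightarrow> near p h \<Longrightarrow> v (\<lambda>x. a * f x + b * h x) = a * v f + b * v h"
  by (simp add: tangent_space_def)

lemma tan_mult:
  "v \<in> tanv p \<Longrightarrow> near p f \<Longrightarrow> near p h \<Longrightarrow> v (\<lambda>x. f x * h x) = f p * v h + h p * v f"
  by (simp add: tangent_space_def)

lemma tan_not_near: "v \<in> tanv p \<Longrightarrow> \<not> near p f \<Longrightarrow> v f = 0"
  by (simp add: tangent_space_def)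

lemma tan_add: "v \<in> tanv p \<Longrightarrow> near p f \<Longrightarrow> near p h \<Longrightarrow> v (\<lambda>x. f x + h x) = v f + v h"
  using tan_linear[of v p f h 1 1] by simp

lemma tan_diff: "v \<in> tanv p \<Longrightarrow> near p f \<Longrightarrow> near p h \<Longrightarrow> v (\<lambda>x. f x - h x) = v f - v h"
  using tan_linear[of v p f h 1 "-1"] by simp

lemma tan_zero: "v \<in> tanv p \<Longrightarrow> p \<in> topspace M \<Longrightarrow> v (\<lambda>x. 0) = 0"
  using tan_linear[of v p "\<lambda>x. 0" "\<lambda>x. 0" 0 0] near_const by simp

lemma tan_const:
  assumes "v \<in> tanv p" "p \<in> topspace M"
  shows "v (\<lambda>x. c) = 0"
proof -
  have "v (\<lambda>x. 1) = 0"
    using tan_mult[of v p "\<lambda>x. 1" "\<lambda>x. 1"] assms near_const by simp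
  then show ?thesis
    using tan_linear[of v p "\<lambda>x. 1" "\<lambda>x. 1" c 0] assms near_const by simp
qed

lemma tan_cmult:
  assumes "v \<in> tanv p" "near p f"
  shows "v (\<lambda>x. c * f x) = c * v f"
  using tan_linear[OF assms assms(2), of c 0] by simp

lemma tan_sum:
  assumes "v \<in> tanv p" "p \<in> topspace M" "\<And>i. i \<in> I \<Longrightarrow> near p (f i)"
  shows "v (\<lambda>x. \<Sum>i\<in>I. f i x) = (\<Sum>i\<in>I. v (f i))"
  using assms(3)
  by (induction I rule: infinite_finite_induct)
    (auto simp: tan_zero[OF assms(1,2)] tan_add[OF assms(1) _ near_sum[OF assms(2)]])

text \<open>Locality: multiply the difference by the indicator function of the neighbourhood.\<close>

lemma tan_cong:
  assumes "v \<in> tanv p" "near p f" "openin M W" "p \<in> W" "\<And>q. q \<in> W \<Longrightarrow> f q = h q"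
  shows "v f = v h"
proof -
  have h: "near p h" by (rule near_cong[OF assms(2-5)])
  have p: "p \<in> topspace M" using assms(2) by (rule near_topspace)
  define d where "d x = f x - h x" for x
  define i where "i x = (if x \<in> W then 1 else 0::real)" for x
  have i: "near p i"
    by (rule near_cong[OF near_const[OF p, of 1] assms(3,4)]) (auto simp: i_def)
  have "d = (\<lambda>x. f x + (-1) * h x)" by (auto simp: d_def)
  then have d: "near p d"
    using near_add[OF assms(2) near_mult[OF near_const[OF p, of "-1"] h]] by simp
  have "(\<lambda>x. d x * i x) = (\<lambda>x. 0)" using assms(5) by (auto simp: d_def i_def)
  then have "v d = 0"
    using tan_mult[OF assms(1) d i] tan_zero[OF assms(1) p] assms(4,5) by (simp add: d_def i_def)
  then show ?thesis
    using tan_diff[OF assms(1,2) h] by (simp add: d_def[abs_def])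
qed

lemma subspace_tan: "subspace (tanv p)"
proof (rule subspaceI)
  show "0 \<in> tanv p" by (auto intro!: tanI)
  show "u + v \<in> tanv p" if "u \<in> tanv p" "v \<in> tanv p" for u v
    using that by (intro tanI) (simp_all add: tan_linear tan_mult tan_not_near algebra_simps)
  show "c *\<^sub>R v \<in> tanv p" if "v \<in> tanv p" for c v
    using that by (intro tanI) (simp_all add: scaleR_fun_def tan_linear tan_mult tan_not_near algebra_simps)
qed

lemmas tan_space_intros =
  subspace_add[OF subspace_tan] subspace_diff[OF subspace_tan] subspace_scale[OF subspace_tan]
  subspace_sum[OF subspace_tan] subspace_0[OF subspace_tan]

section \<open>Smooth vector fields and the Lie bracket\<close>

lemma vfieldI:
  assumes "openin M U" "\<And>p. p \<in> U \<Longrightarrow> X p \<in> tanv p"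
    and "\<And>V f. V \<subseteq> U \<Longrightarrow> smooth V f \<Longrightarrow> smooth V (\<lambda>p. X p f)"
  shows "vfield U X"
  using assms by (simp add: vector_field_def)

lemma vfield_open: "vfield U X \<Longrightarrow> openin M U"
  by (simp add: vector_field_def)

lemma vfield_tan: "vfield U X \<Longrightarrow> p \<in> U \<Longrightarrow> X p \<in> tanv p"
  by (simp add: vector_field_def)

lemma vfield_topspace: "vfield U X \<Longrightarrow> p \<in> U \<Longrightarrow> p \<in> topspace M"
  using vfield_open openin_subset by blast

lemma vfield_smooth: "vfield U X \<Longrightarrow> V \<subseteq> U \<Longrightarrow> smooth V f \<Longrightarrow> smooth V (\<lambda>p. X p f)"
  by (simp add: vector_field_def)

lemma vfield_near:
  assumes "vfield U X" "near p f" "p \<in> U"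
  shows "near p (\<lambda>q. X q f)"
proof -
  obtain W where W: "p \<in> W" "smooth W f" "openin M W" using nearE[OF assms(2)] .
  then have "smooth (U \<inter> W) (\<lambda>q. X q f)"
    by (intro vfield_smooth[OF assms(1)] smooth_subset[OF W(2)]) (auto intro: vfield_open[OF assms(1)])
  then show ?thesis using W assms(3) by (auto intro: nearI)
qed

lemma vfield_subset: "vfield U X \<Longrightarrow> openin M W \<Longrightarrow> W \<subseteq> U \<Longrightarrow> vfield W X"
  by (auto simp: vector_field_def)

lemma vfield_cong:
  assumes "vfield U X" "\<And>q. q \<in> U \<Longrightarrow> X q = Y q"
  shows "vfield U Y"
proof (rule vfieldI[OF vfield_open[OF assms(1)]])
  show "Y p \<in> tanv p" if "p \<in> U" for p using vfield_tan[OF assms(1) that] assms(2)[OF that] by simp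
  show "smooth V (\<lambda>p. Y p f)" if "V \<subseteq> U" "smooth V f" for V f
    by (rule smooth_cong[OF vfield_smooth[OF assms(1) that]]) (use that assms(2) in auto)
qed

lemma vfield_local:
  assumes "openin M U" "\<And>p. p \<in> U \<Longrightarrow> \<exists>W. p \<in> W \<and> vfield W X"
  shows "vfield U X"
proof (rule vfieldI[OF assms(1)])
  show "X p \<in> tanv p" if "p \<in> U" for p using assms(2)[OF that] vfield_tan by blast
  show "smooth V (\<lambda>p. X p f)" if V: "V \<subseteq> U" "smooth V f" for V f
  proof (rule smooth_local[OF smooth_open[OF V(2)]])
    fix p assume p: "p \<in> V"
    then obtain W where W: "p \<in> W" "vfield W X" using assms(2) V by blast
    then have "smooth (W \<inter> V) (\<lambda>p. X p f)"
      by (intro vfield_smooth[OF W(2)] smooth_subset[OF V(2)])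
        (auto intro: vfield_open smooth_open[OF V(2)])
    then show "\<exists>W. p \<in> W \<and> smooth W (\<lambda>p. X p f)" using p W by auto
  qed
qed

lemma vfield_add: "vfield U X \<Longrightarrow> vfield U Y \<Longrightarrow> vfield U (\<lambda>q. X q + Y q)"
  by (intro vfieldI tan_space_intros)
    (auto intro: vfield_tan vfield_open smooth_add vfield_smooth)

lemma vfield_scale:
  assumes "smooth U f" "vfield U X"
  shows "vfield U (\<lambda>q. f q *\<^sub>R X q)"
proof (rule vfieldI[OF smooth_open[OF assms(1)]])
  show "f p *\<^sub>R X p \<in> tanv p" if "p \<in> U" for p
    by (intro tan_space_intros vfield_tan[OF assms(2) that])
  show "smooth V (\<lambda>p. (f p *\<^sub>R X p) h)" if "V \<subseteq> U" "smooth V h" for V h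
    using smooth_mult[OF smooth_subset[OF assms(1) smooth_open[OF that(2)] that(1)]
        vfield_smooth[OF assms(2) that]] by (simp add: scaleR_fun_def)
qed

lemma vfield_cscale: "vfield U X \<Longrightarrow> vfield U (\<lambda>q. c *\<^sub>R X q)"
  by (intro vfield_scale smooth_const) (auto intro: vfield_open)

lemma vfield_diff: "vfield U X \<Longrightarrow> vfield U Y \<Longrightarrow> vfield U (\<lambda>q. X q - Y q)"
  using vfield_add[OF _ vfield_cscale[of U Y "-1"], of X] by simp

lemma vfield_zero: "openin M U \<Longrightarrow> vfield U (\<lambda>q. 0)"
  by (intro vfieldI tan_space_intros) (auto intro: smooth_const smooth_open)

lemma vfield_sum:
  assumes "openin M U" "\<And>i. i \<in> I \<Longrightarrow> vfield U (X i)"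
  shows "vfield U (\<lambda>q. \<Sum>i\<in>I. X i q)"
  using assms(2)
  by (induction I rule: infinite_finite_induct) (auto intro: vfield_zero assms(1) vfield_add)

lemma bracket_apply: "near p f \<Longrightarrow> bracket X Y p f = X p (\<lambda>q. Y q f) - Y p (\<lambda>q. X q f)"
  by (simp add: lie_bracket_def)

lemma bracket_not_near: "\<not> near p f \<Longrightarrow> bracket X Y p f = 0"
  by (simp add: lie_bracket_def)

lemma bracket_skew: "bracket X Y p = - bracket Y X p"
  by (rule ext) (simp add: lie_bracket_def)

text \<open>At a point q, \<open>Y q\<close> is known to respect the combination only if f and h are
  both smooth near q. This holds for q close to p, and locality of u makes that enough.\<close>

lemma vfield_apply_linear:
  assumes "vfield U Y" "p \<in> U" "u \<in> tanv p" "near p f" "near p h"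
  shows "u (\<lambda>q. Y q (\<lambda>x. a * f x + b * h x)) = a * u (\<lambda>q. Y q f) + b * u (\<lambda>q. Y q h)"
proof -
  obtain V W where V: "p \<in> V" "smooth V f" and W: "p \<in> W" "smooth W h"
    using assms(4,5) by (auto simp: smooth_near_def)
  have o: "openin M (U \<inter> V \<inter> W)"
    using V W assms(1) by (auto intro: smooth_open vfield_open)
  have p: "p \<in> topspace M" by (rule vfield_topspace[OF assms(1,2)])
  have n: "near p (\<lambda>q. Y q f)" "near p (\<lambda>q. Y q h)"
    using vfield_near[OF assms(1) _ assms(2)] assms(4,5) by blast+
  have "u (\<lambda>q. a * Y q f + b * Y q h) = u (\<lambda>q. Y q (\<lambda>x. a * f x + b * h x))"
  proof (rule tan_cong[OF assms(3) _ o])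
    show "near p (\<lambda>q. a * Y q f + b * Y q h)"
      by (intro near_add near_mult near_const n p assms)
    show "a * Y q f + b * Y q h = Y q (\<lambda>x. a * f x + b * h x)" if "q \<in> U \<inter> V \<inter> W" for q
      using that tan_linear[OF vfield_tan[OF assms(1)] nearI[OF V(2)] nearI[OF W(2)]] by simp
  qed (use assms(2) V(1) W(1) in simp)
  then show ?thesis
    by (simp add: tan_linear[OF assms(3) n])
qed

text \<open>For \<open>u = X p\<close> the mixed terms \<open>Y p h * u f\<close> and
  \<open>Y p f * u h\<close> are symmetric in X and Y, so they cancel in the bracket, which is
  therefore again a derivation.\<close>

lemma vfield_apply_mult:
  assumes "vfield U Y" "p \<in> U" "u \<in> tanv p" "near p f" "near p h"
  shows "u (\<lambda>q. Y q (\<lambda>x. f x * h x)) =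
    f p * u (\<lambda>q. Y q h) + Y p h * u f + (h p * u (\<lambda>q. Y q f) + Y p f * u h)"
proof -
  obtain V W where V: "p \<in> V" "smooth V f" and W: "p \<in> W" "smooth W h"
    using assms(4,5) by (auto simp: smooth_near_def)
  have o: "openin M (U \<inter> V \<inter> W)"
    using V W assms(1) by (auto intro: smooth_open vfield_open)
  have p: "p \<in> topspace M" by (rule vfield_topspace[OF assms(1,2)])
  have n: "near p (\<lambda>q. Y q f)" "near p (\<lambda>q. Y q h)"
    using vfield_near[OF assms(1) _ assms(2)] assms(4,5) by blast+
  have "u (\<lambda>q. f q * Y q h + h q * Y q f) = u (\<lambda>q. Y q (\<lambda>x. f x * h x))"
  proof (rule tan_cong[OF assms(3) _ o])
    show "near p (\<lambda>q. f q * Y q h + h q * Y q f)"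
      by (intro near_add near_mult near_const n p assms)
    show "f q * Y q h + h q * Y q f = Y q (\<lambda>x. f x * h x)" if "q \<in> U \<inter> V \<inter> W" for q
      using that tan_mult[OF vfield_tan[OF assms(1)] nearI[OF V(2)] nearI[OF W(2)]] by simp
  qed (use assms(2) V(1) W(1) in simp)
  then show ?thesis
    by (simp add: tan_add[OF assms(3)] tan_mult[OF assms(3)] near_mult n assms(4,5))
qed

lemma vfield_bracket:
  assumes "vfield U X" "vfield U Y"
  shows "vfield U (bracket X Y)"
proof (rule vfieldI[OF vfield_open[OF assms(1)]])
  fix p assume p: "p \<in> U"
  show "bracket X Y p \<in> tanv p"
  proof (rule tanI)
    have t: "X p \<in> tanv p" "Y p \<in> tanv p" using assms p vfield_tan by auto
    have top: "p \<in> topspace M" using p assms vfield_topspace by blast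
    show "bracket X Y p (\<lambda>x. a * f x + b * h x) = a * bracket X Y p f + b * bracket X Y p h"
      if "near p f" "near p h" for f h a b
      using that vfield_apply_linear[OF assms(1) p t(2) that] vfield_apply_linear[OF assms(2) p t(1) that]
      by (simp add: bracket_apply near_add near_mult near_const top algebra_simps)
    show "bracket X Y p (\<lambda>x. f x * h x) = f p * bracket X Y p h + h p * bracket X Y p f"
      if "near p f" "near p h" for f h
      using that vfield_apply_mult[OF assms(1) p t(2) that] vfield_apply_mult[OF assms(2) p t(1) that]
      by (simp add: bracket_apply near_mult algebra_simps)
  qed (rule bracket_not_near)
next
  fix V f assume V: "V \<subseteq> U" "smooth V f"
  have "smooth V (\<lambda>p. X p (\<lambda>q. Y q f) - Y p (\<lambda>q. X q f))"
    by (rule smooth_diff[OF vfield_smooth[OF assms(1) V(1) vfield_smooth[OF assms(2) V]]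
          vfield_smooth[OF assms(2) V(1) vfield_smooth[OF assms(1) V]]])
  then show "smooth V (\<lambda>p. bracket X Y p f)"
    by (rule smooth_cong) (simp add: bracket_apply[OF nearI[OF V(2)]])
qed

end

section \<open>Existence of Riemannian metrics\<close>

context smooth_space
begin

text \<open>Seen in another chart, a coordinate is a component of the transition map, smooth by
  compatibility of the atlas.\<close>

lemma smooth_coordinate:
  assumes "(V, \<phi>) \<in> A"
  shows "smooth V (\<lambda>q. \<phi> q $ k)"
proof (rule smoothI[OF chartD(1)[OF assms]])
  fix V' \<phi>' n assume V': "(V', \<phi>') \<in> A"
  have "Cinf_on (transition (V', \<phi>') (V, \<phi>)) (overlap (V', \<phi>') (V, \<phi>))"
    using atlas assms V' by (simp add: smooth_atlas_def)
  then have "Ck_on n (\<lambda>x. \<phi> (inv_into V' \<phi>' x)) (\<phi>' ` (V' \<inter> V))"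
    by (simp add: Cinf_on_def transition_def overlap_def comp_def)
  then show "Ck_on n (\<lambda>x. \<phi> (inv_into V' \<phi>' x) $ k) (\<phi>' ` (V \<inter> V'))"
    using Ck_on_bounded_linear[OF open_chart_image[OF V' chartD(1)[OF assms]] bounded_linear_vec_nth[of k]]
    by (simp add: Int_commute)
qed

text \<open>A closed coordinate ball K is compact, hence closed in M because M is Hausdorff. So the
  complement of K is open, and extension by zero is smooth beyond the chart as well.\<close>

lemma bump_exists:
  assumes "Hausdorff_space M" "openin M W" "p \<in> W"
  obtains b K where "smooth (topspace M) b" "\<And>q. b q \<ge> 0" "b p > 0"
    "closedin M K" "K \<subseteq> W" "\<And>q. q \<notin> K \<Longrightarrow> b q = 0"
proof -
  have "p \<in> topspace M" using assms openin_subset by blast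
  then obtain V \<phi> where V: "(V, \<phi>) \<in> A" "p \<in> V" using chart_exists by blast
  note inj = chartD(5)[OF V(1)]
  have "open (\<phi> ` (W \<inter> V))" "\<phi> p \<in> \<phi> ` (W \<inter> V)"
    using open_chart_image[OF V(1) assms(2)] V(2) assms(3) by auto
  then obtain r where r: "r > 0" "cball (\<phi> p) r \<subseteq> \<phi> ` (W \<inter> V)"
    using open_contains_cball_eq by blast
  define K where "K = {q \<in> V. \<phi> q \<in> cball (\<phi> p) r}"
  \<comment> \<open>The squared distance in the chart, written as a polynomial in the coordinates so
    that it is smooth at the centre too.\<close>
  define \<psi> where "\<psi> q = (\<Sum>k\<in>UNIV. (\<phi> q $ k - \<phi> p $ k)\<^sup>2)" for q
  define b where "b q = (if q \<in> V then flat_exp 0 (r\<^sup>2 - \<psi> q) else 0)" for q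
  have \<psi>: "\<psi> q = (dist (\<phi> p) (\<phi> q))\<^sup>2" for q
  proof -
    have "\<psi> q = (norm (\<phi> q - \<phi> p))\<^sup>2"
      by (simp add: \<psi>_def norm_vec_def L2_set_def sum_nonneg)
    then show ?thesis
      by (simp add: dist_norm norm_minus_commute)
  qed
  have KW: "K \<subseteq> W"
  proof
    fix q assume "q \<in> K"
    then have "q \<in> V" "\<phi> q \<in> \<phi> ` (W \<inter> V)" using r(2) by (auto simp: K_def)
    then show "q \<in> W" using inj_on_image_mem_iff[OF inj, of q "W \<inter> V"] by auto
  qed
  have img: "\<phi> ` K = cball (\<phi> p) r"
  proof
    show "\<phi> ` K \<subseteq> cball (\<phi> p) r" by (auto simp: K_def)
    show "cball (\<phi> p) r \<subseteq> \<phi> ` K"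
    proof
      fix x assume x: "x \<in> cball (\<phi> p) r"
      then obtain q where "q \<in> V" "x = \<phi> q" using r(2) by blast
      then show "x \<in> \<phi> ` K" using x by (auto simp: K_def)
    qed
  qed
  have "compactin (top_of_set (\<phi> ` V)) (\<phi> ` K)"
    unfolding img compactin_subtopology using r(2) by (auto simp: compactin_euclidean_iff)
  moreover have "K \<subseteq> topspace (subtopology M V)"
    using chartD(4)[OF V(1)] by (auto simp: K_def)
  ultimately have "compactin (subtopology M V) K"
    using homeomorphic_map_compactness[OF chartD(3)[OF V(1)]] by blast
  then have "compactin M K"
    by (simp add: compactin_subtopology)
  then have K: "closedin M K"
    using assms(1) compactin_imp_closedin by blast
  have b0: "b q = 0" if "q \<notin> K" for q
  proof (cases "q \<in> V")
    case True
    then have "dist (\<phi> p) (\<phi> q) > r" using that by (simp add: K_def)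
    then have "\<psi> q > r\<^sup>2" unfolding \<psi> using r(1) by (simp add: power_strict_mono)
    then show ?thesis by (simp add: b_def flat_exp_def)
  qed (simp add: b_def)
  have "smooth (topspace M) b"
  proof (rule smooth_local[OF openin_topspace])
    fix q assume q: "q \<in> topspace M"
    show "\<exists>W. q \<in> W \<and> smooth W b"
    proof (cases "q \<in> V")
      case True
      have "smooth V (\<lambda>q. (\<phi> q $ k - \<phi> p $ k)\<^sup>2)" for k
        by (rule smooth_power[OF smooth_diff[OF smooth_coordinate[OF V(1)] smooth_const[OF chartD(1)[OF V(1)]]]])
      then have "smooth V \<psi>"
        unfolding \<psi>_def[abs_def] by (rule smooth_sum[OF chartD(1)[OF V(1)]])
      then have "smooth V (\<lambda>q. r\<^sup>2 - \<psi> q)"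
        by (rule smooth_diff[OF smooth_const[OF chartD(1)[OF V(1)]]])
      then have "smooth V (\<lambda>q. flat_exp 0 (r\<^sup>2 - \<psi> q))"
        by (rule smooth_compose_real[OF _ _ _ Ck_on_flat_exp]) auto
      then have "smooth V b"
        by (rule smooth_cong) (simp add: b_def)
      then show ?thesis using True by blast
    next
      case False
      then have "q \<in> topspace M - K" using q by (auto simp: K_def)
      moreover have "smooth (topspace M - K) b"
        by (rule smooth_cong[OF smooth_const[OF openin_diff[OF openin_topspace K], of 0]]) (simp add: b0)
      ultimately show ?thesis by blast
    qed
  qed
  moreover have "b q \<ge> 0" for q by (simp add: b_def flat_exp_def)
  moreover have "b p > 0" using V(2) r(1) by (simp add: b_def flat_exp_def \<psi>)
  ultimately show thesis
    using that K KW b0 by blast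
qed

text \<open>Near p the form summing \<open>u f * v f\<close> over the separating functions is
  positive definite. Weighting by bump functions and adding over a finite cover keeps every summand
  positive semidefinite, while at each point some summand is definite; the weights need not add up
  to 1.\<close>

lemma riemannian_metric_from_separating:
  assumes "Hausdorff_space M" "compact_space M"
    and sep: "\<And>p. p \<in> topspace M \<Longrightarrow> \<exists>W F. p \<in> W \<and> openin M W \<and> finite F \<and> (\<forall>f\<in>F. smooth W f) \<and>
      (\<forall>q\<in>W. \<forall>v\<in>tanv q. (\<forall>f\<in>F. v f = 0) \<longrightarrow> v = 0)"
  shows "\<exists>g. riemannian_metric M A g"
proof -
  define good where "good p W F b K \<longleftrightarrow> openin M W \<and> finite F \<and> (\<forall>f\<in>F. smooth W f) \<and>
      (\<forall>q\<in>W. \<forall>v\<in>tanv q. (\<forall>f\<in>F. v f = 0) \<longrightarrow> v = 0) \<and>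
      smooth (topspace M) b \<and> (\<forall>q. b q \<ge> 0) \<and> b p > 0 \<and> closedin M K \<and> K \<subseteq> W \<and> (\<forall>q. q \<notin> K \<longrightarrow> b q = 0)"
    for p W K and F :: "('a \<Rightarrow> real) set" and b :: "'a \<Rightarrow> real"
  have "\<exists>W F b K. good p W F b K" if pt: "p \<in> topspace M" for p
  proof -
    obtain W F where 1: "p \<in> W" "openin M W" "finite F" "\<forall>f\<in>F. smooth W f"
      "\<forall>q\<in>W. \<forall>v\<in>tanv q. (\<forall>f\<in>F. v f = 0) \<longrightarrow> v = 0"
      using sep[OF pt] by blast
    obtain b K where 2: "smooth (topspace M) b" "\<And>q. b q \<ge> 0" "b p > 0" "closedin M K" "K \<subseteq> W"
      "\<And>q. q \<notin> K \<Longrightarrow> b q = 0"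
      using bump_exists[OF assms(1) 1(2,1)] by metis
    have "good p W F b K"
      using 1 2 by (simp add: good_def)
    then show ?thesis by blast
  qed
  then obtain W F b K where *: "good p (W p) (F p) (b p) (K p)" if "p \<in> topspace M" for p
    by metis
  note W = *[unfolded good_def, THEN conjunct1]
  have F: "finite (F p)" "\<And>f. f \<in> F p \<Longrightarrow> smooth (W p) f"
      "\<And>q v. q \<in> W p \<Longrightarrow> v \<in> tanv q \<Longrightarrow> (\<And>f. f \<in> F p \<Longrightarrow> v f = 0) \<Longrightarrow> v = 0"
    and b: "smooth (topspace M) (b p)" "\<And>q. b p q \<ge> 0" "b p p > 0"
    and K: "closedin M (K p)" "K p \<subseteq> W p" "\<And>q. q \<notin> K p \<Longrightarrow> b p q = 0"
    if "p \<in> topspace M" for p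
    using *[OF that] by (auto simp: good_def)
  define Pos where "Pos p = {q \<in> topspace M. b p q \<in> {0<..}}" for p
  have Pos: "openin M (Pos p)" if "p \<in> topspace M" for p
    unfolding Pos_def by (rule smooth_open_vimage[OF b(1)[OF that]]) simp
  have "compactin M (topspace M)"
    using assms(2) by (simp add: compact_space_def)
  moreover have "topspace M \<subseteq> \<Union>(Pos ` topspace M)"
    using b(3) by (auto simp: Pos_def)
  ultimately have "\<exists>\<F>. finite \<F> \<and> \<F> \<subseteq> Pos ` topspace M \<and> topspace M \<subseteq> \<Union>\<F>"
    by (intro compactinD) (use Pos in auto)
  then obtain P where P: "finite P" "P \<subseteq> topspace M" "topspace M \<subseteq> \<Union>(Pos ` P)"
    by (metis finite_subset_image)
  define g where "g q u v = (\<Sum>p\<in>P. b p q * (\<Sum>f\<in>F p. u f * v f))"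
    for q and u v :: "'a tangent"
  have "riemannian_metric M A g"
    unfolding riemannian_metric_def
  proof (intro conjI ballI allI impI)
    fix q u v assume q: "q \<in> topspace M" "u \<in> tanv q" "v \<in> tanv q"
    show "g q u v = g q v u"
      by (simp add: g_def mult.commute)
    show "0 < g q u u" if un: "u \<noteq> 0"
    proof -
      obtain p where p: "p \<in> P" "b p q > 0" using P(3) q(1) by (auto simp: Pos_def)
      then have pt: "p \<in> topspace M" using P(2) by auto
      then have qW: "q \<in> W p" using K p(2) by force
      obtain f where f: "f \<in> F p" "u f \<noteq> 0" using F(3)[OF pt qW q(2)] un by blast
      have "(\<Sum>f\<in>F p. u f * u f) > 0"
        by (rule sum_pos2[OF F(1)[OF pt] f(1)])
          (use f(2) in \<open>simp_all add: zero_less_mult_iff linorder_neq_iff[of "u f" 0] disj_commute\<close>)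
      then have "b p q * (\<Sum>f\<in>F p. u f * u f) > 0"
        using p(2) by simp
      moreover have "0 \<le> b i q * (\<Sum>f\<in>F i. u f * u f)" if "i \<in> P" for i
        using that P(2) b(2)[of i q] by (intro mult_nonneg_nonneg sum_nonneg zero_le_square) auto
      ultimately show ?thesis
        unfolding g_def by (intro sum_pos2[OF P(1) p(1)])
    qed
    show "g q (a *\<^sub>R u + c *\<^sub>R v) w = a * g q u w + c * g q v w" for a c w
      by (simp add: g_def scaleR_fun_def algebra_simps sum.distrib sum_distrib_left)
  next
    fix U X Y assume X: "vfield U X" and Y: "vfield U Y"
    note U = vfield_open[OF X]
    have "smooth U (\<lambda>q. b p q * (\<Sum>f\<in>F p. X q f * Y q f))" if "p \<in> P" for p
    proof (rule smooth_local[OF U])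
      have p: "p \<in> topspace M" using that P(2) by auto
      fix q assume q: "q \<in> U"
      show "\<exists>W. q \<in> W \<and> smooth W (\<lambda>q. b p q * (\<Sum>f\<in>F p. X q f * Y q f))"
      proof (cases "q \<in> K p")
        case True
        have o: "openin M (U \<inter> W p)" using U W[OF p] by auto
        have "smooth (U \<inter> W p) f" if "f \<in> F p" for f
          using smooth_subset[OF F(2)[OF p that] o] by simp
        then have "smooth (U \<inter> W p) (\<lambda>q. X q f * Y q f)" if "f \<in> F p" for f
          using smooth_mult[OF vfield_smooth[OF X _] vfield_smooth[OF Y _]] that by simp
        then have "smooth (U \<inter> W p) (\<lambda>q. \<Sum>f\<in>F p. X q f * Y q f)"
          by (rule smooth_sum[OF o])
        moreover have "smooth (U \<inter> W p) (b p)"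
          using smooth_subset[OF b(1)[OF p] o] openin_subset[OF U] by auto
        ultimately have "smooth (U \<inter> W p) (\<lambda>q. b p q * (\<Sum>f\<in>F p. X q f * Y q f))"
          using smooth_mult by blast
        then show ?thesis using q True K(2)[OF p] by blast
      next
        case False
        \<comment> \<open>Away from \<open>W p\<close> the functions in \<open>F p\<close> need not
          be smooth, but the weight vanishes on the whole open set outside
          \<open>K p\<close>.\<close>
        have "smooth (U - K p) (\<lambda>q. b p q * (\<Sum>f\<in>F p. X q f * Y q f))"
          by (rule smooth_cong[OF smooth_const[OF openin_diff[OF U K(1)[OF p]], of 0]])
            (simp add: K(3)[OF p])
        then show ?thesis using q False by blast
      qed
    qed
    then show "smooth U (\<lambda>q. g q (X q) (Y q))"
      unfolding g_def by (rule smooth_sum[OF U])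
  qed
  then show ?thesis by blast
qed

text \<open>Gaussian elimination on the derivatives of functions along the frame: each new field is
  corrected to annihilate the functions already chosen, and the next function is chosen with nonzero
  derivative along it. The resulting matrix is triangular with nonzero diagonal near p, so a tangent
  vector killing all three functions is zero. No coordinate description of derivations
  enters.\<close>

lemma separating_functions:
  assumes S: "vfield U S" and T: "vfield U T" and Z: "vfield U Z" and p: "p \<in> U"
    and span: "\<And>q v. q \<in> U \<Longrightarrow> v \<in> tanv q \<Longrightarrow> \<exists>a b c. v = a *\<^sub>R S q + b *\<^sub>R T q + c *\<^sub>R Z q"
    and indep: "\<And>a b c. a *\<^sub>R S p + b *\<^sub>R T p + c *\<^sub>R Z p = 0 \<Longrightarrow> a = 0 \<and> b = 0 \<and> c = 0"
  shows "\<exists>W F. p \<in> W \<and> openin M W \<and> finite F \<and> (\<forall>f\<in>F. smooth W f) \<and>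
      (\<forall>q\<in>W. \<forall>v\<in>tanv q. (\<forall>f\<in>F. v f = 0) \<longrightarrow> v = 0)"
proof -
  have step: "\<exists>f W. smooth W f \<and> p \<in> W \<and> openin M W \<and> W \<subseteq> V \<and> (\<forall>q\<in>W. X q f \<noteq> 0)"
    if X: "vfield V X" and pV: "p \<in> V" and n: "X p \<noteq> 0" for X V
  proof -
    obtain f where f: "X p f \<noteq> 0" using n by (auto simp: fun_eq_iff)
    then have "near p f" using tan_not_near[OF vfield_tan[OF X pV]] by blast
    then obtain V' where V': "p \<in> V'" "smooth V' f" "openin M V'" by (rule nearE)
    have s: "smooth (V \<inter> V') f" using smooth_subset[OF V'(2)] vfield_open[OF X] V'(3) by auto
    then have "smooth (V \<inter> V') (\<lambda>q. X q f)" using vfield_smooth[OF X] by simp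
    then have o: "openin M {q \<in> V \<inter> V'. X q f \<in> - {0}}"
      by (rule smooth_open_vimage) (rule open_Compl[OF closed_singleton])
    have "smooth {q \<in> V \<inter> V'. X q f \<in> - {0}} f" by (rule smooth_subset[OF s o]) auto
    then show ?thesis
      using o f pV V'(1) by (intro exI[of _ f] exI[of _ "{q \<in> V \<inter> V'. X q f \<in> - {0}}"]) auto
  qed
  have "S p \<noteq> 0" using indep[of 1 0 0] by auto
  then obtain f1 W1 where 1: "smooth W1 f1" "p \<in> W1" "openin M W1" "W1 \<subseteq> U" "\<And>q. q \<in> W1 \<Longrightarrow> S q f1 \<noteq> 0"
    using step[OF S p] by blast
  note S1 = vfield_subset[OF S 1(3,4)] and T1 = vfield_subset[OF T 1(3,4)] and Z1 = vfield_subset[OF Z 1(3,4)]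
  note s1 = vfield_smooth[OF S1 order_refl 1(1)]
  define t where "t q = T q f1 / S q f1" for q
  define T' where "T' q = T q - t q *\<^sub>R S q" for q
  have T': "vfield W1 T'"
    unfolding T'_def[abs_def] t_def
    by (intro vfield_diff T1 vfield_scale smooth_divide s1 S1 1(5) vfield_smooth[OF T1 order_refl 1(1)])
  have "T' p \<noteq> 0" using indep[of "- t p" 1 0] by (auto simp: T'_def)
  then obtain f2 W2 where 2: "smooth W2 f2" "p \<in> W2" "openin M W2" "W2 \<subseteq> W1" "\<And>q. q \<in> W2 \<Longrightarrow> T' q f2 \<noteq> 0"
    using step[OF T' 1(2)] by blast
  note S2 = vfield_subset[OF S1 2(3,4)] and T2 = vfield_subset[OF T' 2(3,4)] and Z2 = vfield_subset[OF Z1 2(3,4)]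
  note f1 = smooth_subset[OF 1(1) 2(3,4)]
  define z where "z q = Z q f1 / S q f1" for q
  \<comment> \<open>As T' annihilates f1, the coefficient z alone makes Z' annihilate f1; then w is
    solved from the condition that Z' annihilates f2.\<close>
  define w where "w q = (Z q f2 - z q * S q f2) / T' q f2" for q
  define Z' where "Z' q = Z q - z q *\<^sub>R S q - w q *\<^sub>R T' q" for q
  have z: "smooth W2 z"
    unfolding z_def[abs_def] using vfield_smooth[OF S2 order_refl f1] vfield_smooth[OF Z2 order_refl f1] 1(5) 2(4)
    by (intro smooth_divide) auto
  have w: "smooth W2 w"
    unfolding w_def[abs_def]
    by (intro smooth_divide smooth_diff smooth_mult z vfield_smooth[OF S2 order_refl 2(1)]
        vfield_smooth[OF T2 order_refl 2(1)] vfield_smooth[OF Z2 order_refl 2(1)] 2(5))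
  have Z': "vfield W2 Z'"
    unfolding Z'_def[abs_def] by (intro vfield_diff vfield_scale z w S2 T2 Z2)
  have "Z' p = (w p * t p - z p) *\<^sub>R S p + (- w p) *\<^sub>R T p + 1 *\<^sub>R Z p"
    by (simp add: Z'_def T'_def algebra_simps)
  then have "Z' p \<noteq> 0" using indep[of "w p * t p - z p" "- w p" 1] by auto
  then obtain f3 W3 where 3: "smooth W3 f3" "p \<in> W3" "openin M W3" "W3 \<subseteq> W2" "\<And>q. q \<in> W3 \<Longrightarrow> Z' q f3 \<noteq> 0"
    using step[OF Z' 2(2)] by blast
  have "v = 0" if q: "q \<in> W3" and v: "v \<in> tanv q" "v f1 = 0" "v f2 = 0" "v f3 = 0" for q v
  proof -
    have qs: "q \<in> W2" "q \<in> W1" "q \<in> U" using q 1(4) 2(4) 3(4) by auto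
    note n = 1(5)[OF qs(2)] 2(5)[OF qs(1)] 3(5)[OF q]
    obtain a b c where abc: "v = a *\<^sub>R S q + b *\<^sub>R T q + c *\<^sub>R Z q" using span[OF qs(3) v(1)] by blast
    define b' where "b' = b + c * w q"
    define a' where "a' = a + b * t q + c * z q"
    have v': "v = a' *\<^sub>R S q + b' *\<^sub>R T' q + c *\<^sub>R Z' q"
      by (simp add: abc a'_def b'_def T'_def Z'_def algebra_simps)
    have ev: "v f = a' * S q f + b' * T' q f + c * Z' q f" for f
      by (simp add: v' scaleR_fun_def)
    have T0: "T' q f1 = 0" using n by (simp add: T'_def t_def scaleR_fun_def)
    have Z0: "Z' q f1 = 0" using n T0 by (simp add: Z'_def z_def scaleR_fun_def)
    have Z02: "Z' q f2 = 0" using n by (simp add: Z'_def w_def scaleR_fun_def)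
    have a: "a' = 0" using ev[of f1] v(2) n T0 Z0 by simp
    moreover have b: "b' = 0" using ev[of f2] v(3) n Z02 a by simp
    moreover have "c = 0" using ev[of f3] v(4) n a b by simp
    ultimately show ?thesis using v' by simp
  qed
  moreover have "smooth W3 f" if "f \<in> {f1, f2, f3}" for f
    using that smooth_subset[OF f1 3(3,4)] smooth_subset[OF 2(1) 3(3,4)] 3(1) by auto
  ultimately show ?thesis
    using 3(2,3) by (intro exI[of _ W3] exI[of _ "{f1, f2, f3}"]) auto
qed

end

section \<open>Orthonormal frames\<close>

context smooth_space
begin

text \<open>That the frame is a basis is expressed by the expansion formula in the last conjunct,
  which takes the place of a dimension count.\<close>

definition orthonormal_frame ::
  "('a \<Rightarrow> 'a tangent \<Rightarrow> 'a tangent \<Rightarrow> real) \<Rightarrow> 'a set \<Rightarrow> ('i::finite \<Rightarrow> 'a \<Rightarrow> 'a tangent) \<Rightarrow> bool" where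
  "orthonormal_frame g W E \<longleftrightarrow> openin M W \<and> (\<forall>i. vfield W (E i)) \<and>
     (\<forall>q\<in>W. \<forall>i j. g q (E i q) (E j q) = of_bool (i = j)) \<and>
     (\<forall>q\<in>W. \<forall>v\<in>tanv q. v = (\<Sum>i\<in>UNIV. g q v (E i q) *\<^sub>R E i q))"

lemma orthonormal_frameD:
  assumes "orthonormal_frame g W E"
  shows "openin M W" "\<And>i. vfield W (E i)"
    "\<And>q i j. q \<in> W \<Longrightarrow> g q (E i q) (E j q) = of_bool (i = j)"
    "\<And>q v. q \<in> W \<Longrightarrow> v \<in> tanv q \<Longrightarrow> v = (\<Sum>i\<in>UNIV. g q v (E i q) *\<^sub>R E i q)"
    "\<And>q i. q \<in> W \<Longrightarrow> E i q \<in> tanv q"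
  using assms vfield_tan by (auto simp: orthonormal_frame_def)

lemma orthonormal_frame_subset:
  "orthonormal_frame g W E \<Longrightarrow> openin M V \<Longrightarrow> V \<subseteq> W \<Longrightarrow> orthonormal_frame g V E"
  unfolding orthonormal_frame_def using vfield_subset by blast

context
  fixes g assumes metric: "riemannian_metric M A g"
begin

section \<open>Pointwise algebra of a metric and Gram-Schmidt\<close>

lemma metric_sym: "p \<in> topspace M \<Longrightarrow> u \<in> tanv p \<Longrightarrow> v \<in> tanv p \<Longrightarrow> g p u v = g p v u"
  using metric by (simp add: riemannian_metric_def)

lemma metric_pos: "p \<in> topspace M \<Longrightarrow> u \<in> tanv p \<Longrightarrow> u \<noteq> 0 \<Longrightarrow> 0 < g p u u"
  using metric by (simp add: riemannian_metric_def)

lemma metric_linear_left: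
  "p \<in> topspace M \<Longrightarrow> u \<in> tanv p \<Longrightarrow> v \<in> tanv p \<Longrightarrow> w \<in> tanv p \<Longrightarrow>
    g p (a *\<^sub>R u + b *\<^sub>R v) w = a * g p u w + b * g p v w"
  using metric by (simp add: riemannian_metric_def)

lemma metric_smooth: "vfield U X \<Longrightarrow> vfield U Y \<Longrightarrow> smooth U (\<lambda>p. g p (X p) (Y p))"
  using metric by (simp add: riemannian_metric_def)

lemma metric_add_left:
  "p \<in> topspace M \<Longrightarrow> u \<in> tanv p \<Longrightarrow> v \<in> tanv p \<Longrightarrow> w \<in> tanv p \<Longrightarrow> g p (u + v) w = g p u w + g p v w"
  using metric_linear_left[of p u v w 1 1] by simp

lemma metric_diff_left:
  "p \<in> topspace M \<Longrightarrow> u \<in> tanv p \<Longrightarrow> v \<in> tanv p \<Longrightarrow> w \<in> tanv p \<Longrightarrow> g p (u - v) w = g p u w - g p v w"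
  using metric_linear_left[of p u v w 1 "-1"] by simp

lemma metric_zero_left: "p \<in> topspace M \<Longrightarrow> w \<in> tanv p \<Longrightarrow> g p 0 w = 0"
  using metric_linear_left[of p w w w 0 0] by simp

lemma metric_scale_left:
  "p \<in> topspace M \<Longrightarrow> u \<in> tanv p \<Longrightarrow> w \<in> tanv p \<Longrightarrow> g p (c *\<^sub>R u) w = c * g p u w"
  using metric_linear_left[of p u u w c 0] by simp

lemma metric_sum_left:
  assumes "p \<in> topspace M" "w \<in> tanv p" "\<And>i. i \<in> I \<Longrightarrow> u i \<in> tanv p"
  shows "g p (\<Sum>i\<in>I. u i) w = (\<Sum>i\<in>I. g p (u i) w)"
  using assms(3)
  by (induction I rule: infinite_finite_induct)
    (simp_all add: metric_zero_left[OF assms(1,2)] metric_add_left[OF assms(1) _ _ assms(2)] tan_space_intros)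

lemma metric_scale_right:
  "p \<in> topspace M \<Longrightarrow> u \<in> tanv p \<Longrightarrow> w \<in> tanv p \<Longrightarrow> g p w (c *\<^sub>R u) = c * g p w u"
  using metric_scale_left[of p u w c] metric_sym[of p w] tan_space_intros(3)[of u p c] by simp

lemma metric_add_right:
  "p \<in> topspace M \<Longrightarrow> u \<in> tanv p \<Longrightarrow> v \<in> tanv p \<Longrightarrow> w \<in> tanv p \<Longrightarrow> g p w (u + v) = g p w u + g p w v"
  using metric_add_left[of p u v w] metric_sym[of p w] tan_space_intros(1)[of u p v] by simp

lemma metric_diff_right:
  "p \<in> topspace M \<Longrightarrow> u \<in> tanv p \<Longrightarrow> v \<in> tanv p \<Longrightarrow> w \<in> tanv p \<Longrightarrow> g p w (u - v) = g p w u - g p w v"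
  using metric_diff_left[of p u v w] metric_sym[of p w] tan_space_intros(2)[of u p v] by simp

lemma unit_vfield:
  assumes X: "vfield U X" and "\<And>q. q \<in> U \<Longrightarrow> X q \<noteq> 0"
  obtains n where "vfield U (\<lambda>q. (1 / n q) *\<^sub>R X q)" "\<And>q. q \<in> U \<Longrightarrow> n q > 0"
    "\<And>q. q \<in> U \<Longrightarrow> g q ((1 / n q) *\<^sub>R X q) ((1 / n q) *\<^sub>R X q) = 1"
proof -
  define n where "n q = sqrt (g q (X q) (X q))" for q
  have pos: "g q (X q) (X q) > 0" if "q \<in> U" for q
    using metric_pos vfield_tan[OF X that] vfield_topspace[OF X that] assms(2)[OF that] by blast
  then have n: "n q > 0" "n q * n q = g q (X q) (X q)" if "q \<in> U" for q
    using that by (auto simp: n_def less_imp_le)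
  have "smooth U n"
    unfolding n_def[abs_def] by (rule smooth_sqrt[OF metric_smooth[OF X X] pos])
  moreover have "n q \<noteq> 0" if "q \<in> U" for q
    using n(1)[OF that] by simp
  ultimately have "vfield U (\<lambda>q. (1 / n q) *\<^sub>R X q)"
    by (rule vfield_scale[OF smooth_divide[OF smooth_const[OF vfield_open[OF X]]] X])
  moreover have "g q ((1 / n q) *\<^sub>R X q) ((1 / n q) *\<^sub>R X q) = 1" if "q \<in> U" for q
    using n[OF that] pos[OF that] metric_scale_left metric_scale_right
      vfield_tan[OF X that] vfield_topspace[OF X that] tan_space_intros(3)[OF vfield_tan[OF X that]]
    by (simp add: field_simps)
  ultimately show thesis using that n by blast
qed

text \<open>Two features of the input survive orthonormalization: the plane of the first two fields,
  later \<xi>, and the side of that plane on which the third field lies. The positive c records the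
  side, and thereby the sign of \<alpha> on \<open>E 3\<close>.\<close>

lemma gram_schmidt:
  assumes S: "vfield U S" and T: "vfield U T" and Z: "vfield U Z"
    and generating: "\<forall>q\<in>U. \<forall>v\<in>tanv q. \<exists>a b c. v = a *\<^sub>R S q + b *\<^sub>R T q + c *\<^sub>R Z q"
    and independent: "\<forall>q\<in>U. \<forall>a b c. a *\<^sub>R S q + b *\<^sub>R T q + c *\<^sub>R Z q = 0 \<longrightarrow> a = 0 \<and> b = 0 \<and> c = 0"
  shows "\<exists>E :: 3 \<Rightarrow> 'a \<Rightarrow> 'a tangent. orthonormal_frame g U E \<and>
    (\<forall>q\<in>U. span {E 1 q, E 2 q} = span {S q, T q} \<and> (\<exists>c>0. E 3 q - c *\<^sub>R Z q \<in> span {S q, T q}))"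
proof -
  note span = generating[rule_format] and indep = independent[rule_format]
  note top = vfield_topspace[OF S]
  have S0: "S q \<noteq> 0" if "q \<in> U" for q using indep[OF that, of 1 0 0] by auto
  obtain n1 where n1: "vfield U (\<lambda>q. (1 / n1 q) *\<^sub>R S q)" "\<And>q. q \<in> U \<Longrightarrow> n1 q > 0"
    "\<And>q. q \<in> U \<Longrightarrow> g q ((1 / n1 q) *\<^sub>R S q) ((1 / n1 q) *\<^sub>R S q) = 1"
    using unit_vfield[OF S S0] by blast
  define e1 where "e1 q = (1 / n1 q) *\<^sub>R S q" for q
  have e1: "vfield U e1" "\<And>q. q \<in> U \<Longrightarrow> g q (e1 q) (e1 q) = 1" using n1 by (simp_all add: e1_def[abs_def])
  define T' where "T' q = T q - g q (T q) (e1 q) *\<^sub>R e1 q" for q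
  have T': "vfield U T'"
    unfolding T'_def[abs_def] by (intro vfield_diff vfield_scale metric_smooth T e1)
  have T0: "T' q \<noteq> 0" if "q \<in> U" for q using indep[OF that, of "- (g q (T q) (e1 q) / n1 q)" 1 0] by (auto simp: T'_def e1_def)
  obtain n2 where n2: "vfield U (\<lambda>q. (1 / n2 q) *\<^sub>R T' q)" "\<And>q. q \<in> U \<Longrightarrow> n2 q > 0"
    "\<And>q. q \<in> U \<Longrightarrow> g q ((1 / n2 q) *\<^sub>R T' q) ((1 / n2 q) *\<^sub>R T' q) = 1"
    using unit_vfield[OF T' T0] by blast
  define e2 where "e2 q = (1 / n2 q) *\<^sub>R T' q" for q
  have e2: "vfield U e2" "\<And>q. q \<in> U \<Longrightarrow> g q (e2 q) (e2 q) = 1" using n2 by (simp_all add: e2_def[abs_def])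
  define Z' where "Z' q = Z q - g q (Z q) (e1 q) *\<^sub>R e1 q - g q (Z q) (e2 q) *\<^sub>R e2 q" for q
  have Z': "vfield U Z'"
    unfolding Z'_def[abs_def] by (intro vfield_diff vfield_scale metric_smooth Z e1 e2)
  have decomp: "S q = n1 q *\<^sub>R e1 q" "T q = g q (T q) (e1 q) *\<^sub>R e1 q + n2 q *\<^sub>R e2 q" if "q \<in> U" for q
    using n1(2)[OF that] n2(2)[OF that] by (simp_all add: e1_def e2_def T'_def)
  have e12: "e1 q \<in> span {S q, T q}" "e2 q \<in> span {S q, T q}" for q
  proof -
    show 1: "e1 q \<in> span {S q, T q}" by (simp add: e1_def span_base span_scale)
    show "e2 q \<in> span {S q, T q}"
      unfolding e2_def T'_def by (intro span_scale span_diff 1 span_base) auto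
  qed
  have Z'0: "Z' q \<noteq> 0" if "q \<in> U" for q
  proof
    assume "Z' q = 0"
    then have "Z q = g q (Z q) (e1 q) *\<^sub>R e1 q + g q (Z q) (e2 q) *\<^sub>R e2 q"
      by (simp add: Z'_def algebra_simps)
    then have "Z q \<in> span {S q, T q}"
      by (metis e12 span_add span_scale)
    then obtain a b where "Z q = a *\<^sub>R S q + b *\<^sub>R T q"
      by (auto simp: span_insert span_singleton algebra_simps)
    then show False using indep[OF that, of a b "-1"] by simp
  qed
  obtain n3 where n3: "vfield U (\<lambda>q. (1 / n3 q) *\<^sub>R Z' q)" "\<And>q. q \<in> U \<Longrightarrow> n3 q > 0"
    "\<And>q. q \<in> U \<Longrightarrow> g q ((1 / n3 q) *\<^sub>R Z' q) ((1 / n3 q) *\<^sub>R Z' q) = 1"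
    using unit_vfield[OF Z' Z'0] by blast
  define e3 where "e3 q = (1 / n3 q) *\<^sub>R Z' q" for q
  have e3: "vfield U e3" "\<And>q. q \<in> U \<Longrightarrow> g q (e3 q) (e3 q) = 1" using n3 by (simp_all add: e3_def[abs_def])
  have decompZ: "Z q = g q (Z q) (e1 q) *\<^sub>R e1 q + g q (Z q) (e2 q) *\<^sub>R e2 q + n3 q *\<^sub>R e3 q" if "q \<in> U" for q
    using n3(2)[OF that] by (simp add: e3_def Z'_def)
  have orth: "g q (e1 q) (e2 q) = 0" "g q (e1 q) (e3 q) = 0" "g q (e2 q) (e3 q) = 0"
    "g q (e2 q) (e1 q) = 0" "g q (e3 q) (e1 q) = 0" "g q (e3 q) (e2 q) = 0" if q: "q \<in> U" for q
  proof -
    have t: "S q \<in> tanv q" "T q \<in> tanv q" "Z q \<in> tanv q" "e1 q \<in> tanv q" "e2 q \<in> tanv q" "e3 q \<in> tanv q"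
        "T' q \<in> tanv q" "Z' q \<in> tanv q" "q \<in> topspace M"
      using q vfield_tan[OF _ q] S T Z e1(1) e2(1) e3(1) T' Z' top by auto
    have "g q (T' q) (e1 q) = 0"
      unfolding T'_def using e1(2)[OF q] t by (simp add: metric_diff_left metric_scale_left tan_space_intros)
    then show 21: "g q (e2 q) (e1 q) = 0" unfolding e2_def using t by (simp add: metric_scale_left)
    then show 12: "g q (e1 q) (e2 q) = 0" using metric_sym t by metis
    have "g q (Z' q) (e1 q) = 0" "g q (Z' q) (e2 q) = 0"
      unfolding Z'_def using e1(2)[OF q] e2(2)[OF q] t 21 12
      by (simp_all add: metric_diff_left metric_scale_left tan_space_intros)
    then show 31: "g q (e3 q) (e1 q) = 0" and 32: "g q (e3 q) (e2 q) = 0"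
      unfolding e3_def using t by (simp_all add: metric_scale_left)
    then show "g q (e1 q) (e3 q) = 0" "g q (e2 q) (e3 q) = 0" using metric_sym t by metis+
  qed
  define E :: "3 \<Rightarrow> 'a \<Rightarrow> 'a tangent" where "E i = (if i = 1 then e1 else if i = 2 then e2 else e3)" for i
  have E: "E 1 = e1" "E 2 = e2" "E 3 = e3" by (simp_all add: E_def)
  have "orthonormal_frame g U E"
    unfolding orthonormal_frame_def
  proof (intro conjI allI ballI)
    show "openin M U" by (rule vfield_open[OF S])
    show "vfield U (E i)" for i using e1 e2 e3 by (simp add: E_def)
    fix q assume q: "q \<in> U"
    show "g q (E i q) (E j q) = of_bool (i = j)" for i j
      using exhaust_3[of i] exhaust_3[of j] e1(2)[OF q] e2(2)[OF q] e3(2)[OF q] orth[OF q]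
      by (auto simp: E)
    fix v assume v: "v \<in> tanv q"
    obtain a b c where abc: "v = a *\<^sub>R S q + b *\<^sub>R T q + c *\<^sub>R Z q" using span[OF q v] by blast
    define x y z where "x = a * n1 q + b * g q (T q) (e1 q) + c * g q (Z q) (e1 q)"
      and "y = b * n2 q + c * g q (Z q) (e2 q)" and "z = c * n3 q"
    have "v = a *\<^sub>R (n1 q *\<^sub>R e1 q) + b *\<^sub>R (g q (T q) (e1 q) *\<^sub>R e1 q + n2 q *\<^sub>R e2 q) +
        c *\<^sub>R (g q (Z q) (e1 q) *\<^sub>R e1 q + g q (Z q) (e2 q) *\<^sub>R e2 q + n3 q *\<^sub>R e3 q)"
      using abc decomp[OF q] decompZ[OF q] by simp
    then have v': "v = x *\<^sub>R e1 q + y *\<^sub>R e2 q + z *\<^sub>R e3 q"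
      by (simp add: x_def y_def z_def algebra_simps)
    have t: "e1 q \<in> tanv q" "e2 q \<in> tanv q" "e3 q \<in> tanv q" "q \<in> topspace M"
      using q vfield_tan[OF _ q] e1(1) e2(1) e3(1) top by auto
    have "g q v (e1 q) = x" "g q v (e2 q) = y" "g q v (e3 q) = z"
      unfolding v' using t orth[OF q] e1(2)[OF q] e2(2)[OF q] e3(2)[OF q]
      by (simp_all add: metric_add_left metric_scale_left tan_space_intros)
    then show "v = (\<Sum>i\<in>UNIV. g q v (E i q) *\<^sub>R E i q)"
      by (simp add: sum_3 E v')
  qed
  moreover have "span {E 1 q, E 2 q} = span {S q, T q}" if q: "q \<in> U" for q
  proof -
    have "S q \<in> span {e1 q, e2 q}" "T q \<in> span {e1 q, e2 q}"
      by (subst decomp[OF q], intro span_add span_scale span_base, auto)+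
    then show ?thesis
      using e12[of q] by (simp add: E span_eq)
  qed
  moreover have "\<exists>c>0. E 3 q - c *\<^sub>R Z q \<in> span {S q, T q}" if q: "q \<in> U" for q
  proof -
    have "E 3 q - (1 / n3 q) *\<^sub>R Z q = - (1 / n3 q) *\<^sub>R (g q (Z q) (e1 q) *\<^sub>R e1 q + g q (Z q) (e2 q) *\<^sub>R e2 q)"
      by (simp add: E e3_def Z'_def algebra_simps)
    also have "\<dots> \<in> span {S q, T q}"
      by (intro span_scale span_add e12)
    finally show ?thesis
      using n3(2)[OF q] by (intro exI[of _ "1 / n3 q"]) simp
  qed
  ultimately show ?thesis
    by (intro exI[of _ E] conjI ballI)
qed

end

end

section \<open>The Levi-Civita connection in an orthonormal frame\<close>

lemma sum_fun_apply: "(\<Sum>i\<in>I. u i) x = (\<Sum>i\<in>I. u i x)"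
  by (induction I rule: infinite_finite_induct) auto

context smooth_space
begin

text \<open>The Levi-Civita conditions tested only on fields over subsets of W, so that a connection
  built from a frame on W can satisfy them.\<close>

definition levi_civita_on ::
  "('a \<Rightarrow> 'a tangent \<Rightarrow> 'a tangent \<Rightarrow> real) \<Rightarrow> 'a set \<Rightarrow> 'a connection \<Rightarrow> bool" where
  "levi_civita_on g W D \<longleftrightarrow>
     (\<forall>U X Y. U \<subseteq> W \<longrightarrow> vfield U X \<longrightarrow> vfield U Y \<longrightarrow> vfield U (\<lambda>p. D p (X p) Y)) \<and>
     (\<forall>U Y. U \<subseteq> W \<longrightarrow> vfield U Y \<longrightarrow> (\<forall>p\<in>U. \<forall>u\<in>tanv p. \<forall>v\<in>tanv p. \<forall>a b.
        D p (a *\<^sub>R u + b *\<^sub>R v) Y = a *\<^sub>R D p u Y + b *\<^sub>R D p v Y)) \<and>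
     (\<forall>U Y Z. U \<subseteq> W \<longrightarrow> vfield U Y \<longrightarrow> vfield U Z \<longrightarrow> (\<forall>p\<in>U. \<forall>v\<in>tanv p.
        D p v (\<lambda>q. Y q + Z q) = D p v Y + D p v Z)) \<and>
     (\<forall>U f Y. U \<subseteq> W \<longrightarrow> smooth U f \<longrightarrow> vfield U Y \<longrightarrow> (\<forall>p\<in>U. \<forall>v\<in>tanv p.
        D p v (\<lambda>q. f q *\<^sub>R Y q) = v f *\<^sub>R Y p + f p *\<^sub>R D p v Y)) \<and>
     (\<forall>U X Y. U \<subseteq> W \<longrightarrow> vfield U X \<longrightarrow> vfield U Y \<longrightarrow> (\<forall>p\<in>U.
        D p (X p) Y - D p (Y p) X = bracket X Y p)) \<and>
     (\<forall>U Y Z. U \<subseteq> W \<longrightarrow> vfield U Y \<longrightarrow> vfield U Z \<longrightarrow> (\<forall>p\<in>U. \<forall>v\<in>tanv p.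
        v (\<lambda>q. g q (Y q) (Z q)) = g p (D p v Y) (Z p) + g p (Y p) (D p v Z)))"

lemma levi_civita_onD:
  assumes "levi_civita_on g W D" "U \<subseteq> W" "vfield U Y" "p \<in> U"
  shows "vfield U X \<Longrightarrow> vfield U (\<lambda>p. D p (X p) Y)"
    and "u \<in> tanv p \<Longrightarrow> v \<in> tanv p \<Longrightarrow> D p (a *\<^sub>R u + b *\<^sub>R v) Y = a *\<^sub>R D p u Y + b *\<^sub>R D p v Y"
    and "vfield U Z \<Longrightarrow> v \<in> tanv p \<Longrightarrow> D p v (\<lambda>q. Y q + Z q) = D p v Y + D p v Z"
    and "smooth U f \<Longrightarrow> v \<in> tanv p \<Longrightarrow> D p v (\<lambda>q. f q *\<^sub>R Y q) = v f *\<^sub>R Y p + f p *\<^sub>R D p v Y"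
    and "vfield U X \<Longrightarrow> D p (X p) Y - D p (Y p) X = bracket X Y p"
    and "vfield U Z \<Longrightarrow> v \<in> tanv p \<Longrightarrow>
      v (\<lambda>q. g q (Y q) (Z q)) = g p (D p v Y) (Z p) + g p (Y p) (D p v Z)"
proof -
  note D = assms(1)[unfolded levi_civita_on_def]
  show "vfield U X \<Longrightarrow> vfield U (\<lambda>p. D p (X p) Y)"
    by (rule D[THEN conjunct1, rule_format, OF assms(2) _ assms(3)])
  show "u \<in> tanv p \<Longrightarrow> v \<in> tanv p \<Longrightarrow> D p (a *\<^sub>R u + b *\<^sub>R v) Y = a *\<^sub>R D p u Y + b *\<^sub>R D p v Y"
    by (rule D[THEN conjunct2, THEN conjunct1, rule_format, OF assms(2,3,4)])
  show "vfield U Z \<Longrightarrow> v \<in> tanv p \<Longrightarrow> D p v (\<lambda>q. Y q + Z q) = D p v Y + D p v Z"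
    by (rule D[THEN conjunct2, THEN conjunct2, THEN conjunct1, rule_format, OF assms(2,3) _ assms(4)])
  show "smooth U f \<Longrightarrow> v \<in> tanv p \<Longrightarrow> D p v (\<lambda>q. f q *\<^sub>R Y q) = v f *\<^sub>R Y p + f p *\<^sub>R D p v Y"
    by (rule D[THEN conjunct2, THEN conjunct2, THEN conjunct2, THEN conjunct1, rule_format, OF assms(2) _ assms(3,4)])
  show "vfield U X \<Longrightarrow> D p (X p) Y - D p (Y p) X = bracket X Y p"
    by (rule D[THEN conjunct2, THEN conjunct2, THEN conjunct2, THEN conjunct2, THEN conjunct1, rule_format, OF assms(2) _ assms(3,4)])
  show "vfield U Z \<Longrightarrow> v \<in> tanv p \<Longrightarrow>
      v (\<lambda>q. g q (Y q) (Z q)) = g p (D p v Y) (Z p) + g p (Y p) (D p v Z)"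
    by (rule D[THEN conjunct2, THEN conjunct2, THEN conjunct2, THEN conjunct2, THEN conjunct2, rule_format, OF assms(2,3) _ assms(4)])
qed

lemma levi_civita_imp_on:
  assumes "levi_civita M A g D"
  shows "levi_civita_on g W D"
proof -
  note D = assms[unfolded levi_civita_def affine_connection_def conj_assoc]
  show ?thesis
    unfolding levi_civita_on_def
  proof (intro conjI allI impI ballI, goal_cases)
    case 1
    then show ?case by (intro D[THEN conjunct1, rule_format])
  next
    case 2
    then show ?case by (intro D[THEN conjunct2, THEN conjunct1, rule_format])
  next
    case 3
    then show ?case by (intro D[THEN conjunct2, THEN conjunct2, THEN conjunct1, rule_format])
  next
    case 4
    then show ?case by (intro D[THEN conjunct2, THEN conjunct2, THEN conjunct2, THEN conjunct1, rule_format])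
  next
    case 5
    then show ?case by (intro D[THEN conjunct2, THEN conjunct2, THEN conjunct2, THEN conjunct2, THEN conjunct1, rule_format])
  next
    case 6
    then show ?case by (intro D[THEN conjunct2, THEN conjunct2, THEN conjunct2, THEN conjunct2, THEN conjunct2, rule_format])
  qed
qed

lemma levi_civita_on_subset:
  assumes "levi_civita_on g W D" "V \<subseteq> W"
  shows "levi_civita_on g V D"
proof -
  note D = assms(1)[unfolded levi_civita_on_def]
  show ?thesis
    unfolding levi_civita_on_def
  proof (intro conjI allI impI ballI, goal_cases)
    case 1
    then show ?case by (intro D[THEN conjunct1, rule_format, OF order_trans[OF _ assms(2)]])
  next
    case 2
    then show ?case by (intro D[THEN conjunct2, THEN conjunct1, rule_format, OF order_trans[OF _ assms(2)]])
  next
    case 3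
    then show ?case by (intro D[THEN conjunct2, THEN conjunct2, THEN conjunct1, rule_format, OF order_trans[OF _ assms(2)]])
  next
    case 4
    then show ?case by (intro D[THEN conjunct2, THEN conjunct2, THEN conjunct2, THEN conjunct1, rule_format, OF order_trans[OF _ assms(2)]])
  next
    case 5
    then show ?case by (intro D[THEN conjunct2, THEN conjunct2, THEN conjunct2, THEN conjunct2, THEN conjunct1, rule_format, OF order_trans[OF _ assms(2)]])
  next
    case 6
    then show ?case by (intro D[THEN conjunct2, THEN conjunct2, THEN conjunct2, THEN conjunct2, THEN conjunct2, rule_format, OF order_trans[OF _ assms(2)]])
  qed
qed

section \<open>Connection coefficients of an orthonormal frame\<close>

definition structure_coeff ::
  "('a \<Rightarrow> 'a tangent \<Rightarrow> 'a tangent \<Rightarrow> real) \<Rightarrow> ('i \<Rightarrow> 'a \<Rightarrow> 'a tangent) \<Rightarrow> 'i \<Rightarrow> 'i \<Rightarrow> 'i \<Rightarrow> 'a \<Rightarrow> real" where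
  "structure_coeff g E i j k q = g q (bracket (E i) (E j) q) (E k q)"

text \<open>Koszul's formula for the \<open>E k\<close> component of the derivative of
  \<open>E j\<close> along \<open>E i\<close>; its derivative terms are absent because the inner
  products of frame fields are constant.\<close>

definition christoffel ::
  "('a \<Rightarrow> 'a tangent \<Rightarrow> 'a tangent \<Rightarrow> real) \<Rightarrow> ('i \<Rightarrow> 'a \<Rightarrow> 'a tangent) \<Rightarrow> 'i \<Rightarrow> 'i \<Rightarrow> 'i \<Rightarrow> 'a \<Rightarrow> real" where
  "christoffel g E i j k q =
     (structure_coeff g E i j k q - structure_coeff g E j k i q + structure_coeff g E k i j q) / 2"

text \<open>The formula forced by additivity and the Leibniz rule once Y is expanded in the
  frame.\<close>

definition frame_connection ::
  "('a \<Rightarrow> 'a tangent \<Rightarrow> 'a tangent \<Rightarrow> real) \<Rightarrow> ('i::finite \<Rightarrow> 'a \<Rightarrow> 'a tangent) \<Rightarrow> 'a connection" where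
  "frame_connection g E p v Y = (\<Sum>k\<in>UNIV. (v (\<lambda>q. g q (Y q) (E k q)) +
     (\<Sum>i\<in>UNIV. \<Sum>j\<in>UNIV. g p v (E i p) * g p (Y p) (E j p) * christoffel g E i j k p)) *\<^sub>R E k p)"

lemma structure_coeff_skew: "structure_coeff g E i j k q = - structure_coeff g E j i k q"
  if "riemannian_metric M A g" "orthonormal_frame g W E" "q \<in> W"
proof -
  note E = orthonormal_frameD[OF that(2)]
  have "bracket (E i) (E j) q = (-1) *\<^sub>R bracket (E j) (E i) q"
    using bracket_skew[of "E i" "E j" q] by simp
  then show ?thesis
    using metric_scale_left[OF that(1) vfield_topspace[OF E(2) that(3)]
        vfield_tan[OF vfield_bracket[OF E(2,2)] that(3)] E(5)[OF that(3)], of "-1"]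
    by (simp add: structure_coeff_def)
qed

context
  fixes g and E :: "'i::finite \<Rightarrow> 'a \<Rightarrow> 'a tangent" and W
  assumes metric: "riemannian_metric M A g" and frame: "orthonormal_frame g W E"
begin

private lemmas E = orthonormal_frameD[OF frame]

private lemma top: "q \<in> W \<Longrightarrow> q \<in> topspace M"
  using E(1) openin_subset by blast

lemma frame_coeff: "q \<in> W \<Longrightarrow> g q (\<Sum>k\<in>UNIV. c k *\<^sub>R E k q) (E j q) = c j"
  by (simp add: metric_sum_left[OF metric top] metric_scale_left[OF metric top] tan_space_intros E
      of_bool_def if_distrib[of "\<lambda>x. _ * x"] cong: if_cong)

lemma frame_inner:
  assumes "q \<in> W" "u \<in> tanv q" "v \<in> tanv q"
  shows "g q u v = (\<Sum>k\<in>UNIV. g q u (E k q) * g q v (E k q))"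
proof -
  have "g q u v = g q (\<Sum>k\<in>UNIV. g q u (E k q) *\<^sub>R E k q) v"
    using E(4)[OF assms(1,2)] by simp
  also have "\<dots> = (\<Sum>k\<in>UNIV. g q u (E k q) * g q (E k q) v)"
    using assms by (simp add: metric_sum_left[OF metric top] metric_scale_left[OF metric top] tan_space_intros E)
  also have "\<dots> = (\<Sum>k\<in>UNIV. g q u (E k q) * g q v (E k q))"
    using metric_sym[OF metric top[OF assms(1)] E(5)[OF assms(1)] assms(3)] by simp
  finally show ?thesis .
qed

lemma frame_eqI:
  assumes "q \<in> W" "u \<in> tanv q" "v \<in> tanv q" "\<And>k. g q u (E k q) = g q v (E k q)"
  shows "u = v"
  using E(4)[OF assms(1,2)] E(4)[OF assms(1,3)] assms(4) by simp

lemma frame_coeff_smooth: "U \<subseteq> W \<Longrightarrow> vfield U Y \<Longrightarrow> smooth U (\<lambda>q. g q (Y q) (E k q))"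
  by (rule metric_smooth[OF metric _ vfield_subset[OF E(2) vfield_open]]) auto

lemma structure_coeff_smooth: "smooth W (structure_coeff g E i j k)"
  unfolding structure_coeff_def[abs_def] by (intro metric_smooth[OF metric] vfield_bracket E)

lemma christoffel_smooth: "smooth W (christoffel g E i j k)"
  unfolding christoffel_def[abs_def] by (intro smooth_intros structure_coeff_smooth E) simp

text \<open>This is metric compatibility for frame fields, and the torsion identity after it is
  symmetry of the connection. Both follow from skewness of the structure coefficients in the first
  two indices.\<close>

lemma christoffel_skew:
  assumes "q \<in> W"
  shows "christoffel g E i j k q = - christoffel g E i k j q"
  using structure_coeff_skew[OF metric frame assms, of i k j] structure_coeff_skew[OF metric frame assms, of k j i]
    structure_coeff_skew[OF metric frame assms, of j i k]
  by (simp add: christoffel_def field_simps)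

lemma christoffel_torsion:
  assumes "q \<in> W"
  shows "christoffel g E i j k q - christoffel g E j i k q = structure_coeff g E i j k q"
  using structure_coeff_skew[OF metric frame assms, of i j k] structure_coeff_skew[OF metric frame assms, of i k j]
    structure_coeff_skew[OF metric frame assms, of k j i]
  by (simp add: christoffel_def field_simps)

lemma frame_expand_apply:
  assumes "q \<in> W" "v \<in> tanv q"
  shows "v f = (\<Sum>i\<in>UNIV. g q v (E i q) * E i q f)"
proof -
  have "v f = (\<Sum>i\<in>UNIV. g q v (E i q) *\<^sub>R E i q) f"
    using E(4)[OF assms] by simp
  then show ?thesis
    by (simp add: sum_fun_apply scaleR_fun_def)
qed

text \<open>Isolates the second-order part of X Y f, which the bracket antisymmetrizes into brackets
  of frame fields.\<close>

lemma frame_second_derivative: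
  assumes U: "U \<subseteq> W" "vfield U X" "vfield U Y" "p \<in> U" and f: "near p f"
  shows "X p (\<lambda>q. Y q f) = (\<Sum>j\<in>UNIV. E j p f * X p (\<lambda>q. g q (Y q) (E j q))) +
    (\<Sum>i\<in>UNIV. \<Sum>j\<in>UNIV. g p (X p) (E i p) * g p (Y p) (E j p) * E i p (\<lambda>q. E j q f))"
proof -
  have pW: "p \<in> W" using U by auto
  have Xt: "X p \<in> tanv p" by (rule vfield_tan[OF U(2,4)])
  have nE: "near p (\<lambda>q. E j q f)" for j by (rule vfield_near[OF E(2) f pW])
  have nY: "near p (\<lambda>q. g q (Y q) (E j q))" for j
    using nearI[OF frame_coeff_smooth[OF U(1,3)] U(4)] .
  have "X p (\<lambda>q. Y q f) = X p (\<lambda>q. \<Sum>j\<in>UNIV. g q (Y q) (E j q) * E j q f)"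
  proof (rule tan_cong[OF Xt _ vfield_open[OF U(2)] U(4)])
    show "near p (\<lambda>q. Y q f)" by (rule vfield_near[OF U(3) f U(4)])
    show "Y q f = (\<Sum>j\<in>UNIV. g q (Y q) (E j q) * E j q f)" if "q \<in> U" for q
      using frame_expand_apply[OF _ vfield_tan[OF U(3) that]] U(1) that by blast
  qed
  also have "\<dots> = (\<Sum>j\<in>UNIV. g p (Y p) (E j p) * X p (\<lambda>q. E j q f) + E j p f * X p (\<lambda>q. g q (Y q) (E j q)))"
    using nE nY by (simp add: tan_sum[OF Xt top[OF pW]] near_mult tan_mult[OF Xt])
  also have "\<dots> = (\<Sum>j\<in>UNIV. E j p f * X p (\<lambda>q. g q (Y q) (E j q))) +
      (\<Sum>j\<in>UNIV. \<Sum>i\<in>UNIV. g p (X p) (E i p) * g p (Y p) (E j p) * E i p (\<lambda>q. E j q f))"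
    by (simp add: sum.distrib frame_expand_apply[OF pW Xt, of "\<lambda>q. E _ q f"] sum_distrib_left algebra_simps)
  also have "(\<Sum>j\<in>UNIV. \<Sum>i\<in>UNIV. g p (X p) (E i p) * g p (Y p) (E j p) * E i p (\<lambda>q. E j q f)) =
      (\<Sum>i\<in>UNIV. \<Sum>j\<in>UNIV. g p (X p) (E i p) * g p (Y p) (E j p) * E i p (\<lambda>q. E j q f))"
    by (rule sum.swap)
  finally show ?thesis .
qed

text \<open>The bracket is first expanded as a functional on germs, by subtracting two instances of
  \<open>frame_second_derivative\<close>, and only then paired with \<open>E k\<close>.\<close>

lemma frame_bracket:
  assumes U: "U \<subseteq> W" "vfield U X" "vfield U Y" "p \<in> U"
  shows "g p (bracket X Y p) (E k p) = X p (\<lambda>q. g q (Y q) (E k q)) - Y p (\<lambda>q. g q (X q) (E k q)) +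
    (\<Sum>i\<in>UNIV. \<Sum>j\<in>UNIV. g p (X p) (E i p) * g p (Y p) (E j p) * structure_coeff g E i j k p)"
proof -
  have pW: "p \<in> W" using U by auto
  let ?x = "\<lambda>i. g p (X p) (E i p)" and ?y = "\<lambda>j. g p (Y p) (E j p)"
  let ?B = "(\<Sum>k\<in>UNIV. (X p (\<lambda>q. g q (Y q) (E k q)) - Y p (\<lambda>q. g q (X q) (E k q))) *\<^sub>R E k p) +
    (\<Sum>i\<in>UNIV. \<Sum>j\<in>UNIV. (?x i * ?y j) *\<^sub>R bracket (E i) (E j) p)"
  have "bracket X Y p = ?B"
  proof (rule ext)
    fix f
    show "bracket X Y p f = ?B f"
    proof (cases "near p f")
      case True
      have "(\<Sum>i\<in>UNIV. \<Sum>j\<in>UNIV. ?y i * ?x j * E i p (\<lambda>q. E j q f)) =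
          (\<Sum>i\<in>UNIV. \<Sum>j\<in>UNIV. ?x i * ?y j * E j p (\<lambda>q. E i q f))"
        by (subst sum.swap) (simp add: mult.commute)
      then show ?thesis
        unfolding bracket_apply[OF True] frame_second_derivative[OF U True]
          frame_second_derivative[OF U(1,3,2,4) True]
        by (simp add: sum_fun_apply scaleR_fun_def bracket_apply[OF True] algebra_simps sum_subtractf)
    next
      case False
      then show ?thesis
        by (simp add: sum_fun_apply scaleR_fun_def bracket_not_near tan_not_near[OF E(5)[OF pW]])
    qed
  qed
  moreover have "bracket (E i) (E j) p \<in> tanv p" for i j
    by (rule vfield_tan[OF vfield_bracket[OF E(2,2)] pW])
  ultimately show ?thesis
    by (simp add: metric_add_left[OF metric top[OF pW]] frame_coeff[OF pW] metric_sum_left[OF metric top[OF pW]]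
        metric_scale_left[OF metric top[OF pW]] tan_space_intros E(5)[OF pW] structure_coeff_def)
qed

lemma frame_connection_tan: "p \<in> W \<Longrightarrow> frame_connection g E p v Y \<in> tanv p"
  unfolding frame_connection_def by (intro tan_space_intros E)

lemma frame_connection_coeff:
  "p \<in> W \<Longrightarrow> g p (frame_connection g E p v Y) (E k p) = v (\<lambda>q. g q (Y q) (E k q)) +
     (\<Sum>i\<in>UNIV. \<Sum>j\<in>UNIV. g p v (E i p) * g p (Y p) (E j p) * christoffel g E i j k p)"
  unfolding frame_connection_def by (rule frame_coeff)

text \<open>Existence, locally. Algebraic conditions are compared component by component in the
  frame; symmetry and metric compatibility reduce to the torsion identity and the skewness of the
  Christoffel coefficients.\<close>

lemma frame_connection_levi_civita: "levi_civita_on g W (frame_connection g E)"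
  unfolding levi_civita_on_def
proof (intro conjI allI impI ballI)
  fix U X Y assume U: "U \<subseteq> W" "vfield U X" "vfield U Y"
  have o: "openin M U" by (rule vfield_open[OF U(2)])
  have "smooth U (christoffel g E i j k)" for i j k
    by (rule smooth_subset[OF christoffel_smooth o U(1)])
  then show "vfield U (\<lambda>p. frame_connection g E p (X p) Y)"
    unfolding frame_connection_def
    by (intro vfield_sum o vfield_scale vfield_subset[OF E(2) o U(1)] smooth_add smooth_sum smooth_mult
        frame_coeff_smooth[OF U(1)] U(2,3) vfield_smooth[OF U(2) order_refl])
  fix p assume p: "p \<in> U"
  then have pW: "p \<in> W" using U(1) by auto
  show "frame_connection g E p (X p) Y - frame_connection g E p (Y p) X = bracket X Y p"
  proof (rule frame_eqI[OF pW])
    show "bracket X Y p \<in> tanv p" by (rule vfield_tan[OF vfield_bracket[OF U(2,3)] p])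
    show "frame_connection g E p (X p) Y - frame_connection g E p (Y p) X \<in> tanv p"
      by (intro tan_space_intros frame_connection_tan pW)
    fix k
    have "(\<Sum>i\<in>UNIV. \<Sum>j\<in>UNIV. g p (Y p) (E i p) * g p (X p) (E j p) * christoffel g E i j k p) =
        (\<Sum>i\<in>UNIV. \<Sum>j\<in>UNIV. g p (X p) (E i p) * g p (Y p) (E j p) * christoffel g E j i k p)"
      by (subst sum.swap) (simp add: mult.commute)
    then show "g p (frame_connection g E p (X p) Y - frame_connection g E p (Y p) X) (E k p) =
        g p (bracket X Y p) (E k p)"
      unfolding frame_bracket[OF U p]
        metric_diff_left[OF metric top[OF pW] frame_connection_tan[OF pW] frame_connection_tan[OF pW] E(5)[OF pW]]
        frame_connection_coeff[OF pW] christoffel_torsion[OF pW, symmetric]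
      by (simp add: algebra_simps sum_subtractf)
  qed
next
  fix U Y p u v a b assume U: "U \<subseteq> W" "vfield U Y" and p: "p \<in> U" "u \<in> tanv p" "v \<in> tanv p"
  then have pW: "p \<in> W" by auto
  have ap: "(c *\<^sub>R w) f = c * w f" for c and w :: "'a tangent" and f
    by (simp add: scaleR_fun_def)
  show "frame_connection g E p (a *\<^sub>R u + b *\<^sub>R v) Y =
      a *\<^sub>R frame_connection g E p u Y + b *\<^sub>R frame_connection g E p v Y"
    by (rule frame_eqI[OF pW])
      (simp_all add: tan_space_intros frame_connection_tan pW frame_connection_coeff ap metric_linear_left[OF metric top[OF pW]] p E
        sum_distrib_left sum.distrib algebra_simps)
next
  fix U Y Z p v assume U: "U \<subseteq> W" "vfield U Y" "vfield U Z" and p: "p \<in> U" "v \<in> tanv p"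
  then have pW: "p \<in> W" by auto
  have n: "near p (\<lambda>q. g q (Y q) (E k q))" "near p (\<lambda>q. g q (Z q) (E k q))" for k
    using nearI[OF frame_coeff_smooth[OF U(1)] p(1)] U by blast+
  \<comment> \<open>Nothing is known about g and the fields outside U, so these functions agree only
    near p; hence the appeal to locality of v here and in the cases below.\<close>
  have "v (\<lambda>q. g q (Y q) (E k q) + g q (Z q) (E k q)) = v (\<lambda>q. g q (Y q + Z q) (E k q))" for k
  proof (rule tan_cong[OF p(2) near_add[OF n] vfield_open[OF U(2)] p(1)])
    show "g q (Y q) (E k q) + g q (Z q) (E k q) = g q (Y q + Z q) (E k q)" if "q \<in> U" for q
    proof -
      have "q \<in> W" using that U(1) by auto
      then show ?thesis
        using metric_add_left[OF metric top _ _ E(5)] vfield_tan[OF U(2) that] vfield_tan[OF U(3) that] by simp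
    qed
  qed
  then have "v (\<lambda>q. g q (Y q + Z q) (E k q)) = v (\<lambda>q. g q (Y q) (E k q)) + v (\<lambda>q. g q (Z q) (E k q))" for k
    using tan_add[OF p(2) n] by metis
  then show "frame_connection g E p v (\<lambda>q. Y q + Z q) = frame_connection g E p v Y + frame_connection g E p v Z"
    by (intro frame_eqI[OF pW])
      (simp_all add: tan_space_intros frame_connection_tan pW frame_connection_coeff
        metric_add_left[OF metric top[OF pW]] vfield_tan[OF U(2) p(1)] vfield_tan[OF U(3) p(1)] E
        sum.distrib algebra_simps)
next
  fix U f Y p v assume U: "U \<subseteq> W" "smooth U f" "vfield U Y" and p: "p \<in> U" "v \<in> tanv p"
  then have pW: "p \<in> W" by auto
  have n: "near p (\<lambda>q. g q (Y q) (E k q))" "near p f" for k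
    using nearI[OF frame_coeff_smooth[OF U(1,3)] p(1)] nearI[OF U(2) p(1)] by blast+
  have "v (\<lambda>q. f q * g q (Y q) (E k q)) = v (\<lambda>q. g q (f q *\<^sub>R Y q) (E k q))" for k
  proof (rule tan_cong[OF p(2) near_mult[OF n(2,1)] vfield_open[OF U(3)] p(1)])
    show "f q * g q (Y q) (E k q) = g q (f q *\<^sub>R Y q) (E k q)" if "q \<in> U" for q
    proof -
      have "q \<in> W" using that U(1) by auto
      then show ?thesis
        using metric_scale_left[OF metric top _ E(5)] vfield_tan[OF U(3) that] by simp
    qed
  qed
  then have "v (\<lambda>q. g q (f q *\<^sub>R Y q) (E k q)) = f p * v (\<lambda>q. g q (Y q) (E k q)) + g p (Y p) (E k p) * v f" for k
    using tan_mult[OF p(2) n(2,1)] by metis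
  then show "frame_connection g E p v (\<lambda>q. f q *\<^sub>R Y q) = v f *\<^sub>R Y p + f p *\<^sub>R frame_connection g E p v Y"
    by (intro frame_eqI[OF pW])
      (simp_all add: tan_space_intros frame_connection_tan pW frame_connection_coeff
        metric_add_left[OF metric top[OF pW]] metric_scale_left[OF metric top[OF pW]] vfield_tan[OF U(3) p(1)] E
        sum_distrib_left algebra_simps)
next
  fix U Y Z p v assume U: "U \<subseteq> W" "vfield U Y" "vfield U Z" and p: "p \<in> U" "v \<in> tanv p"
  then have pW: "p \<in> W" by auto
  let ?y = "\<lambda>k q. g q (Y q) (E k q)" and ?z = "\<lambda>k q. g q (Z q) (E k q)" and ?c = "\<lambda>i j k. christoffel g E i j k p"
  have n: "near p (?y k)" "near p (?z k)" for k
    using nearI[OF frame_coeff_smooth[OF U(1)] p(1)] U by blast+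
  note t = vfield_tan[OF U(2) p(1)] vfield_tan[OF U(3) p(1)]
  have "v (\<lambda>q. \<Sum>k\<in>UNIV. ?y k q * ?z k q) = v (\<lambda>q. g q (Y q) (Z q))"
  proof (rule tan_cong[OF p(2) _ vfield_open[OF U(2)] p(1)])
    show "near p (\<lambda>q. \<Sum>k\<in>UNIV. ?y k q * ?z k q)"
      by (intro near_sum top pW near_mult n)
    show "(\<Sum>k\<in>UNIV. ?y k q * ?z k q) = g q (Y q) (Z q)" if "q \<in> U" for q
      using frame_inner[OF _ vfield_tan[OF U(2) that] vfield_tan[OF U(3) that]] U(1) that by auto
  qed
  moreover have "v (\<lambda>q. \<Sum>k\<in>UNIV. ?y k q * ?z k q) = (\<Sum>k\<in>UNIV. ?y k p * v (?z k) + ?z k p * v (?y k))"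
    by (simp add: tan_sum[OF p(2) top[OF pW]] near_mult n tan_mult[OF p(2)])
  ultimately have 1: "v (\<lambda>q. g q (Y q) (Z q)) = (\<Sum>k\<in>UNIV. ?y k p * v (?z k)) + (\<Sum>k\<in>UNIV. ?z k p * v (?y k))"
    by (simp add: sum.distrib)
  have 2: "g p (frame_connection g E p v Y) (Z p) = (\<Sum>k\<in>UNIV. ?z k p * v (?y k)) +
      (\<Sum>k\<in>UNIV. \<Sum>i\<in>UNIV. \<Sum>j\<in>UNIV. g p v (E i p) * ?y j p * ?z k p * ?c i j k)"
    unfolding frame_inner[OF pW frame_connection_tan[OF pW] t(2)] frame_connection_coeff[OF pW]
    by (simp add: sum.distrib sum_distrib_left algebra_simps)
  have 3: "g p (Y p) (frame_connection g E p v Z) = (\<Sum>j\<in>UNIV. ?y j p * v (?z j)) +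
      (\<Sum>j\<in>UNIV. \<Sum>i\<in>UNIV. \<Sum>k\<in>UNIV. g p v (E i p) * ?z k p * ?y j p * ?c i k j)"
    unfolding frame_inner[OF pW t(1) frame_connection_tan[OF pW]] frame_connection_coeff[OF pW]
    by (simp add: sum.distrib sum_distrib_left algebra_simps)
  \<comment> \<open>The sums are reordered until the Christoffel terms of the two covariant
    derivatives match index by index; skewness in the last two indices then cancels them.\<close>
  have "(\<Sum>j\<in>UNIV. \<Sum>i\<in>UNIV. \<Sum>k\<in>UNIV. g p v (E i p) * ?z k p * ?y j p * ?c i k j) =
      (\<Sum>i\<in>UNIV. \<Sum>j\<in>UNIV. \<Sum>k\<in>UNIV. g p v (E i p) * ?z k p * ?y j p * ?c i k j)"
    by (rule sum.swap)
  also have "\<dots> = (\<Sum>i\<in>UNIV. \<Sum>k\<in>UNIV. \<Sum>j\<in>UNIV. g p v (E i p) * ?z k p * ?y j p * ?c i k j)"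
    by (rule sum.cong[OF refl sum.swap])
  also have "\<dots> = (\<Sum>k\<in>UNIV. \<Sum>i\<in>UNIV. \<Sum>j\<in>UNIV. g p v (E i p) * ?z k p * ?y j p * ?c i k j)"
    by (rule sum.swap)
  also have "\<dots> = - (\<Sum>k\<in>UNIV. \<Sum>i\<in>UNIV. \<Sum>j\<in>UNIV. g p v (E i p) * ?y j p * ?z k p * ?c i j k)"
    unfolding sum_negf[symmetric]
    by (intro sum.cong refl) (subst christoffel_skew[OF pW], simp)
  finally show "v (\<lambda>q. g q (Y q) (Z q)) =
      g p (frame_connection g E p v Y) (Z p) + g p (Y p) (frame_connection g E p v Z)"
    using 1 2 3 by simp
qed

end

end

section \<open>Uniqueness of the Levi-Civita connection and curvature components\<close>

context smooth_space
begin

text \<open>With i the indicator function of U, the fields i Y and i Z are equal everywhere. In the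
  Leibniz rule the derivative of i contributes the same term on both sides, because Y and Z agree at
  p.\<close>

lemma levi_civita_on_cong:
  assumes D: "levi_civita_on g W D" and U: "U \<subseteq> W" "vfield U Y" and p: "p \<in> U" "v \<in> tanv p"
    and eq: "\<And>q. q \<in> U \<Longrightarrow> Y q = Z q"
  shows "D p v Y = D p v Z"
proof -
  define i where "i q = (if q \<in> U then 1 else 0::real)" for q
  have i: "smooth U i"
    by (rule smooth_cong[OF smooth_const[OF vfield_open[OF U(2)], of 1]]) (simp add: i_def)
  have Z: "vfield U Z" by (rule vfield_cong[OF U(2) eq])
  have "(\<lambda>q. i q *\<^sub>R Y q) = (\<lambda>q. i q *\<^sub>R Z q)"
    using eq by (auto simp: i_def)
  then have "v i *\<^sub>R Y p + i p *\<^sub>R D p v Y = v i *\<^sub>R Z p + i p *\<^sub>R D p v Z"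
    using levi_civita_onD(4)[OF D U p(1) i p(2)] levi_civita_onD(4)[OF D U(1) Z p(1) i p(2)] by simp
  then show ?thesis
    using eq[OF p(1)] p(1) by (simp add: i_def)
qed

lemma levi_civita_on_sum:
  assumes D: "levi_civita_on g W D" and U: "U \<subseteq> W" "openin M U" and p: "p \<in> U" "v \<in> tanv p"
    and J: "\<And>j. j \<in> J \<Longrightarrow> smooth U (f j)" "\<And>j. j \<in> J \<Longrightarrow> vfield U (X j)"
  shows "D p v (\<lambda>q. \<Sum>j\<in>J. f j q *\<^sub>R X j q) = (\<Sum>j\<in>J. v (f j) *\<^sub>R X j p + f j p *\<^sub>R D p v (X j))"
proof -
  have top: "p \<in> topspace M" using U(2) p(1) openin_subset by blast
  \<comment> \<open>Additivity handles two summands at a time; the empty sum comes from the Leibniz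
    rule with factor 0.\<close>
  have "D p v (\<lambda>q. 0 *\<^sub>R 0) = v (\<lambda>q. 0) *\<^sub>R 0 + 0 *\<^sub>R D p v (\<lambda>q. 0)"
    by (rule levi_civita_onD(4)[OF D U(1) vfield_zero[OF U(2)] p(1) smooth_const[OF U(2)] p(2)])
  then have 0: "D p v (\<lambda>q. 0) = 0" by simp
  show ?thesis
    using J
  proof (induction J rule: infinite_finite_induct)
    case (insert j J)
    have v: "vfield U (\<lambda>q. f j q *\<^sub>R X j q)" "vfield U (\<lambda>q. \<Sum>j\<in>J. f j q *\<^sub>R X j q)"
      using insert.prems by (auto intro!: vfield_scale vfield_sum U(2))
    have IH: "D p v (\<lambda>q. \<Sum>j\<in>J. f j q *\<^sub>R X j q) = (\<Sum>j\<in>J. v (f j) *\<^sub>R X j p + f j p *\<^sub>R D p v (X j))"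
      by (rule insert.IH) (use insert.prems in auto)
    have 1: "D p v (\<lambda>q. f j q *\<^sub>R X j q) = v (f j) *\<^sub>R X j p + f j p *\<^sub>R D p v (X j)"
      by (rule levi_civita_onD(4)[OF D U(1) _ p(1) _ p(2)]) (use insert.prems in auto)
    have "D p v (\<lambda>q. f j q *\<^sub>R X j q + (\<Sum>j\<in>J. f j q *\<^sub>R X j q)) =
        D p v (\<lambda>q. f j q *\<^sub>R X j q) + D p v (\<lambda>q. \<Sum>j\<in>J. f j q *\<^sub>R X j q)"
      by (rule levi_civita_onD(3)[OF D U(1) v(1) p(1) v(2) p(2)])
    then show ?case
      unfolding sum.insert[OF insert.hyps] IH 1 .
  qed (simp_all add: 0)
qed

lemma levi_civita_on_sum_direction:
  assumes D: "levi_civita_on g W D" and U: "U \<subseteq> W" "vfield U Y" and p: "p \<in> U" "\<And>i. i \<in> I \<Longrightarrow> u i \<in> tanv p"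
  shows "D p (\<Sum>i\<in>I. c i *\<^sub>R u i) Y = (\<Sum>i\<in>I. c i *\<^sub>R D p (u i) Y)"
proof -
  have "D p (0 *\<^sub>R 0 + 0 *\<^sub>R 0) Y = 0 *\<^sub>R D p 0 Y + 0 *\<^sub>R D p 0 Y"
    by (rule levi_civita_onD(2)[OF D U p(1)]) (rule tan_space_intros)+
  then have 0: "D p 0 Y = 0" by simp
  show ?thesis
    using p(2)
  proof (induction I rule: infinite_finite_induct)
    case (insert i I)
    have "D p (c i *\<^sub>R u i + 1 *\<^sub>R (\<Sum>i\<in>I. c i *\<^sub>R u i)) Y =
        c i *\<^sub>R D p (u i) Y + 1 *\<^sub>R D p (\<Sum>i\<in>I. c i *\<^sub>R u i) Y"
      by (rule levi_civita_onD(2)[OF D U p(1)]) (use insert.prems in \<open>auto intro!: tan_space_intros(3,4)\<close>)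
    then have 1: "D p (c i *\<^sub>R u i + (\<Sum>i\<in>I. c i *\<^sub>R u i)) Y =
        c i *\<^sub>R D p (u i) Y + D p (\<Sum>i\<in>I. c i *\<^sub>R u i) Y"
      unfolding scaleR_one .
    have IH: "D p (\<Sum>i\<in>I. c i *\<^sub>R u i) Y = (\<Sum>i\<in>I. c i *\<^sub>R D p (u i) Y)"
      by (rule insert.IH) (use insert.prems in auto)
    show ?case
      unfolding sum.insert[OF insert.hyps] 1 IH ..
  qed (simp_all add: 0)
qed

text \<open>The component along \<open>E k\<close> of the curvature operator of \<open>E m\<close>,
  \<open>E n\<close> applied to \<open>E j\<close>, written in connection coefficients.\<close>

definition curvature_coeff ::
  "('a \<Rightarrow> 'a tangent \<Rightarrow> 'a tangent \<Rightarrow> real) \<Rightarrow> ('i::finite \<Rightarrow> 'a \<Rightarrow> 'a tangent) \<Rightarrow> 'i \<Rightarrow> 'i \<Rightarrow> 'i \<Rightarrow> 'i \<Rightarrow> 'a \<Rightarrow> real" where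
  "curvature_coeff g E m n j k p =
     E m p (christoffel g E n j k) - E n p (christoffel g E m j k)
     - (\<Sum>i\<in>UNIV. structure_coeff g E m n i p * christoffel g E i j k p)
     + (\<Sum>l\<in>UNIV. christoffel g E m l k p * christoffel g E n j l p
          - christoffel g E n l k p * christoffel g E m j l p)"

context
  fixes g and E :: "'i::finite \<Rightarrow> 'a \<Rightarrow> 'a tangent" and W
  assumes metric: "riemannian_metric M A g" and frame: "orthonormal_frame g W E"
begin

private lemmas onf = orthonormal_frameD[OF frame]

private lemma onf_top: "q \<in> W \<Longrightarrow> q \<in> topspace M"
  using onf(1) openin_subset by blast

text \<open>Koszul's argument: skewness in the last two indices comes from differentiating the
  constant inner products, and together with the cyclic instances of the torsion identity it
  determines the coefficients.\<close>

lemma levi_civita_on_frame: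
  assumes D: "levi_civita_on g W D" and p: "p \<in> W"
  shows "g p (D p (E i p) (E j)) (E k p) = christoffel g E i j k p"
proof -
  let ?G = "\<lambda>i j k. g p (D p (E i p) (E j)) (E k p)"
  have t: "D p (E i p) (E j) \<in> tanv p" for i j
    by (rule vfield_tan[OF levi_civita_onD(1)[OF D order_refl onf(2) p onf(2)] p])
  have skew: "?G i j k = - ?G i k j" for i j k
  proof -
    have "E i p (\<lambda>q. of_bool (j = k)) = E i p (\<lambda>q. g q (E j q) (E k q))"
      by (rule tan_cong[OF onf(5)[OF p] near_const[OF onf_top[OF p]] onf(1) p]) (simp add: onf(3))
    then have "g p (D p (E i p) (E j)) (E k p) + g p (E j p) (D p (E i p) (E k)) = 0"
      using levi_civita_onD(6)[OF D order_refl onf(2)[of j] p onf(2)[of k] onf(5)[OF p, of i]]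
        tan_const[OF onf(5)[OF p] onf_top[OF p]] by simp
    then show ?thesis
      using metric_sym[OF metric onf_top[OF p] t onf(5)[OF p], of i k j] by simp
  qed
  have tor: "?G i j k - ?G j i k = structure_coeff g E i j k p" for i j k
    using levi_civita_onD(5)[OF D order_refl onf(2)[of j] p onf(2)[of i]]
      metric_diff_left[OF metric onf_top[OF p] t t onf(5)[OF p], of i j j i k]
    by (simp add: structure_coeff_def)
  show ?thesis
    using skew[of i j k] skew[of j i k] skew[of k i j] tor[of i j k] tor[of j k i] tor[of k i j]
      skew[of j k i]
    by (simp add: christoffel_def field_simps)
qed

text \<open>Makes frame connections agree where their domains overlap, and lets the curvature of any
  Levi-Civita connection be computed from Christoffel coefficients. Locality allows Y to be replaced
  by its frame expansion near p.\<close>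

lemma levi_civita_on_unique:
  assumes D: "levi_civita_on g W D" and U: "vfield U Y" and p: "p \<in> U" "p \<in> W" "v \<in> tanv p"
  shows "D p v Y = frame_connection g E p v Y"
proof -
  define V where "V = U \<inter> W"
  have V: "V \<subseteq> W" "openin M V" "p \<in> V" using vfield_open[OF U] onf(1) p by (auto simp: V_def)
  have Y: "vfield V Y" using vfield_subset[OF U V(2)] by (simp add: V_def)
  have t: "D p (E i p) (E j) \<in> tanv p" for i j
    by (rule vfield_tan[OF levi_civita_onD(1)[OF D order_refl onf(2) p(2) onf(2)] p(2)])
  let ?y = "\<lambda>j q. g q (Y q) (E j q)"
  have "Y q = (\<Sum>j\<in>UNIV. ?y j q *\<^sub>R E j q)" if "q \<in> V" for q
    using onf(4) vfield_tan[OF Y that] that V(1) by blast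
  then have "D p v Y = D p v (\<lambda>q. \<Sum>j\<in>UNIV. ?y j q *\<^sub>R E j q)"
    by (rule levi_civita_on_cong[OF D V(1) Y V(3) p(3)])
  also have "\<dots> = (\<Sum>j\<in>UNIV. v (?y j) *\<^sub>R E j p + ?y j p *\<^sub>R D p v (E j))"
    by (rule levi_civita_on_sum[OF D V(1,2,3) p(3)])
      (rule frame_coeff_smooth[OF metric frame V(1) Y] vfield_subset[OF onf(2) V(2,1)])+
  also have "\<dots> = (\<Sum>j\<in>UNIV. v (?y j) *\<^sub>R E j p +
      ?y j p *\<^sub>R (\<Sum>i\<in>UNIV. g p v (E i p) *\<^sub>R D p (E i p) (E j)))"
  proof -
    have "D p v (E j) = (\<Sum>i\<in>UNIV. g p v (E i p) *\<^sub>R D p (E i p) (E j))" for j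
      using levi_civita_on_sum_direction[OF D order_refl onf(2) p(2), of UNIV "\<lambda>i. E i p" "\<lambda>i. g p v (E i p)" j]
        onf(5)[OF p(2)] onf(4)[OF p(2,3)] by simp
    then show ?thesis by simp
  qed
  finally have eq: "D p v Y = (\<Sum>j\<in>UNIV. v (?y j) *\<^sub>R E j p +
      ?y j p *\<^sub>R (\<Sum>i\<in>UNIV. g p v (E i p) *\<^sub>R D p (E i p) (E j)))" .
  show ?thesis
  proof (rule frame_eqI[OF metric frame p(2)])
    show "D p v Y \<in> tanv p" unfolding eq by (intro tan_space_intros t onf p)
    show "frame_connection g E p v Y \<in> tanv p" by (rule frame_connection_tan[OF metric frame p(2)])
    fix k
    have "g p (D p v Y) (E k p) = (\<Sum>j\<in>UNIV. v (?y j) * of_bool (j = k) +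
      ?y j p * (\<Sum>i\<in>UNIV. g p v (E i p) * christoffel g E i j k p))"
      unfolding eq
      by (simp add: metric_sum_left[OF metric onf_top[OF p(2)]] metric_add_left[OF metric onf_top[OF p(2)]]
          metric_scale_left[OF metric onf_top[OF p(2)]] tan_space_intros t onf p levi_civita_on_frame[OF D p(2)])
    also have "\<dots> = v (?y k) + (\<Sum>j\<in>UNIV. \<Sum>i\<in>UNIV. g p v (E i p) * ?y j p * christoffel g E i j k p)"
      by (simp add: sum.distrib sum_distrib_left of_bool_def if_distrib[of "\<lambda>x. _ * x"]
          if_distrib[of "\<lambda>x. x * _"] algebra_simps cong: if_cong)
    also have "(\<Sum>j\<in>UNIV. \<Sum>i\<in>UNIV. g p v (E i p) * ?y j p * christoffel g E i j k p) =
        (\<Sum>i\<in>UNIV. \<Sum>j\<in>UNIV. g p v (E i p) * ?y j p * christoffel g E i j k p)"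
      by (rule sum.swap)
    finally show "g p (D p v Y) (E k p) = g p (frame_connection g E p v Y) (E k p)"
      unfolding frame_connection_coeff[OF metric frame p(2)] .
  qed
qed

text \<open>Tensoriality of curvature in explicit form: all derivatives of the components of X, Y
  and Z cancel, and only their values at p remain.\<close>

lemma frame_curvature:
  assumes D: "levi_civita_on g W D" and U: "U \<subseteq> W" "vfield U X" "vfield U Y" "vfield U Z" and p: "p \<in> U"
  shows "g p (curvature M A D X Y Z p) (E k p) = (\<Sum>j\<in>UNIV. g p (Z p) (E j p) *
    (\<Sum>m\<in>UNIV. \<Sum>n\<in>UNIV. g p (X p) (E m p) * g p (Y p) (E n p) * curvature_coeff g E m n j k p))"
proof -
  have pW: "p \<in> W" and o: "openin M U" and ptop: "p \<in> topspace M"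
    using p U(1) vfield_open[OF U(2)] onf_top by auto
  \<comment> \<open>The matrix of connection one-forms of the frame, evaluated on X; the covariant
    derivative of Z along X has components X \<zeta> plus this matrix applied to \<zeta>.\<close>
  define \<omega> where "\<omega> X k j q = (\<Sum>i\<in>UNIV. g q (X q) (E i q) * christoffel g E i j k q)"
    for X :: "'a \<Rightarrow> 'a tangent" and k j q
  define \<zeta> where "\<zeta> k q = g q (Z q) (E k q)" for k q
  let ?\<Gamma> = "christoffel g E"
  have s\<Gamma>: "smooth U (?\<Gamma> i j k)" for i j k
    by (rule smooth_subset[OF christoffel_smooth[OF metric frame] o U(1)])
  have s\<zeta>: "smooth U (\<zeta> k)" for k
    unfolding \<zeta>_def[abs_def] by (rule frame_coeff_smooth[OF metric frame U(1,4)])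
  have s\<omega>: "smooth U (\<omega> X k j)" if "vfield U X" for X k j
    unfolding \<omega>_def[abs_def]
    by (intro smooth_sum smooth_mult o s\<Gamma> frame_coeff_smooth[OF metric frame U(1) that])
  note n = nearI[OF s\<Gamma> p] nearI[OF s\<zeta> p] nearI[OF s\<omega> p] nearI[OF frame_coeff_smooth[OF metric frame U(1)] p]
  have D1: "g q (D q v V) (E k q) = v (\<lambda>q. g q (V q) (E k q)) +
      (\<Sum>j\<in>UNIV. (\<Sum>i\<in>UNIV. g q v (E i q) * ?\<Gamma> i j k q) * g q (V q) (E j q))"
    if V: "vfield U V" and q: "q \<in> U" "v \<in> tanv q" for q v V k
  proof -
    have qW: "q \<in> W" using q(1) U(1) by auto
    have "(\<Sum>i\<in>UNIV. \<Sum>j\<in>UNIV. g q v (E i q) * g q (V q) (E j q) * ?\<Gamma> i j k q) =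
        (\<Sum>j\<in>UNIV. \<Sum>i\<in>UNIV. g q v (E i q) * g q (V q) (E j q) * ?\<Gamma> i j k q)"
      by (rule sum.swap)
    then show ?thesis
      unfolding levi_civita_on_unique[OF D V q(1) qW q(2)] frame_connection_coeff[OF metric frame qW]
      by (simp add: sum_distrib_right sum_distrib_left mult_ac)
  qed
  have D2: "g p (D p (X p) (\<lambda>q. D q (Y q) Z)) (E k p) = X p (\<lambda>q. Y q (\<zeta> k)) +
      (\<Sum>j\<in>UNIV. \<omega> Y k j p * X p (\<zeta> j) + \<zeta> j p * X p (\<omega> Y k j)) +
      (\<Sum>l\<in>UNIV. \<omega> X k l p * (Y p (\<zeta> l) + (\<Sum>j\<in>UNIV. \<omega> Y l j p * \<zeta> j p)))"
    if X: "vfield U X" and Y: "vfield U Y" for X Y k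
  proof -
    have DYZ: "vfield U (\<lambda>q. D q (Y q) Z)" by (rule levi_civita_onD(1)[OF D U(1,4) p Y])
    have c: "g q (D q (Y q) Z) (E k q) = Y q (\<zeta> k) + (\<Sum>j\<in>UNIV. \<omega> Y k j q * \<zeta> j q)" if "q \<in> U" for q k
      unfolding D1[OF U(4) that vfield_tan[OF Y that]] \<omega>_def \<zeta>_def[abs_def] ..
    have Xt: "X p \<in> tanv p" by (rule vfield_tan[OF X p])
    have "X p (\<lambda>q. g q (D q (Y q) Z) (E k q)) = X p (\<lambda>q. Y q (\<zeta> k) + (\<Sum>j\<in>UNIV. \<omega> Y k j q * \<zeta> j q))"
      by (rule tan_cong[OF Xt n(4)[OF DYZ] o p c])
    also have "\<dots> = X p (\<lambda>q. Y q (\<zeta> k)) + (\<Sum>j\<in>UNIV. \<omega> Y k j p * X p (\<zeta> j) + \<zeta> j p * X p (\<omega> Y k j))"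
      by (simp add: tan_add[OF Xt] tan_sum[OF Xt ptop] tan_mult[OF Xt] near_sum[OF ptop] near_mult
          n(2) n(3)[OF Y] vfield_near[OF Y n(2) p])
    finally show ?thesis
      unfolding D1[OF DYZ p Xt] c[OF p] \<omega>_def by simp
  qed
  have br: "bracket X Y p \<in> tanv p" by (rule vfield_tan[OF vfield_bracket[OF U(2,3)] p])
  have t: "D p (X p) V \<in> tanv p" if "vfield U X" "vfield U V" for X V
    by (rule vfield_tan[OF levi_civita_onD(1)[OF D U(1) that(2) p that(1)] p])
  have "D p (bracket X Y p) Z \<in> tanv p"
    by (rule t[OF vfield_bracket[OF U(2,3)] U(4)])
  then have split: "g p (curvature M A D X Y Z p) (E k p) = g p (D p (X p) (\<lambda>q. D q (Y q) Z)) (E k p)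
      - g p (D p (Y p) (\<lambda>q. D q (X q) Z)) (E k p) - g p (D p (bracket X Y p) Z) (E k p)"
    using t[OF U(2) levi_civita_onD(1)[OF D U(1,4) p U(3)]] t[OF U(3) levi_civita_onD(1)[OF D U(1,4) p U(2)]]
    unfolding curvature_def
    by (simp add: metric_diff_left[OF metric ptop] tan_space_intros onf(5)[OF pW])
  have D3: "g p (D p (bracket X Y p) Z) (E k p) = X p (\<lambda>q. Y q (\<zeta> k)) - Y p (\<lambda>q. X q (\<zeta> k)) +
      (\<Sum>j\<in>UNIV. \<omega> (bracket X Y) k j p * \<zeta> j p)"
    unfolding D1[OF U(4) p br] \<omega>_def \<zeta>_def[symmetric, abs_def] bracket_apply[OF n(2)]
    by (simp add: \<zeta>_def)
  \<comment> \<open>Cartan's second structure equation: these are the entries of the curvature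
    matrix \<open>d \<omega> + \<omega> \<and> \<omega>\<close> evaluated on X and Y.\<close>
  let ?F = "\<lambda>j. X p (\<omega> Y k j) - Y p (\<omega> X k j) - \<omega> (bracket X Y) k j p +
      (\<Sum>l\<in>UNIV. \<omega> X k l p * \<omega> Y l j p - \<omega> Y k l p * \<omega> X l j p)"
  have sw: "(\<Sum>l\<in>UNIV. \<omega> X k l p * (\<Sum>j\<in>UNIV. \<omega> Y l j p * \<zeta> j p)) =
      (\<Sum>j\<in>UNIV. \<zeta> j p * (\<Sum>l\<in>UNIV. \<omega> X k l p * \<omega> Y l j p))" for X Y
    unfolding sum_distrib_left by (subst sum.swap) (simp add: mult_ac)
  have "g p (curvature M A D X Y Z p) (E k p) = (\<Sum>j\<in>UNIV. \<zeta> j p * ?F j)"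
    unfolding split D2[OF U(2,3)] D2[OF U(3,2)] D3 distrib_left sum.distrib sw
    by (simp add: sum.distrib sum_subtractf algebra_simps)
  also have "\<dots> = (\<Sum>j\<in>UNIV. \<zeta> j p *
      (\<Sum>m\<in>UNIV. \<Sum>n\<in>UNIV. g p (X p) (E m p) * g p (Y p) (E n p) * curvature_coeff g E m n j k p))"
  proof (rule sum.cong[OF refl])
    fix j
    let ?x = "\<lambda>i. g p (X p) (E i p)" and ?y = "\<lambda>i. g p (Y p) (E i p)"
    \<comment> \<open>The first sum differentiates the components of Y. The same terms appear in
      \<open>b2\<close> below and cancel there.\<close>
    have d: "X p (\<omega> Y k j) = (\<Sum>n\<in>UNIV. ?\<Gamma> n j k p * X p (\<lambda>q. g q (Y q) (E n q))) +
        (\<Sum>m\<in>UNIV. \<Sum>n\<in>UNIV. g p (X p) (E m p) * g p (Y p) (E n p) * E m p (?\<Gamma> n j k))"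
      if X: "vfield U X" and Y: "vfield U Y" for X Y
    proof -
      have Xt: "X p \<in> tanv p" by (rule vfield_tan[OF X p])
      have "X p (\<omega> Y k j) = (\<Sum>n\<in>UNIV. g p (Y p) (E n p) * X p (?\<Gamma> n j k) +
          ?\<Gamma> n j k p * X p (\<lambda>q. g q (Y q) (E n q)))"
        unfolding \<omega>_def[abs_def]
        by (simp add: tan_sum[OF Xt ptop] tan_mult[OF Xt] near_mult n(1) n(4)[OF Y])
      also have "\<dots> = (\<Sum>n\<in>UNIV. ?\<Gamma> n j k p * X p (\<lambda>q. g q (Y q) (E n q))) +
          (\<Sum>n\<in>UNIV. \<Sum>m\<in>UNIV. g p (X p) (E m p) * g p (Y p) (E n p) * E m p (?\<Gamma> n j k))"
        unfolding frame_expand_apply[OF metric frame pW Xt, of "?\<Gamma> _ j k"]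
        by (simp add: sum.distrib sum_distrib_left algebra_simps)
      also have "(\<Sum>n\<in>UNIV. \<Sum>m\<in>UNIV. g p (X p) (E m p) * g p (Y p) (E n p) * E m p (?\<Gamma> n j k)) =
          (\<Sum>m\<in>UNIV. \<Sum>n\<in>UNIV. g p (X p) (E m p) * g p (Y p) (E n p) * E m p (?\<Gamma> n j k))"
        by (rule sum.swap)
      finally show ?thesis .
    qed
    have s1: "(\<Sum>m\<in>UNIV. \<Sum>n\<in>UNIV. ?y m * ?x n * E m p (?\<Gamma> n j k)) =
        (\<Sum>m\<in>UNIV. \<Sum>n\<in>UNIV. ?x m * ?y n * E n p (?\<Gamma> m j k))"
      by (subst sum.swap) (simp add: mult_ac)
    have b1: "(\<Sum>i\<in>UNIV. (\<Sum>m\<in>UNIV. \<Sum>n\<in>UNIV. ?x m * ?y n * structure_coeff g E m n i p) * ?\<Gamma> i j k p) =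
        (\<Sum>m\<in>UNIV. \<Sum>n\<in>UNIV. ?x m * ?y n * (\<Sum>i\<in>UNIV. structure_coeff g E m n i p * ?\<Gamma> i j k p))"
    proof -
      have "(\<Sum>i\<in>UNIV. (\<Sum>m\<in>UNIV. \<Sum>n\<in>UNIV. ?x m * ?y n * structure_coeff g E m n i p) * ?\<Gamma> i j k p) =
          (\<Sum>i\<in>UNIV. \<Sum>m\<in>UNIV. \<Sum>n\<in>UNIV. ?x m * ?y n * structure_coeff g E m n i p * ?\<Gamma> i j k p)"
        by (simp add: sum_distrib_right)
      also have "\<dots> = (\<Sum>m\<in>UNIV. \<Sum>i\<in>UNIV. \<Sum>n\<in>UNIV. ?x m * ?y n * structure_coeff g E m n i p * ?\<Gamma> i j k p)"
        by (rule sum.swap)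
      also have "\<dots> = (\<Sum>m\<in>UNIV. \<Sum>n\<in>UNIV. \<Sum>i\<in>UNIV. ?x m * ?y n * structure_coeff g E m n i p * ?\<Gamma> i j k p)"
        by (rule sum.cong[OF refl sum.swap])
      finally show ?thesis by (simp add: sum_distrib_left mult_ac)
    qed
    have l1: "(\<Sum>l\<in>UNIV. \<omega> X k l p * \<omega> Y l j p) =
        (\<Sum>m\<in>UNIV. \<Sum>n\<in>UNIV. g p (X p) (E m p) * g p (Y p) (E n p) * (\<Sum>l\<in>UNIV. ?\<Gamma> m l k p * ?\<Gamma> n j l p))" for X Y
    proof -
      have "(\<Sum>l\<in>UNIV. \<omega> X k l p * \<omega> Y l j p) =
          (\<Sum>l\<in>UNIV. \<Sum>m\<in>UNIV. \<Sum>n\<in>UNIV. g p (X p) (E m p) * g p (Y p) (E n p) * (?\<Gamma> m l k p * ?\<Gamma> n j l p))"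
        unfolding \<omega>_def sum_product by (simp add: mult_ac)
      also have "\<dots> = (\<Sum>m\<in>UNIV. \<Sum>l\<in>UNIV. \<Sum>n\<in>UNIV. g p (X p) (E m p) * g p (Y p) (E n p) * (?\<Gamma> m l k p * ?\<Gamma> n j l p))"
        by (rule sum.swap)
      also have "\<dots> = (\<Sum>m\<in>UNIV. \<Sum>n\<in>UNIV. \<Sum>l\<in>UNIV. g p (X p) (E m p) * g p (Y p) (E n p) * (?\<Gamma> m l k p * ?\<Gamma> n j l p))"
        by (rule sum.cong[OF refl sum.swap])
      finally show ?thesis by (simp add: sum_distrib_left)
    qed
    have l2: "(\<Sum>l\<in>UNIV. \<omega> Y k l p * \<omega> X l j p) =
        (\<Sum>m\<in>UNIV. \<Sum>n\<in>UNIV. ?x m * ?y n * (\<Sum>l\<in>UNIV. ?\<Gamma> n l k p * ?\<Gamma> m j l p))"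
      unfolding l1 by (subst sum.swap) (simp add: mult_ac)
    have b2: "\<omega> (bracket X Y) k j p = (\<Sum>n\<in>UNIV. ?\<Gamma> n j k p * X p (\<lambda>q. g q (Y q) (E n q))) -
        (\<Sum>n\<in>UNIV. ?\<Gamma> n j k p * Y p (\<lambda>q. g q (X q) (E n q))) +
        (\<Sum>m\<in>UNIV. \<Sum>n\<in>UNIV. ?x m * ?y n * (\<Sum>i\<in>UNIV. structure_coeff g E m n i p * ?\<Gamma> i j k p))"
      unfolding \<omega>_def frame_bracket[OF metric frame U(1-3) p] distrib_right left_diff_distrib sum.distrib b1
      by (simp add: sum_subtractf mult.commute)
    have "?F j = (\<Sum>m\<in>UNIV. \<Sum>n\<in>UNIV. ?x m * ?y n * curvature_coeff g E m n j k p)"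
      unfolding d[OF U(2,3)] d[OF U(3,2)] s1 b2 sum_subtractf l1[of X Y] l2 curvature_coeff_def
      by (simp add: distrib_left right_diff_distrib sum.distrib sum_subtractf)
    then show "\<zeta> j p * ?F j = \<zeta> j p *
        (\<Sum>m\<in>UNIV. \<Sum>n\<in>UNIV. ?x m * ?y n * curvature_coeff g E m n j k p)"
      by simp
  qed
  finally show ?thesis unfolding \<zeta>_def .
qed

text \<open>The two antisymmetries reduce the coefficients with all indices in {1, 2} to multiples
  of the single coefficient 1 2 2 1, which is what makes sectional curvature independent of the
  basis of the plane.\<close>

lemma curvature_coeff_skew:
  assumes "p \<in> W"
  shows "curvature_coeff g E n m j k p = - curvature_coeff g E m n j k p"
    and "curvature_coeff g E m n k j p = - curvature_coeff g E m n j k p"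
proof -
  have "(\<Sum>i\<in>UNIV. structure_coeff g E n m i p * christoffel g E i j k p) =
      - (\<Sum>i\<in>UNIV. structure_coeff g E m n i p * christoffel g E i j k p)"
    by (simp add: structure_coeff_skew[OF metric frame assms, of n m] sum_negf)
  then show "curvature_coeff g E n m j k p = - curvature_coeff g E m n j k p"
    by (simp add: curvature_coeff_def sum_subtractf)
  have d: "E m p (christoffel g E n k j) = - E m p (christoffel g E n j k)" for m n
  proof -
    have nr: "near p (christoffel g E n j k)"
      by (rule nearI[OF christoffel_smooth[OF metric frame] assms])
    have "E m p (\<lambda>q. (-1) * christoffel g E n j k q) = E m p (christoffel g E n k j)"
      by (rule tan_cong[OF onf(5)[OF assms] near_mult[OF near_const[OF onf_top[OF assms]] nr] onf(1) assms])
        (simp add: christoffel_skew[OF metric frame, of _ n k j])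
    then show ?thesis
      using tan_cmult[OF onf(5)[OF assms] nr, of m "-1"] by simp
  qed
  have s: "(\<Sum>i\<in>UNIV. structure_coeff g E m n i p * christoffel g E i k j p) =
      - (\<Sum>i\<in>UNIV. structure_coeff g E m n i p * christoffel g E i j k p)"
    by (simp add: christoffel_skew[OF metric frame assms, of _ k j] sum_negf)
  have "christoffel g E m l j p * christoffel g E n k l p - christoffel g E n l j p * christoffel g E m k l p =
      - (christoffel g E m l k p * christoffel g E n j l p - christoffel g E n l k p * christoffel g E m j l p)" for l
    using christoffel_skew[OF metric frame assms, of m l j] christoffel_skew[OF metric frame assms, of n k l]
      christoffel_skew[OF metric frame assms, of n l j] christoffel_skew[OF metric frame assms, of m k l]
    by simp
  then show "curvature_coeff g E m n k j p = - curvature_coeff g E m n j k p"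
    unfolding curvature_coeff_def d s by (simp only: sum_negf)
qed

end

end

section \<open>Curvature\<close>

lemma lin_indep2_iff: "lin_indep2 u v \<longleftrightarrow> (\<forall>a b. a *\<^sub>R u + b *\<^sub>R v = 0 \<longrightarrow> a = 0 \<and> b = 0)"
proof
  assume "lin_indep2 u v"
  then have "u \<noteq> v" "independent {u, v}"
    by (auto simp: lin_indep2_def)
  then have u: "u \<notin> span {v}" and "independent {v}"
    using independent_insert[of u "{v}"] by auto
  then have v: "v \<noteq> 0"
    by (metis dependent_zero singletonI)
  show "\<forall>a b. a *\<^sub>R u + b *\<^sub>R v = 0 \<longrightarrow> a = 0 \<and> b = 0"
  proof (intro allI impI)
    fix a b assume eq: "a *\<^sub>R u + b *\<^sub>R v = 0"
    have "a = 0"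
    proof (rule ccontr)
      assume a: "a \<noteq> 0"
      have "a *\<^sub>R u = (- b) *\<^sub>R v" using eq by (simp add: eq_neg_iff_add_eq_0)
      then have "inverse a *\<^sub>R (a *\<^sub>R u) = inverse a *\<^sub>R ((- b) *\<^sub>R v)" by (rule arg_cong)
      then have "u = (inverse a * (- b)) *\<^sub>R v" using a by simp
      then show False
        using u span_scale[OF span_base[of v "{v}"]] by (metis singletonI)
    qed
    then show "a = 0 \<and> b = 0" using eq v by simp
  qed
next
  assume *: "\<forall>a b. a *\<^sub>R u + b *\<^sub>R v = 0 \<longrightarrow> a = 0 \<and> b = 0"
  have "v \<noteq> 0" using *[rule_format, of 0 1] by auto
  moreover have "u \<notin> span {v}"
  proof
    assume "u \<in> span {v}"
    then obtain k where "u = k *\<^sub>R v" by (auto simp: span_singleton)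
    then show False using *[rule_format, of 1 "- k"] by simp
  qed
  ultimately show "lin_indep2 u v"
    using span_base[of u "{v}"] by (auto simp: lin_indep2_def independent_insert)
qed

section \<open>Existence of the Levi-Civita connection, and sectional curvature in a frame\<close>

context smooth_space
begin

text \<open>At each point the connection of the frame chosen for that point is used. The choice
  varies without any continuity, but near p uniqueness identifies the result with the connection of
  the one frame chosen at p, which gives smoothness.\<close>

lemma levi_civita_exists:
  assumes metric: "riemannian_metric M A g"
    and frames: "\<And>p. p \<in> topspace M \<Longrightarrow> \<exists>W (E :: 'i::finite \<Rightarrow> _). p \<in> W \<and> orthonormal_frame g W E"
  shows "\<exists>D. levi_civita M A g D"
proof -
  obtain W and E :: "'a \<Rightarrow> 'i \<Rightarrow> 'a \<Rightarrow> 'a tangent"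
    where W: "\<And>p. p \<in> topspace M \<Longrightarrow> p \<in> W p" and E: "\<And>p. p \<in> topspace M \<Longrightarrow> orthonormal_frame g (W p) (E p)"
    using frames by metis
  define D where "D p = frame_connection g (E p) p" for p
  note L = frame_connection_levi_civita[OF metric E]
  have agree: "frame_connection g (E p) q v Y = D q v Y"
    if p: "p \<in> topspace M" and Y: "vfield U Y" and q: "q \<in> U" "q \<in> W p" "v \<in> tanv q" for p q U v Y
  proof -
    have qt: "q \<in> topspace M" by (rule vfield_topspace[OF Y q(1)])
    have o: "openin M (W p \<inter> W q)"
      using orthonormal_frameD(1)[OF E] p qt by blast
    show ?thesis
      unfolding D_def
      by (rule levi_civita_on_unique[OF metric orthonormal_frame_subset[OF E[OF qt] o Int_lower2]
            levi_civita_on_subset[OF L[OF p] Int_lower1] Y q(1) _ q(3)])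
        (use q(2) W[OF qt] in simp)
  qed
  have res: "U \<inter> W p \<subseteq> W p" "openin M (U \<inter> W p)" "U \<inter> W p \<subseteq> U" "p \<in> U \<inter> W p" "p \<in> topspace M"
    if "vfield U X" "p \<in> U" for U X p
    using vfield_topspace[OF that] W that(2) vfield_open[OF that(1)] orthonormal_frameD(1)[OF E] by auto
  have "levi_civita M A g D"
    unfolding levi_civita_def affine_connection_def
  proof (intro conjI allI impI ballI)
    fix U X Y assume X: "vfield U X" and Y: "vfield U Y"
    show "vfield U (\<lambda>p. D p (X p) Y)"
    proof (rule vfield_local[OF vfield_open[OF X]])
      fix p assume p: "p \<in> U"
      note r = res[OF X p]
      have "vfield (U \<inter> W p) (\<lambda>q. frame_connection g (E p) q (X q) Y)"
        by (rule levi_civita_onD(1)[OF L[OF r(5)] r(1) vfield_subset[OF Y r(2,3)] r(4) vfield_subset[OF X r(2,3)]])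
      then have "vfield (U \<inter> W p) (\<lambda>q. D q (X q) Y)"
        by (rule vfield_cong) (use agree[OF r(5) Y] vfield_tan[OF X] in auto)
      then show "\<exists>W. p \<in> W \<and> vfield W (\<lambda>q. D q (X q) Y)"
        using r(4) by blast
    qed
    fix p assume p: "p \<in> U"
    note r = res[OF X p]
    show "D p (X p) Y - D p (Y p) X = bracket X Y p"
      unfolding D_def
      by (rule levi_civita_onD(5)[OF L[OF r(5)] r(1) vfield_subset[OF Y r(2,3)] r(4) vfield_subset[OF X r(2,3)]])
  next
    fix U Y p u v a b assume Y: "vfield U Y" and p: "p \<in> U" "u \<in> tanv p" "v \<in> tanv p"
    note r = res[OF Y p(1)]
    show "D p (a *\<^sub>R u + b *\<^sub>R v) Y = a *\<^sub>R D p u Y + b *\<^sub>R D p v Y"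
      unfolding D_def
      by (rule levi_civita_onD(2)[OF L[OF r(5)] r(1) vfield_subset[OF Y r(2,3)] r(4) p(2,3)])
  next
    fix U Y Z p v assume Y: "vfield U Y" and Z: "vfield U Z" and p: "p \<in> U" "v \<in> tanv p"
    note r = res[OF Y p(1)]
    show "D p v (\<lambda>q. Y q + Z q) = D p v Y + D p v Z"
      unfolding D_def
      by (rule levi_civita_onD(3)[OF L[OF r(5)] r(1) vfield_subset[OF Y r(2,3)] r(4) vfield_subset[OF Z r(2,3)] p(2)])
    show "v (\<lambda>q. g q (Y q) (Z q)) = g p (D p v Y) (Z p) + g p (Y p) (D p v Z)"
      unfolding D_def
      by (rule levi_civita_onD(6)[OF L[OF r(5)] r(1) vfield_subset[OF Y r(2,3)] r(4) vfield_subset[OF Z r(2,3)] p(2)])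
  next
    fix U f Y p v assume f: "smooth U f" and Y: "vfield U Y" and p: "p \<in> U" "v \<in> tanv p"
    note r = res[OF Y p(1)]
    show "D p v (\<lambda>q. f q *\<^sub>R Y q) = v f *\<^sub>R Y p + f p *\<^sub>R D p v Y"
      unfolding D_def
      by (rule levi_civita_onD(4)[OF L[OF r(5)] r(1) vfield_subset[OF Y r(2,3)] r(4) smooth_subset[OF f r(2,3)] p(2)])
  qed
  then show ?thesis by blast
qed

text \<open>The right-hand side mentions none of D, U, X, Y: the squared determinant of X, Y in the
  basis \<open>E 1\<close>, \<open>E 2\<close> is the denominator and also the factor by which the
  numerator differs from the coefficient.\<close>

lemma sectional_curvature_quotient:
  fixes E :: "3 \<Rightarrow> 'a \<Rightarrow> 'a tangent"
  assumes metric: "riemannian_metric M A g" and frame: "orthonormal_frame g W E" and p: "p \<in> W" "p \<in> U"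
    and D: "levi_civita M A g D" and X: "vfield U X" and Y: "vfield U Y"
    and indep: "lin_indep2 (X p) (Y p)" and span: "span {X p, Y p} = span {E 1 p, E 2 p}"
  shows "g p (curvature M A D X Y Y p) (X p) /
      (g p (X p) (X p) * g p (Y p) (Y p) - (g p (X p) (Y p))\<^sup>2) = curvature_coeff g E 1 2 2 1 p"
proof -
  note E = orthonormal_frameD[OF frame]
  define V where "V = U \<inter> W"
  have V: "V \<subseteq> W" "V \<subseteq> U" "openin M V" "p \<in> V" using vfield_open[OF X] E(1) p by (auto simp: V_def)
  note XV = vfield_subset[OF X V(3,2)] and YV = vfield_subset[OF Y V(3,2)]
  have L: "levi_civita_on g W D" by (rule levi_civita_imp_on[OF D])
  have top: "p \<in> topspace M" by (rule vfield_topspace[OF X p(2)])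
  note t = vfield_tan[OF X p(2)] vfield_tan[OF Y p(2)]
  have t1: "D p (X p) V' \<in> tanv p" if "vfield V X" "vfield V V'" for X V'
    by (rule vfield_tan[OF levi_civita_onD(1)[OF L V(1) that(2) V(4) that(1)] V(4)])
  have "D p (X p) (\<lambda>q. D q (Y q) Y) \<in> tanv p" "D p (Y p) (\<lambda>q. D q (X q) Y) \<in> tanv p"
    "D p (bracket X Y p) Y \<in> tanv p"
    by (rule t1[OF XV levi_civita_onD(1)[OF L V(1) YV V(4) YV]])
      (rule t1[OF YV levi_civita_onD(1)[OF L V(1) YV V(4) XV]] t1[OF vfield_bracket[OF XV YV] YV])+
  then have ct: "curvature M A D X Y Y p \<in> tanv p"
    unfolding curvature_def by (intro tan_space_intros)
  let ?x = "\<lambda>i. g p (X p) (E i p)" and ?y = "\<lambda>i. g p (Y p) (E i p)"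
  have o: "g p (E i p) (E j p) = of_bool (i = j)" for i j by (rule E(3)[OF p(1)])
  have z: "g p v (E 3 p) = 0" if v: "v \<in> span {E 1 p, E 2 p}" for v
  proof -
    obtain a where "v - a *\<^sub>R E 1 p \<in> span {E 2 p}" using span_breakdown_eq[THEN iffD1, OF v] by (rule exE)
    then obtain b where b: "v - a *\<^sub>R E 1 p = b *\<^sub>R E 2 p" by (auto simp: span_singleton)
    have "v = a *\<^sub>R E 1 p + b *\<^sub>R E 2 p" unfolding b[symmetric] by simp
    then show ?thesis
      using metric_linear_left[OF metric top E(5,5,5)[OF p(1)], of a 1 b 2 3] o by simp
  qed
  have z3: "?x 3 = 0" "?y 3 = 0"
    using z[of "X p"] z[of "Y p"] span span_base[of _ "{X p, Y p}"] by auto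
  have X_exp: "X p = ?x 1 *\<^sub>R E 1 p + ?x 2 *\<^sub>R E 2 p" and Y_exp: "Y p = ?y 1 *\<^sub>R E 1 p + ?y 2 *\<^sub>R E 2 p"
    using E(4)[OF p(1) t(1)] E(4)[OF p(1) t(2)] by (simp_all add: sum_3 z3)
  let ?d = "?x 1 * ?y 2 - ?x 2 * ?y 1"
  \<comment> \<open>If the determinant vanished, the combinations of X and Y eliminating
    \<open>E 1\<close> or \<open>E 2\<close> would both be zero; independence then kills every
    component of X.\<close>
  have d: "?d \<noteq> 0"
  proof
    assume 0: "?d = 0"
    have "?y 2 *\<^sub>R X p + (- ?x 2) *\<^sub>R Y p = ?y 2 *\<^sub>R (?x 1 *\<^sub>R E 1 p + ?x 2 *\<^sub>R E 2 p) + (- ?x 2) *\<^sub>R (?y 1 *\<^sub>R E 1 p + ?y 2 *\<^sub>R E 2 p)"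
      using X_exp Y_exp by simp
    also have "\<dots> = ?d *\<^sub>R E 1 p" by (simp add: algebra_simps)
    finally have "?y 2 *\<^sub>R X p + (- ?x 2) *\<^sub>R Y p = 0" using 0 by simp
    then have 2: "?y 2 = 0 \<and> - ?x 2 = 0" using indep unfolding lin_indep2_iff by blast
    have "?y 1 *\<^sub>R X p + (- ?x 1) *\<^sub>R Y p = ?y 1 *\<^sub>R (?x 1 *\<^sub>R E 1 p + ?x 2 *\<^sub>R E 2 p) + (- ?x 1) *\<^sub>R (?y 1 *\<^sub>R E 1 p + ?y 2 *\<^sub>R E 2 p)"
      using X_exp Y_exp by simp
    also have "\<dots> = (- ?d) *\<^sub>R E 2 p" by (simp add: algebra_simps)
    finally have "?y 1 *\<^sub>R X p + (- ?x 1) *\<^sub>R Y p = 0" using 0 by simp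
    then have "?y 1 = 0 \<and> - ?x 1 = 0" using indep unfolding lin_indep2_iff by blast
    then have "X p = 0" using 2 X_exp by simp
    then have "1 *\<^sub>R X p + 0 *\<^sub>R Y p = 0" by simp
    then have "(1::real) = 0" using indep unfolding lin_indep2_iff by blast
    then show False by simp
  qed
  have R: "g p (curvature M A D X Y Y p) (E k p) = ?d * (\<Sum>j\<in>UNIV. ?y j * curvature_coeff g E 1 2 j k p)" for k
  proof -
    have "curvature_coeff g E 2 1 j k p = - curvature_coeff g E 1 2 j k p"
      "curvature_coeff g E 1 1 j k p = 0" "curvature_coeff g E 2 2 j k p = 0" for j
      using curvature_coeff_skew(1)[OF metric frame p(1), of 2 1 j k]
        curvature_coeff_skew(1)[OF metric frame p(1), of 1 1 j k]
        curvature_coeff_skew(1)[OF metric frame p(1), of 2 2 j k] by simp_all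
    then show ?thesis
      unfolding frame_curvature[OF metric frame L V(1) XV YV YV V(4)]
      by (simp add: sum_3 z3 algebra_simps)
  qed
  have "g p (curvature M A D X Y Y p) (X p) =
      (\<Sum>k\<in>UNIV. ?d * (\<Sum>j\<in>UNIV. ?y j * curvature_coeff g E 1 2 j k p) * ?x k)"
    unfolding frame_inner[OF metric frame p(1) ct t(1)] R ..
  also have "\<dots> = ?d\<^sup>2 * curvature_coeff g E 1 2 2 1 p"
  proof -
    have "curvature_coeff g E 1 2 1 2 p = - curvature_coeff g E 1 2 2 1 p"
      "curvature_coeff g E 1 2 1 1 p = 0" "curvature_coeff g E 1 2 2 2 p = 0"
      using curvature_coeff_skew(2)[OF metric frame p(1), of 1 2 1 2]
        curvature_coeff_skew(2)[OF metric frame p(1), of 1 2 1 1]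
        curvature_coeff_skew(2)[OF metric frame p(1), of 1 2 2 2] by simp_all
    then show ?thesis
      by (simp add: sum_3 z3 algebra_simps power2_eq_square)
  qed
  finally have num: "g p (curvature M A D X Y Y p) (X p) = ?d\<^sup>2 * curvature_coeff g E 1 2 2 1 p" .
  have den: "g p (X p) (X p) * g p (Y p) (Y p) - (g p (X p) (Y p))\<^sup>2 = ?d\<^sup>2"
    unfolding frame_inner[OF metric frame p(1) t(1,1)] frame_inner[OF metric frame p(1) t(2,2)]
      frame_inner[OF metric frame p(1) t(1,2)]
    by (simp add: sum_3 z3 algebra_simps power2_eq_square)
  show ?thesis
    unfolding num den using d by simp
qed

lemma frame_lin_indep2:
  assumes metric: "riemannian_metric M A g" and frame: "orthonormal_frame g W E" and p: "p \<in> W" and ij: "i \<noteq> j"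
  shows "lin_indep2 (E i p) (E j p)"
  unfolding lin_indep2_iff
proof (intro allI impI)
  note E = orthonormal_frameD[OF frame]
  have top: "p \<in> topspace M" using E(1) p openin_subset by blast
  fix a b assume 0: "a *\<^sub>R E i p + b *\<^sub>R E j p = 0"
  have "g p (a *\<^sub>R E i p + b *\<^sub>R E j p) (E k p) = a * of_bool (i = k) + b * of_bool (j = k)" for k
    using metric_linear_left[OF metric top E(5,5,5)[OF p], of a i b j k] E(3)[OF p] by simp
  then have "0 = a * of_bool (i = k) + b * of_bool (j = k)" for k
    unfolding 0 metric_zero_left[OF metric top E(5)[OF p]] by blast
  from this[of i] this[of j] ij show "a = 0 \<and> b = 0" by simp
qed

text \<open>The definite description is evaluated: a global D with the fields \<open>E 1\<close>,
  \<open>E 2\<close> is a witness, and the quotient lemma gives uniqueness over all other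
  choices.\<close>

lemma sectional_curvature_frame:
  fixes E :: "3 \<Rightarrow> 'a \<Rightarrow> 'a tangent"
  assumes metric: "riemannian_metric M A g" and frame: "orthonormal_frame g W E" and p: "p \<in> W"
    and D: "levi_civita M A g D" and span: "span {E 1 p, E 2 p} = \<sigma>"
  shows "sectional_curvature M A g p \<sigma> = curvature_coeff g E 1 2 2 1 p"
  unfolding sectional_curvature_def
proof (rule the_equality)
  note E = orthonormal_frameD[OF frame]
  have indep: "lin_indep2 (E 1 p) (E 2 p)"
    by (rule frame_lin_indep2[OF metric frame p]) simp
  show "\<exists>D U X Y. levi_civita M A g D \<and> p \<in> U \<and> vfield U X \<and> vfield U Y \<and>
        lin_indep2 (X p) (Y p) \<and> span {X p, Y p} = \<sigma> \<and>
        curvature_coeff g E 1 2 2 1 p = g p (curvature M A D X Y Y p) (X p) /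
            (g p (X p) (X p) * g p (Y p) (Y p) - (g p (X p) (Y p))\<^sup>2)"
    using D p E(2) indep span
      sectional_curvature_quotient[OF metric frame p p D E(2) E(2) indep refl, symmetric]
    by (intro exI[of _ D] exI[of _ W] exI[of _ "E 1"] exI[of _ "E 2"]) simp
  show "K = curvature_coeff g E 1 2 2 1 p"
    if "\<exists>D U X Y. levi_civita M A g D \<and> p \<in> U \<and> vfield U X \<and> vfield U Y \<and>
        lin_indep2 (X p) (Y p) \<and> span {X p, Y p} = \<sigma> \<and>
        K = g p (curvature M A D X Y Y p) (X p) /
            (g p (X p) (X p) * g p (Y p) (Y p) - (g p (X p) (Y p))\<^sup>2)" for K
  proof -
    from that obtain D U X Y where *: "levi_civita M A g D" "p \<in> U" "vfield U X" "vfield U Y"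
        "lin_indep2 (X p) (Y p)" "span {X p, Y p} = \<sigma>"
      and K: "K = g p (curvature M A D X Y Y p) (X p) /
            (g p (X p) (X p) * g p (Y p) (Y p) - (g p (X p) (Y p))\<^sup>2)"
      by blast
    have "span {X p, Y p} = span {E 1 p, E 2 p}" using *(6) span by simp
    then show ?thesis
      unfolding K by (rule sectional_curvature_quotient[OF metric frame p *(2,1,3,4,5)])
  qed
qed

text \<open>What matters is which terms are absent. The coefficients \<open>c 1 3 3\<close> and
  \<open>c 2 3 3\<close> do not occur, and the only differentiated ones are \<open>c 1 2 1\<close>
  and \<open>c 1 2 2\<close>. This is why rescaling \<open>E 3\<close> by a function changes the
  curvature of the plane only algebraically.\<close>

lemma curvature_coeff_3:
  fixes E :: "3 \<Rightarrow> 'a \<Rightarrow> 'a tangent"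
  assumes metric: "riemannian_metric M A g" and frame: "orthonormal_frame g W E" and p: "p \<in> W"
  defines "c \<equiv> structure_coeff g E"
  shows "curvature_coeff g E 1 2 2 1 p = E 1 p (c 1 2 2) - E 2 p (c 1 2 1) - (c 1 2 1 p)\<^sup>2 - (c 1 2 2 p)\<^sup>2
    - 3 / 4 * (c 1 2 3 p)\<^sup>2 + c 1 2 3 p * (c 2 3 1 p + c 3 1 2 p) / 2
    + (c 2 3 1 p - c 3 1 2 p)\<^sup>2 / 4 - c 1 3 1 p * c 2 3 2 p"
proof -
  note E = orthonormal_frameD[OF frame]
  have sk: "c j i k q = - c i j k q" if "q \<in> W" for i j k q
    unfolding c_def by (rule structure_coeff_skew[OF metric frame that])
  have c0: "c i i k q = 0" if "q \<in> W" for i k q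
    using sk[OF that, of i i k] by simp
  have G: "christoffel g E i j k q = (c i j k q - c j k i q + c k i j q) / 2" for i j k q
    by (simp add: christoffel_def c_def)
  \<comment> \<open>The two coefficients that get differentiated must be simplified as functions on
    W, beyond their values at p.\<close>
  have G1: "christoffel g E 2 2 1 q = c 1 2 2 q" "christoffel g E 1 2 1 q = c 1 2 1 q" if "q \<in> W" for q
    unfolding G using c0[OF that] sk[OF that, of 2 1] by simp_all
  have d: "E i p (christoffel g E m 2 1) = E i p f"
    if "\<And>q. q \<in> W \<Longrightarrow> christoffel g E m 2 1 q = f q" for i m f
    by (rule tan_cong[OF E(5)[OF p] nearI[OF christoffel_smooth[OF metric frame] p] E(1) p that])
  have e: "E 1 p (christoffel g E 2 2 1) = E 1 p (c 1 2 2)" "E 2 p (christoffel g E 1 2 1) = E 2 p (c 1 2 1)"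
    by (rule d, simp add: G1)+
  show ?thesis
    unfolding curvature_coeff_def e c_def[symmetric] sum_3 G
    using c0[OF p] sk[OF p, of 2 1] sk[OF p, of 3 1] sk[OF p, of 3 2]
    by (simp add: field_simps power2_eq_square)
qed

end

section \<open>Rescaling along the normal direction\<close>

context smooth_space
begin

text \<open>The projection of v to the plane orthogonal to n is measured by s g, the normal part by
  u. For u = s this is the homothetic metric s g.\<close>

definition deform ::
  "('a \<Rightarrow> 'a tangent \<Rightarrow> 'a tangent \<Rightarrow> real) \<Rightarrow> ('a \<Rightarrow> 'a tangent) \<Rightarrow> real \<Rightarrow> ('a \<Rightarrow> real) \<Rightarrow>
     'a \<Rightarrow> 'a tangent \<Rightarrow> 'a tangent \<Rightarrow> real" where
  "deform g n s u q v w =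
     s * (g q v w - g q v (n q) * g q w (n q)) + u q * (g q v (n q) * g q w (n q))"

definition deform_frame :: "real \<Rightarrow> ('a \<Rightarrow> real) \<Rightarrow> (3 \<Rightarrow> 'a \<Rightarrow> 'a tangent) \<Rightarrow> 3 \<Rightarrow> 'a \<Rightarrow> 'a tangent" where
  "deform_frame s u E i = (\<lambda>q. (if i = 3 then 1 / sqrt (u q) else 1 / sqrt s) *\<^sub>R E i q)"

lemma bracket_scale_right:
  assumes "vfield U X" "vfield U Y" "smooth U f" "p \<in> U"
  shows "bracket X (\<lambda>q. f q *\<^sub>R Y q) p = f p *\<^sub>R bracket X Y p + X p f *\<^sub>R Y p"
proof (rule ext)
  fix h
  note t = vfield_tan[OF assms(1,4)] vfield_tan[OF assms(2,4)]
  show "bracket X (\<lambda>q. f q *\<^sub>R Y q) p h = (f p *\<^sub>R bracket X Y p + X p f *\<^sub>R Y p) h"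
  proof (cases "near p h")
    case True
    then show ?thesis
      by (simp add: bracket_apply scaleR_fun_def tan_mult[OF t(1)] nearI[OF assms(3,4)]
          vfield_near[OF assms(2) True assms(4)] algebra_simps)
  next
    case False
    then show ?thesis
      by (simp add: bracket_not_near scaleR_fun_def tan_not_near[OF t(2)])
  qed
qed

lemma bracket_cscale:
  assumes X: "vfield U X" and Y: "vfield U Y" and p: "p \<in> U"
  shows "bracket (\<lambda>q. a *\<^sub>R X q) (\<lambda>q. b *\<^sub>R Y q) p = (a * b) *\<^sub>R bracket X Y p"
proof -
  have o: "openin M U" by (rule vfield_open[OF X])
  have 1: "bracket X (\<lambda>q. b *\<^sub>R Y q) p = b *\<^sub>R bracket X Y p" if "vfield U X" "vfield U Y" for X Y b
    using bracket_scale_right[OF that smooth_const[OF o] p, of b]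
      tan_const[OF vfield_tan[OF that(1) p] vfield_topspace[OF that(1) p]] by simp
  have "bracket (\<lambda>q. a *\<^sub>R X q) Y p = - bracket Y (\<lambda>q. a *\<^sub>R X q) p"
    by (rule bracket_skew)
  also have "\<dots> = a *\<^sub>R bracket X Y p"
    unfolding 1[OF Y X] bracket_skew[of X Y] by simp
  finally show ?thesis
    unfolding 1[OF vfield_cscale[OF X] Y] by (simp add: mult.commute)
qed

context
  fixes g and n :: "'a \<Rightarrow> 'a tangent" and s :: real and u :: "'a \<Rightarrow> real"
  assumes metric: "riemannian_metric M A g"
    and unit: "vfield (topspace M) n" "\<forall>q\<in>topspace M. g q (n q) (n q) = 1"
    and s: "s > 0" and weight: "smooth (topspace M) u" "\<forall>q\<in>topspace M. u q > 0"
begin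

private lemmas n = unit(1) unit(2)[rule_format] and u = weight(1) weight(2)[rule_format]

lemma deform_metric: "riemannian_metric M A (deform g n s u)"
  unfolding riemannian_metric_def
proof (intro conjI ballI allI impI)
  fix q v w assume q: "q \<in> topspace M" "v \<in> tanv q" "w \<in> tanv q"
  have nt: "n q \<in> tanv q" by (rule vfield_tan[OF n(1) q(1)])
  show "deform g n s u q v w = deform g n s u q w v"
    using metric_sym[OF metric q] by (simp add: deform_def mult.commute)
  show "0 < deform g n s u q v v" if v0: "v \<noteq> 0"
  proof -
    \<comment> \<open>With r the part of v orthogonal to n, the new square length is
      \<open>s * g q r r + u q * a\<^sup>2\<close>; at least one summand is positive and neither is
      negative.\<close>
    define a where "a = g q v (n q)"
    define r where "r = v - a *\<^sub>R n q"
    have r: "r \<in> tanv q" unfolding r_def by (intro tan_space_intros q nt)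
    have "g q r r = g q v v - a\<^sup>2"
      unfolding r_def using metric_sym[OF metric q(1) nt q(2)] n(2)[OF q(1)]
      by (simp add: metric_diff_left[OF metric q(1)] metric_diff_right[OF metric q(1)] metric_scale_left[OF metric q(1)]
          metric_scale_right[OF metric q(1)] q nt tan_space_intros a_def power2_eq_square)
    then have d: "deform g n s u q v v = s * g q r r + u q * a\<^sup>2"
      by (simp add: deform_def a_def power2_eq_square)
    show ?thesis
    proof (cases "r = 0")
      case True
      then have "v = a *\<^sub>R n q" by (simp add: r_def)
      then have "a \<noteq> 0" using v0 by auto
      then show ?thesis
        unfolding d True metric_zero_left[OF metric q(1) tan_space_intros(5)] using u(2)[OF q(1)] by simp
    next
      case False
      then have "s * g q r r > 0" using metric_pos[OF metric q(1) r] s by simp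
      moreover have "u q * a\<^sup>2 \<ge> 0" using u(2)[OF q(1)] by simp
      ultimately show ?thesis unfolding d by linarith
    qed
  qed
  show "deform g n s u q (a *\<^sub>R v + b *\<^sub>R w) z = a * deform g n s u q v z + b * deform g n s u q w z"
    if "z \<in> tanv q" for z a b
    by (simp add: deform_def metric_linear_left[OF metric q(1)] q that nt algebra_simps)
next
  fix U X Y assume X: "vfield U X" and Y: "vfield U Y"
  have o: "openin M U" by (rule vfield_open[OF X])
  have sub: "U \<subseteq> topspace M" by (rule openin_subset[OF o])
  note nU = vfield_subset[OF n(1) o sub] and uU = smooth_subset[OF u(1) o sub]
  show "smooth U (\<lambda>q. deform g n s u q (X q) (Y q))"
    unfolding deform_def
    by (intro smooth_add smooth_mult smooth_diff smooth_const o uU metric_smooth[OF metric] X Y nU)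
qed

context
  fixes E :: "3 \<Rightarrow> 'a \<Rightarrow> 'a tangent" and W
  assumes frame: "orthonormal_frame g W E" and normal: "\<forall>q\<in>W. n q = E 3 q"
begin

private lemmas En = normal[rule_format]

private lemmas base = orthonormal_frameD[OF frame]

private lemma base_top: "q \<in> W \<Longrightarrow> q \<in> topspace M"
  using base(1) openin_subset by blast

private lemma sub: "W \<subseteq> topspace M"
  using base(1) openin_subset by blast

private abbreviation "F \<equiv> deform_frame s u E"
private abbreviation "h \<equiv> deform g n s u"
private abbreviation "\<rho> \<equiv> \<lambda>q. 1 / sqrt (u q)"
private abbreviation "\<sigma> \<equiv> 1 / sqrt s"

private lemma \<rho>: "smooth W \<rho>"
proof -
  have uW: "smooth W u" by (rule smooth_subset[OF u(1) base(1) sub])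
  have p: "u q > 0" if "q \<in> W" for q by (rule u(2)[OF base_top[OF that]])
  have ne: "sqrt (u q) \<noteq> 0" if "q \<in> W" for q using p[OF that] by simp
  show ?thesis
    using smooth_divide[OF smooth_const[OF base(1), of 1] smooth_sqrt[OF uW p] ne] by blast
qed

private lemma F: "F 1 = (\<lambda>q. \<sigma> *\<^sub>R E 1 q)" "F 2 = (\<lambda>q. \<sigma> *\<^sub>R E 2 q)" "F 3 = (\<lambda>q. \<rho> q *\<^sub>R E 3 q)"
  by (simp_all add: deform_frame_def)

private lemma F_vfield: "vfield W (F i)"
proof (cases "i = 3")
  case True
  then show ?thesis using vfield_scale[OF \<rho> base(2)] F(3) by simp
next
  case False
  then show ?thesis using vfield_cscale[OF base(2)] by (simp add: deform_frame_def)
qed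

private lemma h_coeff:
  assumes "q \<in> W" "v \<in> tanv q"
  shows "h q v (F i q) = (if i = 3 then sqrt (u q) else sqrt s) * g q v (E i q)"
proof -
  note t = base(5)[OF assms(1)]
  have e: "g q (E i q) (n q) = of_bool (i = 3)" using base(3)[OF assms(1)] En[OF assms(1)] by simp
  have dv: "t * x / sqrt t = sqrt t * x" if "t > 0" for t x :: real
  proof -
    have "t * x / sqrt t = t / sqrt t * x" by simp
    then show ?thesis using that by (simp add: real_div_sqrt)
  qed
  show ?thesis
    using u(2)[OF base_top[OF assms(1)]] s e En[OF assms(1)]
    by (auto simp: deform_def deform_frame_def metric_scale_left[OF metric base_top[OF assms(1)]]
        metric_scale_right[OF metric base_top[OF assms(1)]] t assms dv)
qed

lemma deform_frame_orthonormal: "orthonormal_frame h W F"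
  unfolding orthonormal_frame_def
proof (intro conjI allI ballI)
  show "openin M W" by (rule base(1))
  show "vfield W (F i)" for i by (rule F_vfield)
  fix q assume q: "q \<in> W"
  note pos = s u(2)[OF base_top[OF q]]
  have ne: "sqrt (u q) \<noteq> 0" "sqrt s \<noteq> 0" using pos by auto
  show "h q (F i q) (F j q) = of_bool (i = j)" for i j
    unfolding h_coeff[OF q vfield_tan[OF F_vfield q]]
    using ne by (auto simp: deform_frame_def metric_scale_left[OF metric base_top[OF q]] base(5)[OF q] base(3)[OF q])
  fix v assume v: "v \<in> tanv q"
  \<comment> \<open>The pairing with \<open>F i\<close> grows by the factor by which
    \<open>F i\<close> itself shrinks, so the new expansion of v is term by term the old
    one.\<close>
  have "h q v (F i q) *\<^sub>R F i q = g q v (E i q) *\<^sub>R E i q" for i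
    unfolding h_coeff[OF q v] using ne by (simp add: deform_frame_def)
  then show "v = (\<Sum>i\<in>UNIV. h q v (F i q) *\<^sub>R F i q)"
    using base(4)[OF q v] by simp
qed

lemma deform_frame_span:
  assumes "q \<in> W"
  shows "span {F 1 q, F 2 q} = span {E 1 q, E 2 q}"
proof -
  have "E i q = sqrt s *\<^sub>R (\<sigma> *\<^sub>R E i q)" for i using s by simp
  then have "E 1 q \<in> span {\<sigma> *\<^sub>R E 1 q, \<sigma> *\<^sub>R E 2 q}" "E 2 q \<in> span {\<sigma> *\<^sub>R E 1 q, \<sigma> *\<^sub>R E 2 q}"
    by (metis insertI1 insertI2 span_base span_scale)+
  moreover have "\<sigma> *\<^sub>R E 1 q \<in> span {E 1 q, E 2 q}" "\<sigma> *\<^sub>R E 2 q \<in> span {E 1 q, E 2 q}"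
    by (simp_all add: span_base span_scale)
  ultimately show ?thesis
    unfolding F span_eq by simp
qed

text \<open>Derivatives of \<open>\<rho>\<close> enter the bracket of \<open>F 1\<close> or
  \<open>F 2\<close> with \<open>F 3\<close> only as multiples of \<open>E 3\<close>, so they are
  invisible in components 1 and 2. The seven coefficients listed are exactly those in
  \<open>curvature_coeff_3\<close>, and each is merely multiplied by a power of s and u.\<close>

lemma deform_structure_coeff:
  assumes q: "q \<in> W"
  shows "structure_coeff h F 1 2 1 q = structure_coeff g E 1 2 1 q / sqrt s"
    and "structure_coeff h F 1 2 2 q = structure_coeff g E 1 2 2 q / sqrt s"
    and "structure_coeff h F 1 2 3 q = sqrt (u q) / s * structure_coeff g E 1 2 3 q"
    and "structure_coeff h F 2 3 1 q = structure_coeff g E 2 3 1 q / sqrt (u q)"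
    and "structure_coeff h F 2 3 2 q = structure_coeff g E 2 3 2 q / sqrt (u q)"
    and "structure_coeff h F 1 3 1 q = structure_coeff g E 1 3 1 q / sqrt (u q)"
    and "structure_coeff h F 3 1 2 q = structure_coeff g E 3 1 2 q / sqrt (u q)"
proof -
  note t = base(5)[OF q] and tq = base_top[OF q]
  have ss: "sqrt s * sqrt s = s" using s by simp
  have bt: "bracket (E i) (E j) q \<in> tanv q" for i j by (rule vfield_tan[OF vfield_bracket[OF base(2,2)] q])
  have b12: "bracket (F 1) (F 2) q = (\<sigma> * \<sigma>) *\<^sub>R bracket (E 1) (E 2) q"
    unfolding F by (rule bracket_cscale[OF base(2,2) q])
  have b3: "bracket (\<lambda>q. \<sigma> *\<^sub>R E i q) (F 3) q = (\<rho> q * \<sigma>) *\<^sub>R bracket (E i) (E 3) q + (\<sigma> * E i q \<rho>) *\<^sub>R E 3 q" for i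
  proof -
    have "bracket (\<lambda>q. \<sigma> *\<^sub>R E i q) (E 3) q = \<sigma> *\<^sub>R bracket (E i) (E 3) q"
      using bracket_cscale[OF base(2,2) q, of \<sigma> i 1 3] by simp
    then show ?thesis
      unfolding F bracket_scale_right[OF vfield_cscale[OF base(2)] base(2) \<rho> q] by (simp add: scaleR_fun_def[of _ "E i q"])
  qed
  have c12: "structure_coeff h F 1 2 k q = (if k = 3 then sqrt (u q) else sqrt s) * (\<sigma> * \<sigma> * structure_coeff g E 1 2 k q)" for k
    unfolding structure_coeff_def b12 h_coeff[OF q tan_space_intros(3)[OF bt]] metric_scale_left[OF metric tq bt t] ..
  have c3: "structure_coeff h F i 3 k q = structure_coeff g E i 3 k q / sqrt (u q)"
    if "k \<noteq> 3" "i \<noteq> 3" for i k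
  proof -
    have "F i = (\<lambda>q. \<sigma> *\<^sub>R E i q)" using that(2) by (simp add: deform_frame_def)
    then have b3i: "bracket (F i) (F 3) q = (\<rho> q * \<sigma>) *\<^sub>R bracket (E i) (E 3) q + (\<sigma> * E i q \<rho>) *\<^sub>R E 3 q"
      using b3[of i] by simp
    have "g q ((\<rho> q * \<sigma>) *\<^sub>R bracket (E i) (E 3) q + (\<sigma> * E i q \<rho>) *\<^sub>R E 3 q) (E k q) =
        \<rho> q * \<sigma> * structure_coeff g E i 3 k q"
      using that(1) base(3)[OF q, of 3 k] metric_linear_left[OF metric tq bt t t, of "\<rho> q * \<sigma>" i 3 "\<sigma> * E i q \<rho>" 3 k]
      by (auto simp: structure_coeff_def)
    moreover have "(\<rho> q * \<sigma>) *\<^sub>R bracket (E i) (E 3) q + (\<sigma> * E i q \<rho>) *\<^sub>R E 3 q \<in> tanv q"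
      by (intro tan_space_intros bt t)
    ultimately show ?thesis
      unfolding structure_coeff_def[of h] b3i using h_coeff[OF q] that s by simp
  qed
  show "structure_coeff h F 1 2 1 q = structure_coeff g E 1 2 1 q / sqrt s"
    "structure_coeff h F 1 2 2 q = structure_coeff g E 1 2 2 q / sqrt s"
    "structure_coeff h F 1 2 3 q = sqrt (u q) / s * structure_coeff g E 1 2 3 q"
    unfolding c12 using s ss by (simp_all add: field_simps)
  show "structure_coeff h F 2 3 1 q = structure_coeff g E 2 3 1 q / sqrt (u q)"
    "structure_coeff h F 2 3 2 q = structure_coeff g E 2 3 2 q / sqrt (u q)"
    "structure_coeff h F 1 3 1 q = structure_coeff g E 1 3 1 q / sqrt (u q)"
    by (rule c3; simp)+
  have "structure_coeff h F 1 3 2 q = structure_coeff g E 1 3 2 q / sqrt (u q)"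
    by (rule c3; simp)
  then show "structure_coeff h F 3 1 2 q = structure_coeff g E 3 1 2 q / sqrt (u q)"
    unfolding structure_coeff_skew[OF deform_metric deform_frame_orthonormal q, of 3 1]
      structure_coeff_skew[OF metric frame q, of 3 1] by simp
qed

end

end

text \<open>C, P and Q group the terms of \<open>curvature_coeff_3\<close> by their scaling weight
  under the deformation: \<open>u / s\<^sup>2\<close>, \<open>1 / s\<close> and \<open>1 / u\<close>
  respectively, with C entering negatively.\<close>

definition plane_C :: "('a \<Rightarrow> 'a tangent \<Rightarrow> 'a tangent \<Rightarrow> real) \<Rightarrow> (3 \<Rightarrow> 'a \<Rightarrow> 'a tangent) \<Rightarrow> 'a \<Rightarrow> real" where
  "plane_C g E q = 3 / 4 * (structure_coeff g E 1 2 3 q)\<^sup>2"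

definition plane_P :: "('a \<Rightarrow> 'a tangent \<Rightarrow> 'a tangent \<Rightarrow> real) \<Rightarrow> (3 \<Rightarrow> 'a \<Rightarrow> 'a tangent) \<Rightarrow> 'a \<Rightarrow> real" where
  "plane_P g E q = E 1 q (structure_coeff g E 1 2 2) - E 2 q (structure_coeff g E 1 2 1)
     - (structure_coeff g E 1 2 1 q)\<^sup>2 - (structure_coeff g E 1 2 2 q)\<^sup>2
     + structure_coeff g E 1 2 3 q * (structure_coeff g E 2 3 1 q + structure_coeff g E 3 1 2 q) / 2"

definition plane_Q :: "('a \<Rightarrow> 'a tangent \<Rightarrow> 'a tangent \<Rightarrow> real) \<Rightarrow> (3 \<Rightarrow> 'a \<Rightarrow> 'a tangent) \<Rightarrow> 'a \<Rightarrow> real" where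
  "plane_Q g E q = (structure_coeff g E 2 3 1 q - structure_coeff g E 3 1 2 q)\<^sup>2 / 4
     - structure_coeff g E 1 3 1 q * structure_coeff g E 2 3 2 q"

lemma plane_smooth:
  assumes metric: "riemannian_metric M A g" and frame: "orthonormal_frame g W E"
  shows "smooth W (plane_C g E)" "smooth W (plane_P g E)" "smooth W (plane_Q g E)"
proof -
  note E = orthonormal_frameD[OF frame]
  note c = structure_coeff_smooth[OF metric frame]
  note d = vfield_smooth[OF E(2) order_refl c]
  show "smooth W (plane_C g E)"
    unfolding plane_C_def[abs_def] by (intro smooth_mult smooth_const smooth_power c E(1))
  have two: "smooth W (\<lambda>q. f q / 2)" "smooth W (\<lambda>q. f q / 4)" if "smooth W f" for f
    using smooth_mult[OF that smooth_const[OF E(1), of "1 / 2"]]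
      smooth_mult[OF that smooth_const[OF E(1), of "1 / 4"]] by simp_all
  show "smooth W (plane_P g E)"
    unfolding plane_P_def[abs_def] by (intro smooth_add smooth_diff two smooth_mult smooth_power c d)
  show "smooth W (plane_Q g E)"
    unfolding plane_Q_def[abs_def] by (intro smooth_diff two smooth_mult smooth_power c)
qed

text \<open>Adapted frames are assumed around every point, although the formula concerns one point,
  because their rescalings provide the global Levi-Civita connection of the new metric.\<close>

lemma deform_curvature:
  fixes E :: "3 \<Rightarrow> 'a \<Rightarrow> 'a tangent"
  assumes metric: "riemannian_metric M A g"
    and n: "vfield (topspace M) n" "\<forall>q\<in>topspace M. g q (n q) (n q) = 1"
    and s: "s > 0" and u: "smooth (topspace M) u" "\<forall>q\<in>topspace M. u q > 0"
    and adapted: "\<And>p. p \<in> topspace M \<Longrightarrow> \<exists>W (E :: 3 \<Rightarrow> _). p \<in> W \<and> orthonormal_frame g W E \<and> (\<forall>q\<in>W. n q = E 3 q)"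
    and frame: "orthonormal_frame g W E" "\<forall>q\<in>W. n q = E 3 q"
    and p: "p \<in> W" and span: "span {E 1 p, E 2 p} = \<tau>"
  shows "sectional_curvature M A (deform g n s u) p \<tau> =
    - plane_C g E p * u p / s\<^sup>2 + plane_P g E p / s + plane_Q g E p / u p"
proof -
  let ?h = "deform g n s u" and ?F = "deform_frame s u E"
  note E = orthonormal_frameD[OF frame(1)]
  note hm = deform_metric[where g = g and n = n and s = s and u = u, OF metric n s u] and hf = deform_frame_orthonormal[where g = g and n = n and s = s and u = u and E = E and W = W, OF metric n s u frame]
  have top: "p \<in> topspace M" using E(1) p openin_subset by blast
  have "\<exists>W (F :: 3 \<Rightarrow> _). q \<in> W \<and> orthonormal_frame ?h W F" if q: "q \<in> topspace M" for q
  proof -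
    obtain V and G :: "3 \<Rightarrow> 'a \<Rightarrow> 'a tangent" where V: "q \<in> V" "orthonormal_frame g V G" "\<forall>q\<in>V. n q = G 3 q"
      using adapted[OF q] by blast
    have "orthonormal_frame ?h V (deform_frame s u G)"
      by (rule deform_frame_orthonormal[where g = g and n = n and s = s and u = u and E = G and W = V, OF metric n s u V(2,3)])
    then show ?thesis using V(1) by blast
  qed
  then obtain D where D: "levi_civita M A ?h D"
    using levi_civita_exists[OF hm] by blast
  note K = sectional_curvature_frame[OF hm hf p D]
  have sp: "span {?F 1 p, ?F 2 p} = \<tau>"
    using deform_frame_span[where g = g and n = n and s = s and u = u and E = E and W = W, OF metric n s u frame p] span by simp
  note c = deform_structure_coeff[where g = g and n = n and s = s and u = u and E = E and W = W, OF metric n s u frame]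
  \<comment> \<open>One factor \<open>1 / sqrt s\<close> comes from the rescaled field and one from
    the coefficient. Both are constant, so the derivative is only scaled.\<close>
  have d: "?F i p (structure_coeff ?h ?F 1 2 j) = E i p (structure_coeff g E 1 2 j) / s"
    if ij: "i \<noteq> 3" "j = 1 \<or> j = 2" for i j
  proof -
    have nr: "near p (structure_coeff g E 1 2 j)"
      by (rule nearI[OF structure_coeff_smooth[OF metric frame(1)] p])
    have "E i p (\<lambda>q. 1 / sqrt s * structure_coeff g E 1 2 j q) = E i p (structure_coeff ?h ?F 1 2 j)"
      by (rule tan_cong[OF E(5)[OF p] near_mult[OF near_const[OF top] nr] E(1) p])
        (use ij(2) c(1,2) in auto)
    then have "E i p (structure_coeff ?h ?F 1 2 j) = 1 / sqrt s * E i p (structure_coeff g E 1 2 j)"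
      using tan_cmult[OF E(5)[OF p] nr, of i "1 / sqrt s"] by simp
    then show ?thesis
      using ij(1) s by (simp add: deform_frame_def scaleR_fun_def)
  qed
  have "u p > 0" using u(2) top by blast
  then have uu: "sqrt (u p) * sqrt (u p) = u p" "u p > 0" "sqrt (u p) > 0" by simp_all
  have ss: "sqrt s * sqrt s = s" "sqrt s > 0" using s by simp_all
  show ?thesis
    unfolding K[OF sp] curvature_coeff_3[OF hm hf p] c[OF p]
    using uu ss s
    by (simp add: d plane_C_def plane_P_def plane_Q_def field_simps power2_eq_square)
qed

end

section \<open>Contact structures\<close>

lemma lin_indep2_if_dim_span:
  fixes S T :: "'v::real_vector"
  assumes "dim (span {S, T}) = 2"
  shows "lin_indep2 S T"
proof (rule ccontr)
  assume n: "\<not> lin_indep2 S T"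
  have "\<exists>R. span {S, T} \<subseteq> span {R}"
  proof (cases "S = T \<or> S \<in> span {T}")
    case True
    then have "{S, T} \<subseteq> span {T}" by (auto intro: span_base)
    then show ?thesis using span_minimal[OF _ subspace_span] by blast
  next
    case False
    then have "T = 0"
      using n by (auto simp: lin_indep2_def independent_insert)
    then have "{S, T} \<subseteq> span {S}" by (auto intro: span_base span_zero)
    then show ?thesis using span_minimal[OF _ subspace_span] by blast
  qed
  then obtain R where "span {S, T} \<subseteq> span {R}" by blast
  then have "dim (span {S, T}) \<le> card {R}" by (rule dim_le_card) simp
  then show False using assms by simp
qed

context smooth_space
begin

context
  fixes \<xi> :: "'a \<Rightarrow> 'a tangent set" and \<alpha>
  assumes contact: "contact_structure M A \<xi>" and form: "one_form M A \<alpha>"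
    and kernel: "\<forall>p\<in>topspace M. \<xi> p = {v \<in> tanv p. \<alpha> p v = 0}"
begin

lemma form_linear:
  "p \<in> topspace M \<Longrightarrow> v \<in> tanv p \<Longrightarrow> w \<in> tanv p \<Longrightarrow> \<alpha> p (a *\<^sub>R v + b *\<^sub>R w) = a * \<alpha> p v + b * \<alpha> p w"
  using form by (simp add: one_form_def)

lemma form_smooth: "vfield U X \<Longrightarrow> smooth U (\<lambda>q. \<alpha> q (X q))"
  using form by (simp add: one_form_def)

text \<open>The contact condition supplies the third frame vector: the bracket of two sections spanning
  \<open>\<xi>\<close> is transverse to \<open>\<xi>\<close>, so the dimension of the tangent spaces never has to be computed.\<close>

lemma contact_frame:
  assumes p: "p \<in> topspace M"
  shows "\<exists>U S T Z. p \<in> U \<and> vfield U S \<and> vfield U T \<and> vfield U Z \<and>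
    (\<forall>q\<in>U. \<xi> q = span {S q, T q} \<and> \<alpha> q (Z q) > 0 \<and>
      (\<forall>v\<in>tanv q. \<exists>a b c. v = a *\<^sub>R S q + b *\<^sub>R T q + c *\<^sub>R Z q) \<and>
      (\<forall>a b c. a *\<^sub>R S q + b *\<^sub>R T q + c *\<^sub>R Z q = 0 \<longrightarrow> a = 0 \<and> b = 0 \<and> c = 0))"
proof -
  have pd: "plane_distribution M A \<xi>" using contact by (simp add: contact_structure_def)
  then obtain U S T where U: "p \<in> U" and S: "local_section M A \<xi> U S" and T: "local_section M A \<xi> U T"
    and span: "\<And>q. q \<in> U \<Longrightarrow> \<xi> q = span {S q, T q}"
    using p unfolding plane_distribution_def by meson
  have vS: "vfield U S" and vT: "vfield U T" using S T by (auto simp: local_section_def)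
  have in\<xi>: "S q \<in> \<xi> q" "T q \<in> \<xi> q" if "q \<in> U" for q using S T that by (auto simp: local_section_def)
  note top = vfield_topspace[OF vS]
  have indep: "lin_indep2 (S q) (T q)" if q: "q \<in> U" for q
  proof (rule lin_indep2_if_dim_span)
    show "dim (span {S q, T q}) = 2"
      using pd top[OF q] span[OF q] unfolding plane_distribution_def by metis
  qed
  define B where "B = bracket S T"
  have vB: "vfield U B" unfolding B_def by (rule vfield_bracket[OF vS vT])
  have "B q \<notin> \<xi> q" if "q \<in> U" for q
    using contact S T indep that unfolding contact_structure_def B_def by blast
  then have \<alpha>B: "\<alpha> q (B q) \<noteq> 0" if "q \<in> U" for q
    using kernel[rule_format, OF top[OF that]] vfield_tan[OF vB that] that by auto
  \<comment> \<open>The bracket may lie on either side of \<xi>; multiplying it by its own value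
    under \<alpha> makes \<open>\<alpha> q (Z q)\<close> a nonzero square.\<close>
  define Z where "Z q = \<alpha> q (B q) *\<^sub>R B q" for q
  have vZ: "vfield U Z" unfolding Z_def[abs_def] by (rule vfield_scale[OF form_smooth[OF vB] vB])
  have \<alpha>Z: "\<alpha> q (Z q) > 0" if q: "q \<in> U" for q
  proof -
    have "\<alpha> q (\<alpha> q (B q) *\<^sub>R B q + 0 *\<^sub>R B q) = \<alpha> q (B q) * \<alpha> q (B q) + 0 * \<alpha> q (B q)"
      by (rule form_linear[OF top[OF q] vfield_tan[OF vB q] vfield_tan[OF vB q]])
    then show ?thesis
      using \<alpha>B[OF q] by (simp add: Z_def zero_less_mult_iff linorder_neq_iff[of "\<alpha> q (B q)" 0] disj_commute)
  qed
  have sp: "\<exists>a b c. v = a *\<^sub>R S q + b *\<^sub>R T q + c *\<^sub>R Z q" if q: "q \<in> U" and v: "v \<in> tanv q" for q v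
  proof -
    define c where "c = \<alpha> q v / \<alpha> q (Z q)"
    have "\<alpha> q (1 *\<^sub>R v + (- c) *\<^sub>R Z q) = 1 * \<alpha> q v + (- c) * \<alpha> q (Z q)"
      by (rule form_linear[OF top[OF q] v vfield_tan[OF vZ q]])
    then have "\<alpha> q (v - c *\<^sub>R Z q) = 0" using \<alpha>Z[OF q] by (simp add: c_def)
    moreover have "v - c *\<^sub>R Z q \<in> tanv q" by (intro tan_space_intros v vfield_tan[OF vZ q])
    ultimately have "v - c *\<^sub>R Z q \<in> span {S q, T q}"
      using kernel[rule_format, OF top[OF q]] span[OF q] by blast
    then obtain a where "v - c *\<^sub>R Z q - a *\<^sub>R S q \<in> span {T q}"
      by (metis span_breakdown_eq)
    then obtain b where "v - c *\<^sub>R Z q - a *\<^sub>R S q = b *\<^sub>R T q" by (auto simp: span_singleton)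
    then have "v = a *\<^sub>R S q + b *\<^sub>R T q + c *\<^sub>R Z q" by (simp add: algebra_simps)
    then show ?thesis by blast
  qed
  have ind: "a = 0 \<and> b = 0 \<and> c = 0" if q: "q \<in> U" and 0: "a *\<^sub>R S q + b *\<^sub>R T q + c *\<^sub>R Z q = 0" for q a b c
  proof -
    note t = vfield_tan[OF vS q] vfield_tan[OF vT q] vfield_tan[OF vZ q]
    have z: "\<alpha> q (S q) = 0" "\<alpha> q (T q) = 0" using in\<xi>[OF q] kernel[rule_format, OF top[OF q]] by auto
    have "\<alpha> q (1 *\<^sub>R (a *\<^sub>R S q + b *\<^sub>R T q) + c *\<^sub>R Z q) = 1 * \<alpha> q (a *\<^sub>R S q + b *\<^sub>R T q) + c * \<alpha> q (Z q)"
      by (rule form_linear[OF top[OF q] _ t(3)]) (intro tan_space_intros t)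
    also have "\<alpha> q (a *\<^sub>R S q + b *\<^sub>R T q) = a * \<alpha> q (S q) + b * \<alpha> q (T q)"
      by (rule form_linear[OF top[OF q] t(1,2)])
    finally have "\<alpha> q 0 = 1 * (a * \<alpha> q (S q) + b * \<alpha> q (T q)) + c * \<alpha> q (Z q)"
      unfolding scaleR_one 0 .
    then have "\<alpha> q 0 = c * \<alpha> q (Z q)" using z by simp
    moreover have "\<alpha> q (0 *\<^sub>R S q + 0 *\<^sub>R S q) = 0 * \<alpha> q (S q) + 0 * \<alpha> q (S q)"
      by (rule form_linear[OF top[OF q] t(1,1)])
    ultimately have c: "c = 0" using \<alpha>Z[OF q] by simp
    then have "a *\<^sub>R S q + b *\<^sub>R T q = 0" using 0 by simp
    then show ?thesis using c indep[OF q] unfolding lin_indep2_iff by blast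
  qed
  have "\<forall>q\<in>U. \<xi> q = span {S q, T q} \<and> \<alpha> q (Z q) > 0 \<and>
      (\<forall>v\<in>tanv q. \<exists>a b c. v = a *\<^sub>R S q + b *\<^sub>R T q + c *\<^sub>R Z q) \<and>
      (\<forall>a b c. a *\<^sub>R S q + b *\<^sub>R T q + c *\<^sub>R Z q = 0 \<longrightarrow> a = 0 \<and> b = 0 \<and> c = 0)"
    by (rule ballI, intro conjI[OF span conjI[OF \<alpha>Z conjI[OF ballI[OF sp] allI[OF allI[OF allI[OF impI[OF ind]]]]]]])
  note U vS vT vZ this
  then show ?thesis
    by - (rule exI[of _ U], rule exI[of _ S], rule exI[of _ T], rule exI[of _ Z], intro conjI, assumption+)
qed

lemma contact_metric_exists:
  assumes "Hausdorff_space M" "compact_space M"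
  shows "\<exists>g. riemannian_metric M A g"
proof (rule riemannian_metric_from_separating[OF assms])
  fix p assume p: "p \<in> topspace M"
  obtain U S T Z where U: "p \<in> U" "vfield U S" "vfield U T" "vfield U Z"
    and F: "\<forall>q\<in>U. \<xi> q = span {S q, T q} \<and> \<alpha> q (Z q) > 0 \<and>
      (\<forall>v\<in>tanv q. \<exists>a b c. v = a *\<^sub>R S q + b *\<^sub>R T q + c *\<^sub>R Z q) \<and>
      (\<forall>a b c. a *\<^sub>R S q + b *\<^sub>R T q + c *\<^sub>R Z q = 0 \<longrightarrow> a = 0 \<and> b = 0 \<and> c = 0)"
    using contact_frame[OF p] by (elim exE conjE) (rule that)
  note ex = F[THEN bspec, THEN conjunct2, THEN conjunct2, THEN conjunct1, rule_format]
    and ind = F[THEN bspec, THEN conjunct2, THEN conjunct2, THEN conjunct2, rule_format]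
  show "\<exists>W F. p \<in> W \<and> openin M W \<and> finite F \<and> (\<forall>f\<in>F. smooth W f) \<and>
      (\<forall>q\<in>W. \<forall>v\<in>tanv q. (\<forall>f\<in>F. v f = 0) \<longrightarrow> v = 0)"
    by (rule separating_functions[OF U(2,3,4,1) ex ind[OF U(1)]])
qed

section \<open>Adapted frames and the unit normal\<close>

definition adapted_frame where
  "adapted_frame g W E \<longleftrightarrow> orthonormal_frame g W (E :: 3 \<Rightarrow> 'a \<Rightarrow> 'a tangent) \<and>
     (\<forall>q\<in>W. span {E 1 q, E 2 q} = \<xi> q \<and> \<alpha> q (E 3 q) > 0)"

lemma adapted_frame_exists:
  assumes metric: "riemannian_metric M A g" and p: "p \<in> topspace M"
  shows "\<exists>W E. p \<in> W \<and> adapted_frame g W E"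
proof -
  obtain U S T Z where U: "p \<in> U" "vfield U S" "vfield U T" "vfield U Z"
    and F: "\<forall>q\<in>U. \<xi> q = span {S q, T q} \<and> \<alpha> q (Z q) > 0 \<and>
      (\<forall>v\<in>tanv q. \<exists>a b c. v = a *\<^sub>R S q + b *\<^sub>R T q + c *\<^sub>R Z q) \<and>
      (\<forall>a b c. a *\<^sub>R S q + b *\<^sub>R T q + c *\<^sub>R Z q = 0 \<longrightarrow> a = 0 \<and> b = 0 \<and> c = 0)"
    using contact_frame[OF p] by (elim exE conjE) (rule that)
  note span\<xi> = F[THEN bspec, THEN conjunct1]
    and \<alpha>Z = F[THEN bspec, THEN conjunct2, THEN conjunct1]
  have "\<forall>q\<in>U. \<forall>v\<in>tanv q. \<exists>a b c. v = a *\<^sub>R S q + b *\<^sub>R T q + c *\<^sub>R Z q"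
    "\<forall>q\<in>U. \<forall>a b c. a *\<^sub>R S q + b *\<^sub>R T q + c *\<^sub>R Z q = 0 \<longrightarrow> a = 0 \<and> b = 0 \<and> c = 0"
    using F by simp_all
  from gram_schmidt[OF metric U(2,3,4) this]
  obtain E :: "3 \<Rightarrow> 'a \<Rightarrow> 'a tangent" where frame: "orthonormal_frame g U E"
    and E: "\<forall>q\<in>U. span {E 1 q, E 2 q} = span {S q, T q} \<and> (\<exists>c>0. E 3 q - c *\<^sub>R Z q \<in> span {S q, T q})"
    by (elim exE conjE) (rule that)
  have "\<alpha> q (E 3 q) > 0" if q: "q \<in> U" for q
  proof -
    have top: "q \<in> topspace M" by (rule vfield_topspace[OF U(2) q])
    obtain c where c: "c > 0" "E 3 q - c *\<^sub>R Z q \<in> span {S q, T q}" using E q by blast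
    then have "E 3 q - c *\<^sub>R Z q \<in> tanv q" "\<alpha> q (E 3 q - c *\<^sub>R Z q) = 0"
      using span\<xi>[OF q] kernel[rule_format, OF top] by auto
    moreover have "\<alpha> q (1 *\<^sub>R (E 3 q - c *\<^sub>R Z q) + c *\<^sub>R Z q) = 1 * \<alpha> q (E 3 q - c *\<^sub>R Z q) + c * \<alpha> q (Z q)"
      by (rule form_linear[OF top calculation(1) vfield_tan[OF U(4) q]])
    ultimately show ?thesis using c(1) \<alpha>Z[OF q] by simp
  qed
  then have "adapted_frame g U E"
    using frame E span\<xi> by (simp add: adapted_frame_def)
  then show ?thesis using U(1) by blast
qed

text \<open>The conditions mention no frame, so the field is defined globally; smoothness is then
  read off locally from adapted frames. The sign of \<alpha> selects one of the two unit normals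
  consistently over all of M.\<close>

definition unit_normal where
  "unit_normal g q = (SOME v. v \<in> tanv q \<and> g q v v = 1 \<and> (\<forall>w\<in>\<xi> q. g q v w = (0::real)) \<and> \<alpha> q v > (0::real))"

text \<open>A vector orthogonal to \<xi> is a multiple of \<open>E 3\<close>; unit length leaves
  only a sign, and positivity of \<alpha> decides it. So the choice operator has exactly one
  candidate.\<close>

lemma unit_normal_adapted:
  assumes metric: "riemannian_metric M A g" and frame: "adapted_frame g W E" and q: "q \<in> W"
  shows "unit_normal g q = E 3 q"
  unfolding unit_normal_def
proof (rule some_equality)
  have of: "orthonormal_frame g W E" using frame by (simp add: adapted_frame_def)
  note E = orthonormal_frameD[OF of]
  have sp: "span {E 1 q, E 2 q} = \<xi> q" and pos: "\<alpha> q (E 3 q) > 0"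
    using frame q by (simp_all add: adapted_frame_def)
  have top: "q \<in> topspace M" using E(1) q openin_subset by blast
  note t = E(5)[OF q]
  have "g q (E 3 q) w = 0" if w: "w \<in> \<xi> q" for w
  proof -
    have "w \<in> span {E 1 q, E 2 q}" using w sp by simp
    then obtain a where "w - a *\<^sub>R E 1 q \<in> span {E 2 q}" by (metis span_breakdown_eq)
    then obtain b where b: "w - a *\<^sub>R E 1 q = b *\<^sub>R E 2 q" by (auto simp: span_singleton)
    have "w = a *\<^sub>R E 1 q + b *\<^sub>R E 2 q" unfolding b[symmetric] by simp
    then show ?thesis
      using E(3)[OF q] by (simp add: metric_add_right[OF metric top] metric_scale_right[OF metric top] t tan_space_intros)
  qed
  then show "E 3 q \<in> tanv q \<and> g q (E 3 q) (E 3 q) = 1 \<and> (\<forall>w\<in>\<xi> q. g q (E 3 q) w = 0) \<and> \<alpha> q (E 3 q) > 0"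
    using t E(3)[OF q] pos by simp
  fix v assume v: "v \<in> tanv q \<and> g q v v = 1 \<and> (\<forall>w\<in>\<xi> q. g q v w = 0) \<and> \<alpha> q v > 0"
  have "E 1 q \<in> \<xi> q" "E 2 q \<in> \<xi> q" using sp span_base[of _ "{E 1 q, E 2 q}"] by auto
  then have v': "v = g q v (E 3 q) *\<^sub>R E 3 q"
    using E(4)[OF q, of v] v by (simp add: sum_3)
  let ?c = "g q v (E 3 q)"
  have "?c * ?c = 1"
    using v frame_inner[OF metric of q, of v v] \<open>E 1 q \<in> \<xi> q\<close> \<open>E 2 q \<in> \<xi> q\<close> by (simp add: sum_3)
  moreover have "\<alpha> q (?c *\<^sub>R E 3 q + 0 *\<^sub>R E 3 q) = ?c * \<alpha> q (E 3 q) + 0 * \<alpha> q (E 3 q)"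
    by (rule form_linear[OF top t t])
  then have "?c * \<alpha> q (E 3 q) > 0" using v v' by simp
  then have "?c > 0" using pos by (simp add: zero_less_mult_iff)
  ultimately have "?c = 1" by (simp add: square_eq_1_iff)
  then show "v = E 3 q" using v' by simp
qed

lemma unit_normal_vfield:
  assumes metric: "riemannian_metric M A g"
  shows "vfield (topspace M) (unit_normal g)" "\<forall>q\<in>topspace M. g q (unit_normal g q) (unit_normal g q) = 1"
proof -
  have loc: "\<exists>W E. p \<in> W \<and> orthonormal_frame g W (E :: 3 \<Rightarrow> _) \<and> (\<forall>q\<in>W. unit_normal g q = E 3 q)"
    if p: "p \<in> topspace M" for p
  proof -
    obtain W E where W: "p \<in> W" "adapted_frame g W E" using adapted_frame_exists[OF metric p] by blast
    then have "\<forall>q\<in>W. unit_normal g q = E 3 q" using unit_normal_adapted[OF metric W(2)] by blast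
    moreover have "orthonormal_frame g W E" using W(2) by (simp add: adapted_frame_def)
    ultimately show ?thesis using W(1) by blast
  qed
  show "vfield (topspace M) (unit_normal g)"
  proof (rule vfield_local[OF openin_topspace])
    fix p assume "p \<in> topspace M"
    then obtain W and E :: "3 \<Rightarrow> 'a \<Rightarrow> 'a tangent"
      where W: "p \<in> W" "orthonormal_frame g W E" "\<forall>q\<in>W. unit_normal g q = E 3 q"
      using loc by blast
    have "vfield W (unit_normal g)"
      by (rule vfield_cong[OF orthonormal_frameD(2)[OF W(2), of 3]]) (use W(3) in simp)
    then show "\<exists>W. p \<in> W \<and> vfield W (unit_normal g)" using W(1) by blast
  qed
  show "\<forall>q\<in>topspace M. g q (unit_normal g q) (unit_normal g q) = 1"
  proof
    fix p assume "p \<in> topspace M"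
    then obtain W and E :: "3 \<Rightarrow> 'a \<Rightarrow> 'a tangent"
      where W: "p \<in> W" "orthonormal_frame g W E" "\<forall>q\<in>W. unit_normal g q = E 3 q"
      using loc by blast
    then show "g p (unit_normal g p) (unit_normal g p) = 1"
      using orthonormal_frameD(3)[OF W(2,1), of 3 3] by simp
  qed
qed

text \<open>The coefficient \<open>structure_coeff g E 1 2 3\<close> is the normal component of the
  bracket of two independent sections of \<xi>; were it zero, the bracket would lie in \<xi>,
  against the contact condition.\<close>

lemma plane_C_pos:
  assumes metric: "riemannian_metric M A g" and frame: "adapted_frame g W E" and q: "q \<in> W"
  shows "plane_C g E q > 0"
proof -
  have of: "orthonormal_frame g W E" and sp: "\<And>q. q \<in> W \<Longrightarrow> span {E 1 q, E 2 q} = \<xi> q"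
    using frame by (simp_all add: adapted_frame_def)
  note E = orthonormal_frameD[OF of]
  have in\<xi>: "E 1 q \<in> \<xi> q" "E 2 q \<in> \<xi> q" if "q \<in> W" for q
    using sp[OF that] span_base[of _ "{E 1 q, E 2 q}"] by auto
  have ls: "local_section M A \<xi> W (E 1)" "local_section M A \<xi> W (E 2)"
    using E(2) in\<xi> by (auto simp: local_section_def)
  have li: "\<forall>q\<in>W. lin_indep2 (E 1 q) (E 2 q)"
    using frame_lin_indep2[OF metric of, of _ 1 2] by simp
  have nin: "bracket (E 1) (E 2) q \<notin> \<xi> q"
    using contact ls li q unfolding contact_structure_def by blast
  have "structure_coeff g E 1 2 3 q \<noteq> 0"
  proof
    assume 0: "structure_coeff g E 1 2 3 q = 0"
    let ?B = "bracket (E 1) (E 2) q"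
    have "?B \<in> tanv q" by (rule vfield_tan[OF vfield_bracket[OF E(2,2)] q])
    then have "?B = g q ?B (E 1 q) *\<^sub>R E 1 q + g q ?B (E 2 q) *\<^sub>R E 2 q"
      using E(4)[OF q, of ?B] 0 by (simp add: sum_3 structure_coeff_def)
    also have "\<dots> \<in> span {E 1 q, E 2 q}"
      by (intro span_add span_scale span_base) auto
    finally show False using nin sp[OF q] by simp
  qed
  then show ?thesis by (simp add: plane_C_def)
qed

lemma contact_curvature:
  assumes metric: "riemannian_metric M A g" and frame: "adapted_frame g W E" and q: "q \<in> W"
    and s: "s > 0" and u: "smooth (topspace M) u" "\<forall>q\<in>topspace M. u q > 0"
  shows "distribution_curvature M A (deform g (unit_normal g) s u) \<xi> q =
    - plane_C g E q * u q / s\<^sup>2 + plane_P g E q / s + plane_Q g E q / u q"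
  unfolding distribution_curvature_def
proof (rule deform_curvature[where g = g and n = "unit_normal g" and s = s and u = u and E = E and W = W, OF metric unit_normal_vfield[OF metric] s u])
  have ad: "orthonormal_frame g V F \<and> (\<forall>q\<in>V. unit_normal g q = F 3 q)" if "adapted_frame g V F" for V F
    using that unit_normal_adapted[OF metric that] by (simp add: adapted_frame_def)
  show "\<exists>W (E :: 3 \<Rightarrow> _). p \<in> W \<and> orthonormal_frame g W E \<and> (\<forall>q\<in>W. unit_normal g q = E 3 q)"
    if "p \<in> topspace M" for p
    using adapted_frame_exists[OF metric that] ad by blast
  show "orthonormal_frame g W E" "\<forall>q\<in>W. unit_normal g q = E 3 q"
    using ad[OF frame] by blast+
  show "q \<in> W" by (rule q)
  show "span {E 1 q, E 2 q} = \<xi> q" using frame q by (simp add: adapted_frame_def)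
qed

section \<open>Choice of the rescaling factors\<close>

theorem contact_metric_curvature_minus_one:
  assumes "Hausdorff_space M" and compact: "compact_space M"
  shows "\<exists>g. riemannian_metric M A g \<and> (\<forall>p\<in>topspace M. distribution_curvature M A g \<xi> p = -1)"
proof -
  obtain g where metric: "riemannian_metric M A g" using contact_metric_exists[OF assms] by blast
  let ?n = "unit_normal g"
  define K where "K t q = distribution_curvature M A (deform g ?n 1 (\<lambda>_. t)) \<xi> q" for t q
  txt \<open>The curvatures for \<open>s = 1\<close> and \<open>u = 1, 2, 4\<close> determine \<open>C, P, Q\<close>, which are therefore globally
    defined although \<^const>\<open>plane_C\<close>, \<^const>\<open>plane_P\<close>, \<^const>\<open>plane_Q\<close> refer to a local frame.\<close>
  define Q where "Q q = 4 / 3 * (2 * K 1 q - 3 * K 2 q + K 4 q)" for q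
  define C where "C q = K 1 q - K 2 q - Q q / 2" for q
  define P where "P q = K 1 q + C q - Q q" for q
  have loc: "C q = plane_C g E q" "P q = plane_P g E q" "Q q = plane_Q g E q"
    if fr: "adapted_frame g W E" and q: "q \<in> W" for W E q
  proof -
    have "K t q = - plane_C g E q * t + plane_P g E q + plane_Q g E q / t" if "t > 0" for t
      using contact_curvature[where u = "\<lambda>_. t" and s = 1, OF metric fr q zero_less_one smooth_const[OF openin_topspace]] that
      by (simp add: K_def)
    \<comment> \<open>In \<open>2 * K 1 - 3 * K 2 + K 4\<close> the linear and constant terms cancel
      and the term Q / t contributes 3/4 Q, whence the factor 4/3. Then \<open>K 1 - K 2\<close> is
      C + Q / 2, and P remains from \<open>K 1\<close>.\<close>
    from this[of 1] this[of 2] this[of 4]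
    show Q: "Q q = plane_Q g E q" "C q = plane_C g E q" "P q = plane_P g E q"
      by (simp_all add: Q_def C_def P_def field_simps)
  qed
  have sm: "smooth (topspace M) C" "smooth (topspace M) P" "smooth (topspace M) Q"
  proof -
    have "\<exists>W. p \<in> W \<and> smooth W C \<and> smooth W P \<and> smooth W Q" if p: "p \<in> topspace M" for p
    proof -
      obtain W E where W: "p \<in> W" "adapted_frame g W E" using adapted_frame_exists[OF metric p] by blast
      have "orthonormal_frame g W E" using W(2) by (simp add: adapted_frame_def)
      note ps = plane_smooth[OF metric this]
      have "smooth W C" by (rule smooth_cong[OF ps(1)]) (simp add: loc[OF W(2)])
      moreover have "smooth W P" by (rule smooth_cong[OF ps(2)]) (simp add: loc[OF W(2)])
      moreover have "smooth W Q" by (rule smooth_cong[OF ps(3)]) (simp add: loc[OF W(2)])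
      ultimately show ?thesis using W(1) by blast
    qed
    then show "smooth (topspace M) C" "smooth (topspace M) P" "smooth (topspace M) Q"
      by (auto intro!: smooth_local)
  qed
  have Cpos: "C q > 0" if q: "q \<in> topspace M" for q
  proof -
    obtain W E where W: "q \<in> W" "adapted_frame g W E" using adapted_frame_exists[OF metric q] by blast
    then show ?thesis using loc(1)[OF W(2,1)] plane_C_pos[OF metric W(2,1)] by simp
  qed
  obtain B1 where B1: "\<forall>q\<in>topspace M. \<bar>P q\<bar> \<le> B1" using smooth_bounded[OF compact sm(2)] by blast
  have four: "smooth (topspace M) (\<lambda>q. 4 * C q * Q q)"
    by (intro smooth_mult smooth_const sm openin_topspace)
  obtain B2 where B2: "\<forall>q\<in>topspace M. \<bar>4 * C q * Q q\<bar> \<le> B2" using smooth_bounded[OF compact four] by blast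
  \<comment> \<open>Adding B1 offsets a negative P, so that P + s is at least
    \<open>\<bar>B2\<bar> + 1\<close>. The summand 1 makes this bound at least 1, hence at most its
    own square, and so the discriminant d is positive although Q may be negative.\<close>
  define s where "s = \<bar>B1\<bar> + \<bar>B2\<bar> + 1"
  have s: "s > 0" by (simp add: s_def)
  define d where "d q = (P q + s)\<^sup>2 + 4 * C q * Q q" for q
  have Ps: "P q + s \<ge> \<bar>B2\<bar> + 1" if "q \<in> topspace M" for q
    using B1[rule_format, OF that] by (simp add: s_def)
  have dpos: "d q > 0" if q: "q \<in> topspace M" for q
  proof -
    have "\<bar>B2\<bar> + 1 \<le> (\<bar>B2\<bar> + 1)\<^sup>2"
      by (simp add: power2_eq_square algebra_simps)
    also have "\<dots> \<le> (P q + s)\<^sup>2"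
      by (rule power_mono[OF Ps[OF q]]) simp
    finally show ?thesis
      using B2[rule_format, OF q] by (simp add: d_def)
  qed
  \<comment> \<open>The larger root: P + s and the square root are both positive, so v is positive
    whatever the sign of Q. Positivity of d and C makes it smooth.\<close>
  define v where "v q = (P q + s + sqrt (d q)) / (2 * C q)" for q
  define u where "u q = s * v q" for q
  have vpos: "v q > 0" if q: "q \<in> topspace M" for q
    unfolding v_def
  proof (rule divide_pos_pos)
    show "P q + s + sqrt (d q) > 0"
      using Ps[OF q] real_sqrt_gt_zero[OF dpos[OF q]] by linarith
    show "2 * C q > 0" using Cpos[OF q] by simp
  qed
  have veq: "C q * (v q)\<^sup>2 = (P q + s) * v q + Q q" if q: "q \<in> topspace M" for q
  proof -
    have r: "sqrt (d q) * sqrt (d q) = (P q + s)\<^sup>2 + 4 * C q * Q q"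
      using dpos[OF q] by (simp add: d_def)
    have e: "2 * C q * v q = P q + s + sqrt (d q)" using Cpos[OF q] by (simp add: v_def)
    have "(2 * C q * v q - (P q + s))\<^sup>2 = (P q + s)\<^sup>2 + 4 * C q * Q q"
      unfolding e using r by (simp add: power2_eq_square)
    then have "4 * C q * (C q * (v q)\<^sup>2) = 4 * C q * ((P q + s) * v q + Q q)"
      by (simp add: power2_eq_square algebra_simps)
    then show ?thesis using Cpos[OF q] by simp
  qed
  have Cn: "2 * C q \<noteq> 0" if "q \<in> topspace M" for q using Cpos[OF that] by simp
  have sd: "smooth (topspace M) d"
    unfolding d_def[abs_def] by (intro smooth_add smooth_power smooth_const sm openin_topspace four)
  have "smooth (topspace M) u"
    unfolding u_def[abs_def] v_def
    by (intro smooth_mult smooth_const openin_topspace smooth_divide smooth_add sm smooth_sqrt[OF sd dpos] Cn)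
  moreover have upos: "\<forall>q\<in>topspace M. u q > 0" using vpos s by (simp add: u_def)
  ultimately have u: "smooth (topspace M) u" "\<forall>q\<in>topspace M. u q > 0" by auto
  have "riemannian_metric M A (deform g ?n s u)"
    by (rule deform_metric[where g = g and n = ?n and s = s and u = u, OF metric unit_normal_vfield[OF metric] s u])
  moreover have "distribution_curvature M A (deform g ?n s u) \<xi> p = -1" if p: "p \<in> topspace M" for p
  proof -
    obtain W E where W: "p \<in> W" "adapted_frame g W E" using adapted_frame_exists[OF metric p] by blast
    have "distribution_curvature M A (deform g ?n s u) \<xi> p = - C p * u p / s\<^sup>2 + P p / s + Q p / u p"
      unfolding contact_curvature[where s = s and u = u, OF metric W(2,1) s u] loc[OF W(2,1)] ..
    also have "\<dots> = (- (C p * (v p)\<^sup>2) + P p * v p + Q p) / (s * v p)"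
      using s vpos[OF p] by (simp add: u_def field_simps power2_eq_square)
    also have "\<dots> = -1"
      unfolding veq[OF p] using s vpos[OF p] by (simp add: field_simps)
    finally show ?thesis .
  qed
  ultimately show ?thesis by blast
qed

end

end

theorem corollary4p2:
  fixes M :: "'a topology"
    and A :: "('a, 3) chart set"
    and \<xi> :: "'a \<Rightarrow> 'a tangent set"
  assumes "closed_manifold M A"
    and "orientable_manifold M A"
    and "contact_structure M A \<xi>"
    and "transversally_orientable M A \<xi>"
  shows "\<exists>g. riemannian_metric M A g \<and>
           (\<forall>p\<in>topspace M. distribution_curvature M A g \<xi> p = -1)"
proof -
  interpret smooth_space M A
    using assms(1) by unfold_locales (simp add: closed_manifold_def smooth_manifold_def)
  obtain \<alpha> where "one_form M A \<alpha>" "\<forall>p\<in>topspace M. \<xi> p = {v \<in> tangent_space M A p. \<alpha> p v = 0}"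
    using assms(4) unfolding transversally_orientable_def by blast
  then show ?thesis
    using contact_metric_curvature_minus_one[OF assms(3)] assms(1)
    by (simp add: closed_manifold_def smooth_manifold_def)
qed

end
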